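(* Let $B$ be a finite Kleene algebra, let $D(B)=(W,\preceq_W,M)$ be its dual Kleene space (relation $R$ omitted, since it plays no role), let $(\mathcal N(W),\omega)$ be the associated weighted abstract simplicial complex, and let $P^{\omega}_{\mathcal N(W)}$ be the companion polyhedron. Then the MV-algebra $F(B)$ freely generated by $B$ is isomorphic to the MV-algebra of $\mathbb Z$-maps on $P^{\omega}_{\mathcal N(W)}$: $$F(B)\cong \mathcal M\big(P^{\omega}_{\mathcal N(W)}\big).$$
   Context: An MV-algebra is a structure $(A,\oplus,\neg,0)$ with $(A,\oplus,0)$ a commutative monoid, $\neg\neg x=x$, $x\oplus 1=1$ where $1=\neg 0$, and $\neg(\neg x\oplus y)\oplus y=\neg(\neg y\oplus x)\oplus x$; it has an underlying distributive lattice with $x\vee y=\neg(\neg x\oplus y)\oplus y$, $x\wedge y=\neg(\neg x\vee\neg y)$. A Kleene algebra is a bounded distributive lattice $(A,\vee,\wedge,0,1)$ with a unary $\neg$ satisfying $\neg\neg x=x$, $\neg 0=1$, $\neg(x\wedge y)=\neg x\vee\neg y$ and $(x\wedge\neg x)\vee(y\vee\neg y)=y\vee\neg y$. Every MV-algebra $A$ has an underlying Kleene algebra $U(A)=(A,\vee,\wedge,\neg,0,1)$; this gives a forgetful functor $U$ from MV-algebras to Kleene algebras, and $F$ denotes its left adjoint; $F(B)$ is the MV-algebra freely generated by the Kleene algebra $B$. Let $K=\{0,\tfrac12,1\}$ be the three-element Kleene chain ($0<\tfrac12<1$, $\neg 0=1$, $\neg\tfrac12=\tfrac12$). Let $\preceq$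 be the partial order on $\{0,\tfrac12,1\}$ with $\tfrac12\preceq 0$, $\tfrac12\preceq 1$ and $0,1$ incomparable. For a finite Kleene algebra $B$, its dual Kleene space $D(B)$ has underlying set $W$ = the set of Kleene algebra homomorphisms $h\colon B\to K$, ordered pointwise by $\preceq$ ($h\preceq_W h'$ iff $h(b)\preceq h'(b)$ for all $b$), with distinguished subset $M=\{h\in W: h(B)\subseteq\{0,1\}\}$. The nerve $\mathcal N(W)$ is the abstract simplicial complex of all totally ordered subsets (chains) of the poset $(W,\preceq_W)$. The weight is $\omega(w)=1$ if $w\in M$ and $\omega(w)=2$ otherwise. Enumerate $W=\{w_1,\dots,w_d\}$ and let $e_1,\dots,e_d$ be the standard basis of $\mathbb R^d$; the companion polyhedron is $P^{\omega}_{\mathcal N(W)}=\bigcup_{S\in\mathcal N(W)}\mathrm{conv}\{e_i/\omega(w_i): w_i\in S\}\subseteq\mathbb R^d$. For $X\subseteq[0,1]^d$, a $\mathbb Z$-map on $X$ is the restriction to $X$ of a continuous function $\mathbb R^d\to\mathbb R$ that is piecewise linear with finitely many affine pieces, each an affine polynomial with integer coefficients; $\mathcal M(X)$ is the set of $\mathbb Z$-maps $X\to[0,1]$, an MV-algebra under pointwise operations $(f\oplus g)(x)=\min\{f(x)+g(x),1\}$, $(\neg f)(x)=1-f(x)$, $0$ the constant zero function. *)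

theory Defs
  imports "HOL-Algebra.Congruence" "HOL-Analysis.Analysis"
begin

section \<open>MV-algebras\<close>

record 'a mv = "'a partial_object" +
  mv_add :: "'a \<Rightarrow> 'a \<Rightarrow> 'a"
  mv_neg :: "'a \<Rightarrow> 'a"
  mv_zero :: 'a

definition mv_one :: "('a, 'm) mv_scheme \<Rightarrow> 'a" where
  "mv_one A = mv_neg A (mv_zero A)"

definition mv_join :: "('a, 'm) mv_scheme \<Rightarrow> 'a \<Rightarrow> 'a \<Rightarrow> 'a" where
  "mv_join A x y = mv_add A (mv_neg A (mv_add A (mv_neg A x) y)) y"

definition mv_meet :: "('a, 'm) mv_scheme \<Rightarrow> 'a \<Rightarrow> 'a \<Rightarrow> 'a" where
  "mv_meet A x y = mv_neg A (mv_join A (mv_neg A x) (mv_neg A y))"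

locale mv_algebra =
  fixes A :: "('a, 'm) mv_scheme"
  assumes add_closed: "x \<in> carrier A \<Longrightarrow> y \<in> carrier A \<Longrightarrow> mv_add A x y \<in> carrier A"
    and neg_closed: "x \<in> carrier A \<Longrightarrow> mv_neg A x \<in> carrier A"
    and zero_closed: "mv_zero A \<in> carrier A"
    and add_assoc: "x \<in> carrier A \<Longrightarrow> y \<in> carrier A \<Longrightarrow> z \<in> carrier A \<Longrightarrow>
      mv_add A (mv_add A x y) z = mv_add A x (mv_add A y z)"
    and add_comm: "x \<in> carrier A \<Longrightarrow> y \<in> carrier A \<Longrightarrow> mv_add A x y = mv_add A y x"
    and add_zero: "x \<in> carrier A \<Longrightarrow> mv_add A x (mv_zero A) = x"
    and neg_neg: "x \<in> carrier A \<Longrightarrow> mv_neg A (mv_neg A x) = x"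
    and add_one: "x \<in> carrier A \<Longrightarrow> mv_add A x (mv_one A) = mv_one A"
    and lukasiewicz: "x \<in> carrier A \<Longrightarrow> y \<in> carrier A \<Longrightarrow>
      mv_add A (mv_neg A (mv_add A (mv_neg A x) y)) y =
      mv_add A (mv_neg A (mv_add A (mv_neg A y) x)) x"

definition mv_hom :: "('a, 'm) mv_scheme \<Rightarrow> ('b, 'n) mv_scheme \<Rightarrow> ('a \<Rightarrow> 'b) set" where
  "mv_hom A B = {h \<in> carrier A \<rightarrow>\<^sub>E carrier B.
     (\<forall>x\<in>carrier A. \<forall>y\<in>carrier A. h (mv_add A x y) = mv_add B (h x) (h y)) \<and>
     (\<forall>x\<in>carrier A. h (mv_neg A x) = mv_neg B (h x)) \<and>
     h (mv_zero A) = mv_zero B}"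

definition mv_isomorphic :: "('a, 'm) mv_scheme \<Rightarrow> ('b, 'n) mv_scheme \<Rightarrow> bool" where
  "mv_isomorphic A B \<longleftrightarrow> (\<exists>h\<in>mv_hom A B. bij_betw h (carrier A) (carrier B))"

section \<open>Kleene algebras\<close>

record 'a kleene = "'a partial_object" +
  k_join :: "'a \<Rightarrow> 'a \<Rightarrow> 'a"
  k_meet :: "'a \<Rightarrow> 'a \<Rightarrow> 'a"
  k_neg :: "'a \<Rightarrow> 'a"
  k_zero :: 'a
  k_one :: 'a

locale kleene_algebra =
  fixes B :: "('a, 'm) kleene_scheme"
  assumes join_closed: "x \<in> carrier B \<Longrightarrow> y \<in> carrier B \<Longrightarrow> k_join B x y \<in> carrier B"
    and meet_closed: "x \<in> carrier B \<Longrightarrow> y \<in> carrier B \<Longrightarrow> k_meet B x y \<in> carrier B"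
    and neg_closed: "x \<in> carrier B \<Longrightarrow> k_neg B x \<in> carrier B"
    and zero_closed: "k_zero B \<in> carrier B"
    and one_closed: "k_one B \<in> carrier B"
    and join_assoc: "x \<in> carrier B \<Longrightarrow> y \<in> carrier B \<Longrightarrow> z \<in> carrier B \<Longrightarrow>
      k_join B (k_join B x y) z = k_join B x (k_join B y z)"
    and meet_assoc: "x \<in> carrier B \<Longrightarrow> y \<in> carrier B \<Longrightarrow> z \<in> carrier B \<Longrightarrow>
      k_meet B (k_meet B x y) z = k_meet B x (k_meet B y z)"
    and join_comm: "x \<in> carrier B \<Longrightarrow> y \<in> carrier B \<Longrightarrow> k_join B x y = k_join B y x"
    and meet_comm: "x \<in> carrier B \<Longrightarrow> y \<in> carrier B \<Longrightarrow> k_meet B x y = k_meet B y x"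
    and join_absorb: "x \<in> carrier B \<Longrightarrow> y \<in> carrier B \<Longrightarrow> k_join B x (k_meet B x y) = x"
    and meet_absorb: "x \<in> carrier B \<Longrightarrow> y \<in> carrier B \<Longrightarrow> k_meet B x (k_join B x y) = x"
    and distrib: "x \<in> carrier B \<Longrightarrow> y \<in> carrier B \<Longrightarrow> z \<in> carrier B \<Longrightarrow>
      k_meet B x (k_join B y z) = k_join B (k_meet B x y) (k_meet B x z)"
    and join_zero: "x \<in> carrier B \<Longrightarrow> k_join B x (k_zero B) = x"
    and meet_one: "x \<in> carrier B \<Longrightarrow> k_meet B x (k_one B) = x"
    and neg_neg: "x \<in> carrier B \<Longrightarrow> k_neg B (k_neg B x) = x"
    and neg_zero: "k_neg B (k_zero B) = k_one B"
    and de_morgan: "x \<in> carrier B \<Longrightarrow> y \<in> carrier B \<Longrightarrow>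
      k_neg B (k_meet B x y) = k_join B (k_neg B x) (k_neg B y)"
    and kleene: "x \<in> carrier B \<Longrightarrow> y \<in> carrier B \<Longrightarrow>
      k_join B (k_meet B x (k_neg B x)) (k_join B y (k_neg B y)) = k_join B y (k_neg B y)"

definition kleene_hom :: "('a, 'm) kleene_scheme \<Rightarrow> ('b, 'n) kleene_scheme \<Rightarrow> ('a \<Rightarrow> 'b) set" where
  "kleene_hom A B = {h \<in> carrier A \<rightarrow>\<^sub>E carrier B.
     (\<forall>x\<in>carrier A. \<forall>y\<in>carrier A. h (k_join A x y) = k_join B (h x) (h y)) \<and>
     (\<forall>x\<in>carrier A. \<forall>y\<in>carrier A. h (k_meet A x y) = k_meet B (h x) (h y)) \<and>
     (\<forall>x\<in>carrier A. h (k_neg A x) = k_neg B (h x)) \<and>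
     h (k_zero A) = k_zero B \<and> h (k_one A) = k_one B}"

definition underlying_kleene :: "('a, 'm) mv_scheme \<Rightarrow> 'a kleene" where
  "underlying_kleene A = \<lparr>carrier = carrier A, k_join = mv_join A, k_meet = mv_meet A,
     k_neg = mv_neg A, k_zero = mv_zero A, k_one = mv_one A\<rparr>"

section \<open>The MV-algebra freely generated by a Kleene algebra\<close>

text \<open>
  The value at \<open>B\<close> of the left adjoint of the forgetful functor is built by generators and
  relations: MV-terms over the elements of \<open>B\<close> modulo the least congruence that contains the
  MV-identities and makes \<open>b \<mapsto> [MV_Gen b]\<close> preserve the Kleene operations.  The
  universal property that characterizes it up to isomorphism is \<open>free_mv_universal\<close> below.
\<close>

datatype 'a mv_term = MV_Gen 'a | MV_Zero | MV_Neg "'a mv_term" | MV_Add "'a mv_term" "'a mv_term"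

definition mv_term_algebra :: "'a set \<Rightarrow> 'a mv_term mv" where
  "mv_term_algebra G = \<lparr>carrier = {t. set_mv_term t \<subseteq> G},
     mv_add = MV_Add, mv_neg = MV_Neg, mv_zero = MV_Zero\<rparr>"

abbreviation kleene_terms :: "('a, 'm) kleene_scheme \<Rightarrow> 'a mv_term mv" where
  "kleene_terms B \<equiv> mv_term_algebra (carrier B)"

inductive_set free_mv_cong :: "('a, 'm) kleene_scheme \<Rightarrow> ('a mv_term \<times> 'a mv_term) set"
  for B :: "('a, 'm) kleene_scheme"
  where
    refl: "s \<in> carrier (kleene_terms B) \<Longrightarrow> (s, s) \<in> free_mv_cong B"
  | sym: "(s, t) \<in> free_mv_cong B \<Longrightarrow> (t, s) \<in> free_mv_cong B"
  | trans: "(s, t) \<in> free_mv_cong B \<Longrightarrow> (t, u) \<in> free_mv_cong B \<Longrightarrow> (s, u) \<in> free_mv_cong B"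
  | neg: "(s, t) \<in> free_mv_cong B \<Longrightarrow> (mv_neg (kleene_terms B) s, mv_neg (kleene_terms B) t) \<in> free_mv_cong B"
  | add: "(s, s') \<in> free_mv_cong B \<Longrightarrow> (t, t') \<in> free_mv_cong B \<Longrightarrow>
      (mv_add (kleene_terms B) s t, mv_add (kleene_terms B) s' t') \<in> free_mv_cong B"
  | add_assoc: "s \<in> carrier (kleene_terms B) \<Longrightarrow> t \<in> carrier (kleene_terms B) \<Longrightarrow> u \<in> carrier (kleene_terms B) \<Longrightarrow>
      (mv_add (kleene_terms B) (mv_add (kleene_terms B) s t) u, mv_add (kleene_terms B) s (mv_add (kleene_terms B) t u)) \<in> free_mv_cong B"
  | add_comm: "s \<in> carrier (kleene_terms B) \<Longrightarrow> t \<in> carrier (kleene_terms B) \<Longrightarrow>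
      (mv_add (kleene_terms B) s t, mv_add (kleene_terms B) t s) \<in> free_mv_cong B"
  | add_zero: "s \<in> carrier (kleene_terms B) \<Longrightarrow> (mv_add (kleene_terms B) s (mv_zero (kleene_terms B)), s) \<in> free_mv_cong B"
  | neg_neg: "s \<in> carrier (kleene_terms B) \<Longrightarrow> (mv_neg (kleene_terms B) (mv_neg (kleene_terms B) s), s) \<in> free_mv_cong B"
  | add_one: "s \<in> carrier (kleene_terms B) \<Longrightarrow> (mv_add (kleene_terms B) s (mv_one (kleene_terms B)), mv_one (kleene_terms B)) \<in> free_mv_cong B"
  | lukasiewicz: "s \<in> carrier (kleene_terms B) \<Longrightarrow> t \<in> carrier (kleene_terms B) \<Longrightarrow>
      (mv_add (kleene_terms B) (mv_neg (kleene_terms B) (mv_add (kleene_terms B) (mv_neg (kleene_terms B) s) t)) t,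
       mv_add (kleene_terms B) (mv_neg (kleene_terms B) (mv_add (kleene_terms B) (mv_neg (kleene_terms B) t) s)) s) \<in> free_mv_cong B"
  | gen_join: "a \<in> carrier B \<Longrightarrow> b \<in> carrier B \<Longrightarrow>
      (MV_Gen (k_join B a b), mv_join (kleene_terms B) (MV_Gen a) (MV_Gen b)) \<in> free_mv_cong B"
  | gen_meet: "a \<in> carrier B \<Longrightarrow> b \<in> carrier B \<Longrightarrow>
      (MV_Gen (k_meet B a b), mv_meet (kleene_terms B) (MV_Gen a) (MV_Gen b)) \<in> free_mv_cong B"
  | gen_neg: "a \<in> carrier B \<Longrightarrow> (MV_Gen (k_neg B a), mv_neg (kleene_terms B) (MV_Gen a)) \<in> free_mv_cong B"
  | gen_zero: "(MV_Gen (k_zero B), mv_zero (kleene_terms B)) \<in> free_mv_cong B"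
  | gen_one: "(MV_Gen (k_one B), mv_one (kleene_terms B)) \<in> free_mv_cong B"

definition free_mv :: "('a, 'm) kleene_scheme \<Rightarrow> 'a mv_term set mv" where
  "free_mv B = \<lparr>carrier = carrier (kleene_terms B) // free_mv_cong B,
     mv_add = (\<lambda>X Y. \<Union>s\<in>X. \<Union>t\<in>Y. free_mv_cong B `` {MV_Add s t}),
     mv_neg = (\<lambda>X. \<Union>s\<in>X. free_mv_cong B `` {MV_Neg s}),
     mv_zero = free_mv_cong B `` {MV_Zero}\<rparr>"

definition free_mv_unit :: "('a, 'm) kleene_scheme \<Rightarrow> 'a \<Rightarrow> 'a mv_term set" where
  "free_mv_unit B = (\<lambda>b\<in>carrier B. free_mv_cong B `` {MV_Gen b})"

context
  fixes B :: "('a, 'm) kleene_scheme"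
  assumes B: "kleene_algebra B"
begin

interpretation kleene_algebra B by (rule B)

lemma free_mv_cong_carrier:
  "(s, t) \<in> free_mv_cong B \<Longrightarrow> s \<in> carrier (kleene_terms B) \<and> t \<in> carrier (kleene_terms B)"
  by (induction rule: free_mv_cong.induct)
     (auto simp: mv_term_algebra_def mv_one_def mv_join_def mv_meet_def
        join_closed meet_closed neg_closed zero_closed one_closed)

lemma equiv_free_mv_cong: "equiv (carrier (kleene_terms B)) (free_mv_cong B)"
proof (rule equivI)
  show "free_mv_cong B \<subseteq> carrier (kleene_terms B) \<times> carrier (kleene_terms B)"
    using free_mv_cong_carrier by auto
  show "refl_on (carrier (kleene_terms B)) (free_mv_cong B)"
    by (simp add: refl_on_def free_mv_cong.refl)
  show "Relation.sym (free_mv_cong B)"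
    by (rule symI) (rule free_mv_cong.sym)
  show "Relation.trans (free_mv_cong B)"
    by (rule transI) (rule free_mv_cong.trans)
qed

lemma free_mv_cong_class_eq:
  "(s, t) \<in> free_mv_cong B \<Longrightarrow> free_mv_cong B `` {s} = free_mv_cong B `` {t}"
  using equiv_class_eq[OF equiv_free_mv_cong] .

lemma free_mv_add_class:
  assumes "s \<in> carrier (kleene_terms B)" "t \<in> carrier (kleene_terms B)"
  shows "mv_add (free_mv B) (free_mv_cong B `` {s}) (free_mv_cong B `` {t}) =
    free_mv_cong B `` {MV_Add s t}"
proof -
  have "(\<lambda>s t. free_mv_cong B `` {MV_Add s t}) respects2 free_mv_cong B"
    using free_mv_cong.add[of _ _ B]
    by (intro congruent2I' free_mv_cong_class_eq) (auto simp: mv_term_algebra_def)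
  from UN_equiv_class2[OF equiv_free_mv_cong equiv_free_mv_cong this assms] show ?thesis
    by (simp add: free_mv_def)
qed

lemma free_mv_neg_class:
  assumes "s \<in> carrier (kleene_terms B)"
  shows "mv_neg (free_mv B) (free_mv_cong B `` {s}) = free_mv_cong B `` {MV_Neg s}"
proof -
  have "(\<lambda>s. free_mv_cong B `` {MV_Neg s}) respects free_mv_cong B"
    using free_mv_cong.neg[of _ _ B]
    by (intro congruentI free_mv_cong_class_eq) (auto simp: mv_term_algebra_def)
  from UN_equiv_class[OF equiv_free_mv_cong this assms] show ?thesis
    by (simp add: free_mv_def)
qed

lemma free_mv_carrierE:
  assumes "X \<in> carrier (free_mv B)"
  obtains s where "s \<in> carrier (kleene_terms B)" "X = free_mv_cong B `` {s}"
  using assms by (auto simp: free_mv_def elim: quotientE)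

lemma free_mv_class_closed:
  "s \<in> carrier (kleene_terms B) \<Longrightarrow> free_mv_cong B `` {s} \<in> carrier (free_mv B)"
  by (simp add: free_mv_def quotientI)

lemma kleene_terms_closed:
  "MV_Zero \<in> carrier (kleene_terms B)"
  "b \<in> carrier B \<Longrightarrow> MV_Gen b \<in> carrier (kleene_terms B)"
  "s \<in> carrier (kleene_terms B) \<Longrightarrow> MV_Neg s \<in> carrier (kleene_terms B)"
  "s \<in> carrier (kleene_terms B) \<Longrightarrow> t \<in> carrier (kleene_terms B) \<Longrightarrow>
    MV_Add s t \<in> carrier (kleene_terms B)"
  by (auto simp: mv_term_algebra_def)

lemma kleene_terms_ops:
  "mv_zero (kleene_terms B) = MV_Zero" "mv_neg (kleene_terms B) = MV_Neg"
  "mv_add (kleene_terms B) = MV_Add"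
  by (auto simp: mv_term_algebra_def)

lemma free_mv_zero_class: "mv_zero (free_mv B) = free_mv_cong B `` {MV_Zero}"
  by (simp add: free_mv_def)

lemmas free_mv_class_simps = free_mv_add_class free_mv_neg_class free_mv_zero_class
  free_mv_class_closed kleene_terms_closed

theorem mv_algebra_free_mv: "mv_algebra (free_mv B)"
proof
  fix X Y Z
  assume "X \<in> carrier (free_mv B)" "Y \<in> carrier (free_mv B)" "Z \<in> carrier (free_mv B)"
  then obtain s t u where st: "s \<in> carrier (kleene_terms B)" "t \<in> carrier (kleene_terms B)"
      "u \<in> carrier (kleene_terms B)" and eq: "X = free_mv_cong B `` {s}"
      "Y = free_mv_cong B `` {t}" "Z = free_mv_cong B `` {u}"
    by (metis free_mv_carrierE)
  show "mv_add (free_mv B) (mv_add (free_mv B) X Y) Z = mv_add (free_mv B) X (mv_add (free_mv B) Y Z)"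
    using free_mv_cong_class_eq[OF free_mv_cong.add_assoc[OF st]]
    by (simp add: eq st free_mv_class_simps kleene_terms_ops)
next
  fix X Y assume "X \<in> carrier (free_mv B)" "Y \<in> carrier (free_mv B)"
  then obtain s t where st: "s \<in> carrier (kleene_terms B)" "t \<in> carrier (kleene_terms B)"
      and eq: "X = free_mv_cong B `` {s}" "Y = free_mv_cong B `` {t}"
    by (metis free_mv_carrierE)
  show "mv_add (free_mv B) X Y \<in> carrier (free_mv B)"
    by (simp add: eq st free_mv_class_simps)
  show "mv_add (free_mv B) X Y = mv_add (free_mv B) Y X"
    using free_mv_cong_class_eq[OF free_mv_cong.add_comm[OF st]]
    by (simp add: eq st free_mv_class_simps kleene_terms_ops)
  show "mv_add (free_mv B) (mv_neg (free_mv B) (mv_add (free_mv B) (mv_neg (free_mv B) X) Y)) Y =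
      mv_add (free_mv B) (mv_neg (free_mv B) (mv_add (free_mv B) (mv_neg (free_mv B) Y) X)) X"
    using free_mv_cong_class_eq[OF free_mv_cong.lukasiewicz[OF st]]
    by (simp add: eq st free_mv_class_simps kleene_terms_ops)
next
  fix X assume "X \<in> carrier (free_mv B)"
  then obtain s where st: "s \<in> carrier (kleene_terms B)" and eq: "X = free_mv_cong B `` {s}"
    by (metis free_mv_carrierE)
  show "mv_neg (free_mv B) X \<in> carrier (free_mv B)"
    by (simp add: eq st free_mv_class_simps)
  show "mv_add (free_mv B) X (mv_zero (free_mv B)) = X"
    using free_mv_cong_class_eq[OF free_mv_cong.add_zero[OF st]]
    by (simp add: eq st free_mv_class_simps kleene_terms_ops)
  show "mv_neg (free_mv B) (mv_neg (free_mv B) X) = X"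
    using free_mv_cong_class_eq[OF free_mv_cong.neg_neg[OF st]]
    by (simp add: eq st free_mv_class_simps kleene_terms_ops)
  show "mv_add (free_mv B) X (mv_one (free_mv B)) = mv_one (free_mv B)"
    using free_mv_cong_class_eq[OF free_mv_cong.add_one[OF st]]
    by (simp add: eq st free_mv_class_simps kleene_terms_ops mv_one_def)
qed (simp add: free_mv_class_simps)

theorem free_mv_unit_hom: "free_mv_unit B \<in> kleene_hom B (underlying_kleene (free_mv B))"
proof -
  note defs = underlying_kleene_def mv_join_def mv_meet_def mv_one_def free_mv_unit_def
    free_mv_class_simps kleene_terms_ops join_closed meet_closed neg_closed zero_closed one_closed
  let ?U = "underlying_kleene (free_mv B)" and ?u = "free_mv_unit B"
  have "?u \<in> carrier B \<rightarrow>\<^sub>E carrier ?U"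
    by (auto simp: defs)
  moreover have "?u (k_join B x y) = k_join ?U (?u x) (?u y)"
    "?u (k_meet B x y) = k_meet ?U (?u x) (?u y)" if "x \<in> carrier B" "y \<in> carrier B" for x y
    using free_mv_cong_class_eq[OF free_mv_cong.gen_join[of x B y]]
      free_mv_cong_class_eq[OF free_mv_cong.gen_meet[of x B y]] that
    by (simp_all add: defs)
  moreover have "?u (k_neg B x) = k_neg ?U (?u x)" if "x \<in> carrier B" for x
    using free_mv_cong_class_eq[OF free_mv_cong.gen_neg[OF that]] that by (simp add: defs)
  moreover have "?u (k_zero B) = k_zero ?U"
    using free_mv_cong_class_eq[OF free_mv_cong.gen_zero] by (simp add: defs)
  moreover have "?u (k_one B) = k_one ?U"
    using free_mv_cong_class_eq[OF free_mv_cong.gen_one] by (simp add: defs)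
  ultimately show ?thesis
    unfolding kleene_hom_def by blast
qed

end

primrec mv_eval :: "('b, 'n) mv_scheme \<Rightarrow> ('a \<Rightarrow> 'b) \<Rightarrow> 'a mv_term \<Rightarrow> 'b" where
  "mv_eval A g (MV_Gen a) = g a"
| "mv_eval A g MV_Zero = mv_zero A"
| "mv_eval A g (MV_Neg t) = mv_neg A (mv_eval A g t)"
| "mv_eval A g (MV_Add s t) = mv_add A (mv_eval A g s) (mv_eval A g t)"

theorem free_mv_universal:
  fixes B :: "('a, 'm) kleene_scheme" and A :: "('b, 'n) mv_scheme"
  assumes B: "kleene_algebra B" and A: "mv_algebra A"
    and g: "g \<in> kleene_hom B (underlying_kleene A)"
  shows "\<exists>!h. h \<in> mv_hom (free_mv B) A \<and> (\<forall>b\<in>carrier B. h (free_mv_unit B b) = g b)"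
proof -
  interpret B: kleene_algebra B by (rule B)
  interpret A: mv_algebra A by (rule A)
  note cls = free_mv_class_simps[OF B]
  have g_closed: "g b \<in> carrier A" if "b \<in> carrier B" for b
    using g that by (auto simp: kleene_hom_def underlying_kleene_def)
  have ev_closed: "mv_eval A g s \<in> carrier A" if "s \<in> carrier (kleene_terms B)" for s
    using that by (induction s)
      (auto simp: mv_term_algebra_def g_closed A.add_closed A.neg_closed A.zero_closed)
  have ev_cong: "mv_eval A g s = mv_eval A g t" if "(s, t) \<in> free_mv_cong B" for s t
    using that
  proof (induction rule: free_mv_cong.induct)
    case (add_assoc s t u)
    then show ?case
      by (simp add: kleene_terms_ops[OF B] A.add_assoc ev_closed)
  next
    case (lukasiewicz s t)
    then show ?case
      using A.lukasiewicz ev_closed by (simp add: kleene_terms_ops[OF B])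
  next
    case (add_comm s t)
    then show ?case
      using A.add_comm ev_closed by (simp add: kleene_terms_ops[OF B])
  next
    case (add_one s)
    then show ?case
      using A.add_one ev_closed by (simp add: kleene_terms_ops[OF B] mv_one_def)
  qed (use g in \<open>simp_all add: kleene_terms_ops[OF B] A.add_zero A.neg_neg ev_closed
        mv_one_def mv_join_def mv_meet_def kleene_hom_def underlying_kleene_def\<close>)
  define h where "h = (\<lambda>X\<in>carrier (free_mv B). mv_eval A g (SOME s. s \<in> X))"
  have h_class: "h (free_mv_cong B `` {s}) = mv_eval A g s" if s: "s \<in> carrier (kleene_terms B)" for s
  proof -
    have "s \<in> free_mv_cong B `` {s}"
      using free_mv_cong.refl[OF s] by simp
    then have "(SOME t. t \<in> free_mv_cong B `` {s}) \<in> free_mv_cong B `` {s}"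
      by (rule someI)
    then have "(s, SOME t. t \<in> free_mv_cong B `` {s}) \<in> free_mv_cong B"
      by simp
    from ev_cong[OF this] show ?thesis
      using s by (simp add: h_def free_mv_class_closed[OF B] del: Image_singleton_iff)
  qed
  show ?thesis
  proof (rule ex1I[of _ h])
    have "h \<in> carrier (free_mv B) \<rightarrow>\<^sub>E carrier A"
    proof (rule PiE_I)
      show "h X \<in> carrier A" if "X \<in> carrier (free_mv B)" for X
        using that by (auto elim!: free_mv_carrierE[OF B] simp: h_class ev_closed)
    qed (simp add: h_def)
    then show "h \<in> mv_hom (free_mv B) A \<and> (\<forall>b\<in>carrier B. h (free_mv_unit B b) = g b)"
      by (auto simp: mv_hom_def free_mv_unit_def h_class cls elim!: free_mv_carrierE[OF B])
  next
    fix k assume k: "k \<in> mv_hom (free_mv B) A \<and> (\<forall>b\<in>carrier B. k (free_mv_unit B b) = g b)"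
    have k_class: "k (free_mv_cong B `` {s}) = mv_eval A g s" if "s \<in> carrier (kleene_terms B)" for s
      using that
    proof (induction s)
      case (MV_Gen b)
      then have "b \<in> carrier B" by (simp add: mv_term_algebra_def)
      moreover from this k have "k (free_mv_unit B b) = g b" by blast
      ultimately show ?case by (simp add: free_mv_unit_def)
    next
      case MV_Zero
      have "k (mv_zero (free_mv B)) = mv_zero A"
        using k by (simp add: mv_hom_def)
      then show ?case by (simp add: free_mv_zero_class[OF B])
    next
      case (MV_Neg s)
      then have s: "s \<in> carrier (kleene_terms B)" by (simp add: mv_term_algebra_def)
      have "k (mv_neg (free_mv B) (free_mv_cong B `` {s})) = mv_neg A (k (free_mv_cong B `` {s}))"
        using k free_mv_class_closed[OF B s] by (simp add: mv_hom_def)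
      then show ?case
        using MV_Neg.IH s by (simp add: free_mv_neg_class[OF B])
    next
      case (MV_Add s t)
      then have s: "s \<in> carrier (kleene_terms B)" and t: "t \<in> carrier (kleene_terms B)"
        by (simp_all add: mv_term_algebra_def)
      have "k (mv_add (free_mv B) (free_mv_cong B `` {s}) (free_mv_cong B `` {t})) =
          mv_add A (k (free_mv_cong B `` {s})) (k (free_mv_cong B `` {t}))"
        using k free_mv_class_closed[OF B s] free_mv_class_closed[OF B t] by (simp add: mv_hom_def)
      then show ?case
        using MV_Add.IH s t by (simp add: free_mv_add_class[OF B])
    qed
    show "k = h"
    proof
      fix X
      show "k X = h X"
      proof (cases "X \<in> carrier (free_mv B)")
        case True
        then show ?thesis
          by (auto elim!: free_mv_carrierE[OF B] simp: h_class k_class)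
      next
        case False
        then show ?thesis
          using k by (auto simp: h_def mv_hom_def PiE_def extensional_def)
      qed
    qed
  qed
qed

section \<open>The dual Kleene space of a finite Kleene algebra\<close>

definition K3 :: "real kleene" where
  "K3 = \<lparr>carrier = {0, 1/2, 1}, k_join = max, k_meet = min, k_neg = (\<lambda>x. 1 - x),
     k_zero = 0, k_one = 1\<rparr>"

lemma kleene_algebra_K3: "kleene_algebra K3"
  by unfold_locales (auto simp: K3_def)

definition K3_le :: "real \<Rightarrow> real \<Rightarrow> bool" where
  "K3_le x y \<longleftrightarrow> x \<in> {0, 1/2, 1} \<and> y \<in> {0, 1/2, 1} \<and> (x = y \<or> x = 1/2)"

definition dual_points :: "('a, 'm) kleene_scheme \<Rightarrow> ('a \<Rightarrow> real) set" where
  "dual_points B = kleene_hom B K3"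

definition dual_le :: "('a, 'm) kleene_scheme \<Rightarrow> ('a \<Rightarrow> real) \<Rightarrow> ('a \<Rightarrow> real) \<Rightarrow> bool" where
  "dual_le B h h' \<longleftrightarrow> (\<forall>b\<in>carrier B. K3_le (h b) (h' b))"

definition dual_M :: "('a, 'm) kleene_scheme \<Rightarrow> ('a \<Rightarrow> real) set" where
  "dual_M B = {h \<in> dual_points B. h ` carrier B \<subseteq> {0, 1}}"

definition dual_weight :: "('a, 'm) kleene_scheme \<Rightarrow> ('a \<Rightarrow> real) \<Rightarrow> nat" where
  "dual_weight B w = (if w \<in> dual_M B then 1 else 2)"

definition nerve :: "'w set \<Rightarrow> ('w \<Rightarrow> 'w \<Rightarrow> bool) \<Rightarrow> 'w set set" where
  "nerve W le = {S. S \<subseteq> W \<and> (\<forall>x\<in>S. \<forall>y\<in>S. le x y \<or> le y x)}"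

section \<open>The companion polyhedron and its MV-algebra of Z-maps\<close>

text \<open>
  Points of \<open>\<real>\<^sup>d\<close> are the elements of \<open>topspace (Euclidean_space d)\<close>, that is, real
  sequences vanishing from index \<open>d\<close> on; coordinates are numbered from 0.  The function type is
  not an instance of \<open>real_vector\<close>, so the convex hull of a finite set of points
  is spelled out as the set of their convex combinations.
\<close>

definition conv_finite :: "(nat \<Rightarrow> real) set \<Rightarrow> (nat \<Rightarrow> real) set" where
  "conv_finite V = {(\<lambda>j. \<Sum>v\<in>V. u v * v j) | u. (\<forall>v\<in>V. 0 \<le> u v) \<and> sum u V = 1}"

definition std_basis :: "nat \<Rightarrow> nat \<Rightarrow> real" where
  "std_basis i = (\<lambda>j. if j = i then 1 else 0)"

definition companion_polyhedron ::
    "nat \<Rightarrow> (nat \<Rightarrow> 'w) \<Rightarrow> 'w set set \<Rightarrow> ('w \<Rightarrow> nat) \<Rightarrow> (nat \<Rightarrow> real) set" where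
  "companion_polyhedron d w N \<omega> =
     (\<Union>S\<in>N. conv_finite {(\<lambda>j. std_basis i j / real (\<omega> (w i))) | i. i < d \<and> w i \<in> S})"

definition int_affine :: "nat \<Rightarrow> ((nat \<Rightarrow> real) \<Rightarrow> real) set" where
  "int_affine d = {(\<lambda>x. real_of_int c + (\<Sum>i<d. real_of_int (a i) * x i)) | (c :: int) (a :: nat \<Rightarrow> int). True}"

definition int_piecewise_linear :: "nat \<Rightarrow> ((nat \<Rightarrow> real) \<Rightarrow> real) \<Rightarrow> bool" where
  "int_piecewise_linear d f \<longleftrightarrow>
     continuous_map (Euclidean_space d) euclideanreal f \<and>
     (\<exists>L. finite L \<and> L \<subseteq> int_affine d \<and> (\<forall>x\<in>topspace (Euclidean_space d). \<exists>l\<in>L. f x = l x))"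

definition zmap_algebra :: "nat \<Rightarrow> (nat \<Rightarrow> real) set \<Rightarrow> ((nat \<Rightarrow> real) \<Rightarrow> real) mv" where
  "zmap_algebra d X =
     \<lparr>carrier = {restrict f X | f. int_piecewise_linear d f \<and> f ` X \<subseteq> {0..1}},
      mv_add = (\<lambda>f g. \<lambda>x\<in>X. min (f x + g x) 1),
      mv_neg = (\<lambda>f. \<lambda>x\<in>X. 1 - f x),
      mv_zero = (\<lambda>x\<in>X. 0)\<rparr>"

lemma int_piecewise_linear_const: "int_piecewise_linear d (\<lambda>x. real_of_int c)"
  unfolding int_piecewise_linear_def
  by (intro conjI exI[of _ "{\<lambda>x. real_of_int c}"])
     (auto simp: int_affine_def intro!: exI[of _ c] exI[of _ "\<lambda>_. 0"])

lemma int_affine_add: "l \<in> int_affine d \<Longrightarrow> m \<in> int_affine d \<Longrightarrow> (\<lambda>x. l x + m x) \<in> int_affine d"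
proof -
  assume "l \<in> int_affine d" "m \<in> int_affine d"
  then obtain c a c' a' where "l = (\<lambda>x. real_of_int c + (\<Sum>i<d. real_of_int (a i) * x i))"
    "m = (\<lambda>x. real_of_int c' + (\<Sum>i<d. real_of_int (a' i) * x i))"
    by (auto simp: int_affine_def)
  then have "(\<lambda>x. l x + m x) =
      (\<lambda>x. real_of_int (c + c') + (\<Sum>i<d. real_of_int (a i + a' i) * x i))"
    by (simp add: algebra_simps sum.distrib)
  then show ?thesis
    unfolding int_affine_def by (auto intro!: exI[of _ "c + c'"] exI[of _ "\<lambda>i. a i + a' i"])
qed

lemma int_affine_minus: "l \<in> int_affine d \<Longrightarrow> (\<lambda>x. - l x) \<in> int_affine d"
proof -
  assume "l \<in> int_affine d"
  then obtain c a where "l = (\<lambda>x. real_of_int c + (\<Sum>i<d. real_of_int (a i) * x i))"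
    by (auto simp: int_affine_def)
  then have "(\<lambda>x. - l x) = (\<lambda>x. real_of_int (- c) + (\<Sum>i<d. real_of_int (- a i) * x i))"
    by (simp add: sum_negf)
  then show ?thesis
    unfolding int_affine_def by (auto intro!: exI[of _ "- c"] exI[of _ "\<lambda>i. - a i"])
qed

lemma int_piecewise_linear_add:
  assumes "int_piecewise_linear d f" "int_piecewise_linear d g"
  shows "int_piecewise_linear d (\<lambda>x. f x + g x)"
proof -
  obtain L M where L: "finite L" "L \<subseteq> int_affine d" "\<forall>x\<in>topspace (Euclidean_space d). \<exists>l\<in>L. f x = l x"
    and M: "finite M" "M \<subseteq> int_affine d" "\<forall>x\<in>topspace (Euclidean_space d). \<exists>l\<in>M. g x = l x"
    using assms by (auto simp: int_piecewise_linear_def)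
  let ?S = "(\<lambda>(l, m) x. l x + m x) ` (L \<times> M)"
  have "finite ?S" using L M by simp
  moreover have "?S \<subseteq> int_affine d" using L(2) M(2) by (auto intro!: int_affine_add)
  moreover have "\<exists>l\<in>?S. f x + g x = l x" if x: "x \<in> topspace (Euclidean_space d)" for x
  proof -
    obtain l where l: "l \<in> L" "f x = l x"
      using bspec[OF L(3) x] by (rule bexE)
    obtain m where m: "m \<in> M" "g x = m x"
      using bspec[OF M(3) x] by (rule bexE)
    note lm = l m
    have "(\<lambda>x. l x + m x) \<in> ?S"
      using lm by (intro image_eqI[of _ _ "(l, m)"]) simp_all
    then show ?thesis
      by (rule bexI[rotated]) (simp only: lm)
  qed
  moreover have "continuous_map (Euclidean_space d) euclideanreal (\<lambda>x. f x + g x)"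
    using assms by (simp add: int_piecewise_linear_def continuous_map_add)
  ultimately show ?thesis
    unfolding int_piecewise_linear_def by (intro conjI exI[of _ ?S] ballI)
qed

lemma int_piecewise_linear_minus:
  assumes "int_piecewise_linear d f"
  shows "int_piecewise_linear d (\<lambda>x. - f x)"
proof -
  obtain L where L: "finite L" "L \<subseteq> int_affine d" "\<forall>x\<in>topspace (Euclidean_space d). \<exists>l\<in>L. f x = l x"
    using assms by (auto simp: int_piecewise_linear_def)
  let ?S = "(\<lambda>l x. - l x) ` L"
  have "finite ?S" using L by simp
  moreover have "?S \<subseteq> int_affine d" using L int_affine_minus by fastforce
  moreover have "\<forall>x\<in>topspace (Euclidean_space d). \<exists>l\<in>?S. - f x = l x"
    using L by fastforce
  ultimately show ?thesis
    using assms unfolding int_piecewise_linear_def by (blast intro: continuous_map_minus)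
qed

lemma int_piecewise_linear_min:
  assumes "int_piecewise_linear d f" "int_piecewise_linear d g"
  shows "int_piecewise_linear d (\<lambda>x. min (f x) (g x))"
proof -
  obtain L M where L: "finite L" "L \<subseteq> int_affine d" "\<forall>x\<in>topspace (Euclidean_space d). \<exists>l\<in>L. f x = l x"
    and M: "finite M" "M \<subseteq> int_affine d" "\<forall>x\<in>topspace (Euclidean_space d). \<exists>l\<in>M. g x = l x"
    using assms by (auto simp: int_piecewise_linear_def)
  have "\<forall>x\<in>topspace (Euclidean_space d). \<exists>l\<in>L \<union> M. min (f x) (g x) = l x"
    using L M by (fastforce simp: min_def)
  moreover have "finite (L \<union> M)" "L \<union> M \<subseteq> int_affine d" using L M by auto
  ultimately show ?thesis
    using assms unfolding int_piecewise_linear_def by (blast intro: continuous_map_real_min)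
qed

theorem mv_algebra_zmap_algebra: "mv_algebra (zmap_algebra d X)"
proof -
  let ?A = "zmap_algebra d X"
  have ops: "mv_add ?A = (\<lambda>f g. \<lambda>x\<in>X. min (f x + g x) 1)" "mv_neg ?A = (\<lambda>f. \<lambda>x\<in>X. 1 - f x)"
    "mv_zero ?A = (\<lambda>x\<in>X. 0)"
    by (simp_all add: zmap_algebra_def)
  have carr: "f \<in> extensional X \<and> (\<forall>x\<in>X. 0 \<le> f x \<and> f x \<le> 1)" if "f \<in> carrier ?A" for f
    using that by (auto simp: zmap_algebra_def)
  have eqI: "f = g" if "f \<in> extensional X" "g \<in> extensional X" "\<And>x. x \<in> X \<Longrightarrow> f x = g x"
    for f g :: "(nat \<Rightarrow> real) \<Rightarrow> real"
    using that by (rule extensionalityI)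
  show ?thesis
  proof
    fix f g assume "f \<in> carrier ?A" "g \<in> carrier ?A"
    then obtain f' g' where f': "f = restrict f' X" "int_piecewise_linear d f'" "f' ` X \<subseteq> {0..1}"
      and g': "g = restrict g' X" "int_piecewise_linear d g'" "g' ` X \<subseteq> {0..1}"
      by (auto simp: zmap_algebra_def)
    have "int_piecewise_linear d (\<lambda>x. min (f' x + g' x) 1)"
      using int_piecewise_linear_min[OF int_piecewise_linear_add[OF f'(2) g'(2)]
          int_piecewise_linear_const[of d 1]] by simp
    moreover have "(\<lambda>x\<in>X. min (f x + g x) 1) = restrict (\<lambda>x. min (f' x + g' x) 1) X"
      using f' g' by (auto simp: fun_eq_iff)
    moreover have "(\<lambda>x. min (f' x + g' x) 1) ` X \<subseteq> {0..1}"
      using f'(3) g'(3) by (force simp: image_subset_iff)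
    ultimately show "mv_add ?A f g \<in> carrier ?A"
      unfolding zmap_algebra_def by auto
  next
    fix f assume "f \<in> carrier ?A"
    then obtain f' where f': "f = restrict f' X" "int_piecewise_linear d f'" "f' ` X \<subseteq> {0..1}"
      by (auto simp: zmap_algebra_def)
    have "int_piecewise_linear d (\<lambda>x. 1 - f' x)"
      using int_piecewise_linear_add[OF int_piecewise_linear_const[of d 1]
          int_piecewise_linear_minus[OF f'(2)]] by simp
    moreover have "(\<lambda>x\<in>X. 1 - f x) = restrict (\<lambda>x. 1 - f' x) X"
      using f' by (auto simp: fun_eq_iff)
    moreover have "(\<lambda>x. 1 - f' x) ` X \<subseteq> {0..1}"
      using f'(3) by (force simp: image_subset_iff)
    ultimately show "mv_neg ?A f \<in> carrier ?A"
      unfolding zmap_algebra_def by auto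
  next
    show "mv_zero ?A \<in> carrier ?A"
      using int_piecewise_linear_const[of d 0] unfolding zmap_algebra_def by force
  next
    fix f g h assume "f \<in> carrier ?A" "g \<in> carrier ?A" "h \<in> carrier ?A"
    then have *: "0 \<le> f x" "0 \<le> g x" "0 \<le> h x" if "x \<in> X" for x
      using carr that by blast+
    show "mv_add ?A (mv_add ?A f g) h = mv_add ?A f (mv_add ?A g h)"
    proof (unfold ops, rule eqI)
      fix x assume "x \<in> X"
      with *[of x] show "(\<lambda>x\<in>X. min ((\<lambda>x\<in>X. min (f x + g x) 1) x + h x) 1) x =
          (\<lambda>x\<in>X. min (f x + (\<lambda>x\<in>X. min (g x + h x) 1) x) 1) x"
        by (simp add: min_def)
    qed simp_all
  next
    fix f g assume "f \<in> carrier ?A" "g \<in> carrier ?A"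
    then have *: "0 \<le> f x" "0 \<le> g x" "f x \<le> 1" "g x \<le> 1" if "x \<in> X" for x
      using carr that by blast+
    show "mv_add ?A f g = mv_add ?A g f"
      unfolding ops by (rule eqI) (auto simp: add.commute)
    show "mv_add ?A (mv_neg ?A (mv_add ?A (mv_neg ?A f) g)) g =
        mv_add ?A (mv_neg ?A (mv_add ?A (mv_neg ?A g) f)) f"
      unfolding ops by (rule eqI) (use * in \<open>auto simp: min_def\<close>)
  next
    fix f assume "f \<in> carrier ?A"
    then have ext: "f \<in> extensional X" and *: "\<And>x. x \<in> X \<Longrightarrow> 0 \<le> f x \<and> f x \<le> 1"
      using carr by blast+
    show "mv_add ?A f (mv_zero ?A) = f" "mv_neg ?A (mv_neg ?A f) = f"
      unfolding ops by (rule eqI; use ext * in \<open>simp add: min_def\<close>)+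
    show "mv_add ?A f (mv_one ?A) = mv_one ?A"
      unfolding ops mv_one_def by (rule eqI) (auto simp: min_def dest!: *)
  qed
qed

end

theory Submission
  imports Defs "HOL-Algebra.FiniteProduct" "HOL-Library.Function_Algebras"
begin

text \<open>
  Each \<open>b \<in> B\<close> gives the function \<open>lin b x = (\<Sum>i. \<omega> i * w i b * x i)\<close> on the polyhedron \<open>P\<close>.  It is linear
  with integer coefficients, takes the value \<open>w i b\<close> at the \<open>i\<close>-th vertex, and turns the Kleene operations
  into pointwise ones, because on the chain supporting \<open>x\<close> two elements of \<open>B\<close> compare the same way
  everywhere.  This induces a homomorphism from the free algebra to the Z-maps.

  Injectivity: distinct elements of the free algebra differ in some chain quotient.  An MV-chain is the
  unit interval of Chang's totally ordered group, and finitely many linear inequalities over the integers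
  that hold in a totally ordered group also have a real solution, by Fourier--Motzkin elimination.  So
  the elements are separated by a Kleene homomorphism \<open>B \<rightarrow> [0, 1]\<close>, and averaging the thresholds of such a
  homomorphism shows that it is evaluation at a point of \<open>P\<close>.

  Surjectivity: some \<open>c \<in> B\<close> has \<open>w j c = 1 / \<omega> j\<close> on the downset of \<open>i\<close> and vanishes elsewhere, so the sums
  of coordinates over downsets, and hence the coordinates, come from the free algebra.  Therefore so does
  every truncated integral affine function, and a continuous piecewise linear function is a maximum of
  minima of its affine pieces (McNaughton's theorem).
\<close>

section \<open>Order and ideals of MV-algebras\<close>

context mv_algebra
begin

abbreviation madd (infixl "\<oplus>" 65) where "x \<oplus> y \<equiv> mv_add A x y"
abbreviation mneg ("\<sim> _" [81] 80) where "\<sim> x \<equiv> mv_neg A x"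
abbreviation mzero ("\<^bold>0") where "\<^bold>0 \<equiv> mv_zero A"
abbreviation mone ("\<^bold>1") where "\<^bold>1 \<equiv> mv_one A"
abbreviation mdiff (infixl "\<ominus>" 65) where "x \<ominus> y \<equiv> \<sim> (\<sim> x \<oplus> y)"
abbreviation mprod (infixl "\<odot>" 70) where "x \<odot> y \<equiv> \<sim> (\<sim> x \<oplus> \<sim> y)"
abbreviation mjoin (infixl "\<curlyvee>" 65) where "x \<curlyvee> y \<equiv> mv_join A x y"
abbreviation mmeet (infixl "\<curlywedge>" 70) where "x \<curlywedge> y \<equiv> mv_meet A x y"

definition mle (infix "\<preceq>" 50) where "x \<preceq> y \<longleftrightarrow> \<sim> x \<oplus> y = \<^bold>1"

lemma one_closed: "\<^bold>1 \<in> carrier A"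
  by (simp add: mv_one_def neg_closed zero_closed)

lemmas closed [simp] = add_closed neg_closed zero_closed one_closed

lemma join_closed [simp]: "x \<in> carrier A \<Longrightarrow> y \<in> carrier A \<Longrightarrow> x \<curlyvee> y \<in> carrier A"
  by (simp add: mv_join_def)

lemma meet_closed [simp]: "x \<in> carrier A \<Longrightarrow> y \<in> carrier A \<Longrightarrow> x \<curlywedge> y \<in> carrier A"
  by (simp add: mv_meet_def)

lemma neg_zero [simp]: "\<sim> \<^bold>0 = \<^bold>1"
  by (simp add: mv_one_def)

lemma neg_one [simp]: "\<sim> \<^bold>1 = \<^bold>0"
  by (simp add: mv_one_def neg_neg zero_closed del: neg_zero)

lemma zero_add: "x \<in> carrier A \<Longrightarrow> \<^bold>0 \<oplus> x = x"
  by (simp add: add_comm[of "\<^bold>0"] add_zero)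

lemma one_add: "x \<in> carrier A \<Longrightarrow> \<^bold>1 \<oplus> x = \<^bold>1"
  by (simp add: add_comm[of "\<^bold>1"] add_one)

lemmas units [simp] = add_zero add_one zero_add one_add neg_neg

lemma neg_eq_iff: "x \<in> carrier A \<Longrightarrow> y \<in> carrier A \<Longrightarrow> \<sim> x = \<sim> y \<longleftrightarrow> x = y"
  by (metis neg_neg)

lemma add_left_comm:
  "x \<in> carrier A \<Longrightarrow> y \<in> carrier A \<Longrightarrow> z \<in> carrier A \<Longrightarrow> x \<oplus> (y \<oplus> z) = y \<oplus> (x \<oplus> z)"
  by (metis add_assoc add_comm)

lemmas add_ac = add_assoc add_comm add_left_comm

lemma neg_add [simp]: "x \<in> carrier A \<Longrightarrow> \<sim> x \<oplus> x = \<^bold>1"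
  using lukasiewicz[of x "\<^bold>1"] by simp

lemma add_neg [simp]: "x \<in> carrier A \<Longrightarrow> x \<oplus> \<sim> x = \<^bold>1"
  by (simp add: add_comm[of x])

lemma le_refl [simp]: "x \<in> carrier A \<Longrightarrow> x \<preceq> x"
  by (simp add: mle_def)

lemma le_add [simp]: "x \<in> carrier A \<Longrightarrow> y \<in> carrier A \<Longrightarrow> x \<preceq> x \<oplus> y"
  by (simp add: mle_def add_assoc[symmetric])

lemma le_add2 [simp]: "x \<in> carrier A \<Longrightarrow> y \<in> carrier A \<Longrightarrow> x \<preceq> y \<oplus> x"
  by (simp add: add_comm[of y])

lemma add_diff_of_le: "x \<in> carrier A \<Longrightarrow> y \<in> carrier A \<Longrightarrow> x \<preceq> y \<Longrightarrow> x \<oplus> (y \<ominus> x) = y"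
  using lukasiewicz[of x y] by (simp add: mle_def add_comm)

lemma le_antisym: "x \<in> carrier A \<Longrightarrow> y \<in> carrier A \<Longrightarrow> x \<preceq> y \<Longrightarrow> y \<preceq> x \<Longrightarrow> x = y"
  using lukasiewicz[of x y] by (simp add: mle_def)

lemma le_iff_ex_add:
  assumes "x \<in> carrier A" "y \<in> carrier A"
  shows "x \<preceq> y \<longleftrightarrow> (\<exists>z\<in>carrier A. y = x \<oplus> z)"
proof
  assume "x \<preceq> y"
  then show "\<exists>z\<in>carrier A. y = x \<oplus> z"
    using assms by (intro bexI[of _ "y \<ominus> x"]) (simp_all add: add_diff_of_le)
qed (use assms in auto)

lemma le_trans:
  assumes "x \<preceq> y" "y \<preceq> z" "x \<in> carrier A" "y \<in> carrier A" "z \<in> carrier A"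
  shows "x \<preceq> z"
proof -
  obtain u v where "u \<in> carrier A" "v \<in> carrier A" "y = x \<oplus> u" "z = y \<oplus> v"
    using assms by (auto simp: le_iff_ex_add)
  then have "u \<oplus> v \<in> carrier A" "z = x \<oplus> (u \<oplus> v)"
    using assms by (simp_all add: add_assoc)
  then show ?thesis
    using assms le_iff_ex_add by blast
qed

lemma add_mono:
  assumes "x \<preceq> y" "u \<preceq> v" "x \<in> carrier A" "y \<in> carrier A" "u \<in> carrier A" "v \<in> carrier A"
  shows "x \<oplus> u \<preceq> y \<oplus> v"
proof -
  obtain s t where "s \<in> carrier A" "t \<in> carrier A" "y = x \<oplus> s" "v = u \<oplus> t"
    using assms by (auto simp: le_iff_ex_add)
  then have "s \<oplus> t \<in> carrier A" "y \<oplus> v = (x \<oplus> u) \<oplus> (s \<oplus> t)"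
    using assms by (simp_all add: add_ac)
  then show ?thesis
    using assms le_iff_ex_add add_closed by metis
qed

lemma zero_le [simp]: "x \<in> carrier A \<Longrightarrow> \<^bold>0 \<preceq> x"
  by (simp add: mle_def)

lemma le_one [simp]: "x \<in> carrier A \<Longrightarrow> x \<preceq> \<^bold>1"
  by (simp add: mle_def)

lemma le_zero_iff: "x \<in> carrier A \<Longrightarrow> x \<preceq> \<^bold>0 \<longleftrightarrow> x = \<^bold>0"
  using le_antisym by auto

lemma one_le_iff: "x \<in> carrier A \<Longrightarrow> \<^bold>1 \<preceq> x \<longleftrightarrow> x = \<^bold>1"
  by (simp add: mle_def)

lemma neg_le_neg_iff: "x \<in> carrier A \<Longrightarrow> y \<in> carrier A \<Longrightarrow> \<sim> y \<preceq> \<sim> x \<longleftrightarrow> x \<preceq> y"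
  by (simp add: mle_def add_comm)

lemma diff_le_iff:
  "x \<in> carrier A \<Longrightarrow> y \<in> carrier A \<Longrightarrow> z \<in> carrier A \<Longrightarrow> x \<ominus> y \<preceq> z \<longleftrightarrow> x \<preceq> y \<oplus> z"
  by (simp add: mle_def add_assoc)

lemma diff_eq_zero_iff: "x \<in> carrier A \<Longrightarrow> y \<in> carrier A \<Longrightarrow> x \<ominus> y = \<^bold>0 \<longleftrightarrow> x \<preceq> y"
  using diff_le_iff[of x y "\<^bold>0"] by (simp add: le_zero_iff)

lemma le_add_diff: "x \<in> carrier A \<Longrightarrow> y \<in> carrier A \<Longrightarrow> x \<preceq> y \<oplus> (x \<ominus> y)"
  by (simp flip: diff_le_iff)

lemma diff_le: "x \<in> carrier A \<Longrightarrow> y \<in> carrier A \<Longrightarrow> x \<ominus> y \<preceq> x"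
  by (simp add: diff_le_iff)

lemma diff_mono:
  assumes "x \<preceq> y" "x \<in> carrier A" "y \<in> carrier A" "z \<in> carrier A"
  shows "x \<ominus> z \<preceq> y \<ominus> z"
  using le_trans[OF assms(1) le_add_diff] assms by (simp add: diff_le_iff)

lemma diff_antimono:
  assumes "x \<preceq> y" "x \<in> carrier A" "y \<in> carrier A" "z \<in> carrier A"
  shows "z \<ominus> y \<preceq> z \<ominus> x"
  using diff_mono[of "\<sim> y" "\<sim> x" "\<sim> z"] assms by (simp add: neg_le_neg_iff add_comm)

lemma diff_triangle:
  assumes [simp]: "x \<in> carrier A" "y \<in> carrier A" "z \<in> carrier A"
  shows "x \<ominus> z \<preceq> (x \<ominus> y) \<oplus> (y \<ominus> z)"
proof -
  have "x \<preceq> y \<oplus> (x \<ominus> y)" "y \<oplus> (x \<ominus> y) \<preceq> z \<oplus> (y \<ominus> z) \<oplus> (x \<ominus> y)"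
    by (simp_all add: le_add_diff add_mono)
  then have "x \<preceq> z \<oplus> (y \<ominus> z) \<oplus> (x \<ominus> y)"
    by (rule le_trans) simp_all
  then show ?thesis
    by (simp add: diff_le_iff add_assoc add_comm[of "x \<ominus> y"])
qed

lemma diff_add_le:
  assumes [simp]: "x \<in> carrier A" "y \<in> carrier A" "z \<in> carrier A"
  shows "(x \<oplus> z) \<ominus> (y \<oplus> z) \<preceq> x \<ominus> y"
proof -
  have "x \<oplus> z \<preceq> (y \<oplus> (x \<ominus> y)) \<oplus> z"
    by (intro add_mono le_add_diff) simp_all
  then show ?thesis
    by (simp add: diff_le_iff add_assoc add_comm[of z])
qed

lemma join_comm: "x \<in> carrier A \<Longrightarrow> y \<in> carrier A \<Longrightarrow> x \<curlyvee> y = y \<curlyvee> x"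
  unfolding mv_join_def by (rule lukasiewicz)

lemma le_join2: "x \<in> carrier A \<Longrightarrow> y \<in> carrier A \<Longrightarrow> y \<preceq> x \<curlyvee> y"
  by (simp add: mv_join_def)

lemma le_join1: "x \<in> carrier A \<Longrightarrow> y \<in> carrier A \<Longrightarrow> x \<preceq> x \<curlyvee> y"
  by (simp add: join_comm[of x] le_join2)

lemma join_least:
  assumes "x \<preceq> z" "y \<preceq> z" "x \<in> carrier A" "y \<in> carrier A" "z \<in> carrier A"
  shows "x \<curlyvee> y \<preceq> z"
proof -
  have "(x \<ominus> y) \<oplus> y \<preceq> (z \<ominus> y) \<oplus> y"
    using assms by (intro add_mono diff_mono) simp_all
  also have "(z \<ominus> y) \<oplus> y = z"
    using assms by (simp add: add_diff_of_le add_comm[of "z \<ominus> y"])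
  finally show ?thesis by (simp add: mv_join_def)
qed

lemma meet_comm: "x \<in> carrier A \<Longrightarrow> y \<in> carrier A \<Longrightarrow> x \<curlywedge> y = y \<curlywedge> x"
  by (simp add: mv_meet_def join_comm)

lemma meet_le1: "x \<in> carrier A \<Longrightarrow> y \<in> carrier A \<Longrightarrow> x \<curlywedge> y \<preceq> x"
  using neg_le_neg_iff[of "x \<curlywedge> y" x] by (simp add: mv_meet_def le_join1)

lemma meet_le2: "x \<in> carrier A \<Longrightarrow> y \<in> carrier A \<Longrightarrow> x \<curlywedge> y \<preceq> y"
  by (simp add: meet_comm[of x] meet_le1)

lemma meet_greatest:
  assumes "z \<preceq> x" "z \<preceq> y" "x \<in> carrier A" "y \<in> carrier A" "z \<in> carrier A"
  shows "z \<preceq> x \<curlywedge> y"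
  using join_least[of "\<sim> x" "\<sim> z" "\<sim> y"] neg_le_neg_iff[of z "x \<curlywedge> y"] assms
  by (simp add: mv_meet_def neg_le_neg_iff)

lemma meet_eq_left: "x \<preceq> y \<Longrightarrow> x \<in> carrier A \<Longrightarrow> y \<in> carrier A \<Longrightarrow> x \<curlywedge> y = x"
  by (intro le_antisym meet_le1 meet_greatest) simp_all

lemma add_diff_cancel:
  assumes "x \<preceq> \<sim> y" "x \<in> carrier A" "y \<in> carrier A"
  shows "(x \<oplus> y) \<ominus> y = x"
  using meet_eq_left[OF assms(1)] assms by (simp add: mv_meet_def mv_join_def)

lemma le_add_meet:
  assumes "z \<preceq> a \<oplus> x" "z \<preceq> a \<oplus> y"
    and "a \<in> carrier A" "x \<in> carrier A" "y \<in> carrier A" "z \<in> carrier A"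
  shows "z \<preceq> a \<oplus> x \<curlywedge> y"
  using assms meet_greatest[of "z \<ominus> a" x y] by (simp flip: diff_le_iff)

lemma meet_add_le:
  assumes [simp]: "x \<in> carrier A" "y \<in> carrier A" "z \<in> carrier A"
  shows "(x \<oplus> y) \<curlywedge> z \<preceq> x \<curlywedge> z \<oplus> y \<curlywedge> z"
proof -
  let ?l = "(x \<oplus> y) \<curlywedge> z"
  have z: "?l \<preceq> a \<oplus> z" if [simp]: "a \<in> carrier A" for a
    by (rule le_trans[OF meet_le2 le_add2]) simp_all
  have "?l \<preceq> x \<oplus> y \<curlywedge> z"
    by (rule le_add_meet) (simp_all add: z meet_le1)
  then have "?l \<preceq> y \<curlywedge> z \<oplus> x \<curlywedge> z"
    by (intro le_add_meet) (simp_all add: z add_comm[of _ x])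
  then show ?thesis
    by (simp add: add_comm)
qed

lemma diff_meet_diff_swap:
  assumes [simp]: "x \<in> carrier A" "y \<in> carrier A"
  shows "(x \<ominus> y) \<curlywedge> (y \<ominus> x) = \<^bold>0"
proof -
  define m where "m = x \<curlywedge> y"
  define r where "r = (x \<ominus> y) \<curlywedge> (y \<ominus> x)"
  have [simp]: "m \<in> carrier A" "r \<in> carrier A"
    by (simp_all add: m_def r_def)
  have m: "m \<preceq> x" "m \<preceq> y"
    by (simp_all add: m_def meet_le1 meet_le2)
  have r_diff: "r \<preceq> x \<ominus> m" "r \<preceq> y \<ominus> m"
    using m le_trans[OF meet_le1 diff_antimono[of m y x]] le_trans[OF meet_le2 diff_antimono[of m x y]]
    by (simp_all add: r_def)
  have "m \<oplus> r \<preceq> m \<oplus> (x \<ominus> m)" "m \<oplus> r \<preceq> m \<oplus> (y \<ominus> m)"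
    by (simp_all add: add_mono r_diff)
  then have "m \<oplus> r \<preceq> m"
    using m meet_greatest[of "m \<oplus> r" x y] by (simp add: add_diff_of_le m_def)
  moreover have "r \<preceq> \<sim> m"
    by (rule le_trans[OF r_diff(1)]) (simp_all add: neg_le_neg_iff)
  then have "(m \<oplus> r) \<ominus> m = r"
    using add_diff_cancel[of r m] by (simp add: add_comm[of r])
  ultimately show ?thesis
    using diff_eq_zero_iff[of "m \<oplus> r" m] by (simp add: r_def)
qed

definition mv_ideal :: "'a set \<Rightarrow> bool" where
  "mv_ideal I \<longleftrightarrow> I \<subseteq> carrier A \<and> \<^bold>0 \<in> I \<and>
     (\<forall>x\<in>I. \<forall>y\<in>carrier A. y \<preceq> x \<longrightarrow> y \<in> I) \<and> (\<forall>x\<in>I. \<forall>y\<in>I. x \<oplus> y \<in> I)"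

definition mv_prime_ideal :: "'a set \<Rightarrow> bool" where
  "mv_prime_ideal I \<longleftrightarrow> mv_ideal I \<and> I \<noteq> carrier A \<and>
     (\<forall>x\<in>carrier A. \<forall>y\<in>carrier A. x \<curlywedge> y \<in> I \<longrightarrow> x \<in> I \<or> y \<in> I)"

lemma mv_idealD:
  assumes "mv_ideal I"
  shows "x \<in> I \<Longrightarrow> x \<in> carrier A" "\<^bold>0 \<in> I"
    "y \<preceq> x \<Longrightarrow> x \<in> I \<Longrightarrow> y \<in> carrier A \<Longrightarrow> y \<in> I" "x \<in> I \<Longrightarrow> y \<in> I \<Longrightarrow> x \<oplus> y \<in> I"
  using assms unfolding mv_ideal_def by blast+

lemma mv_ideal_zero: "mv_ideal {\<^bold>0}"
  by (auto simp: mv_ideal_def le_zero_iff)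

lemma mv_ideal_Union_chain:
  assumes "C \<noteq> {}" and chain: "subset.chain (Collect mv_ideal) C"
  shows "mv_ideal (\<Union>C)"
proof -
  have ideal: "mv_ideal I" if "I \<in> C" for I
    using chain that by (auto simp: subset_chain_def)
  have "x \<oplus> y \<in> \<Union>C" if xy: "x \<in> \<Union>C" "y \<in> \<Union>C" for x y
  proof -
    obtain I J where IJ: "I \<in> C" "J \<in> C" "x \<in> I" "y \<in> J"
      using xy by blast
    then obtain K where "K \<in> C" "x \<in> K" "y \<in> K"
      using subset.chain_total[OF chain IJ(1,2)] by blast
    then show ?thesis
      using mv_idealD(4)[OF ideal] by blast
  qed
  moreover have "\<^bold>0 \<in> \<Union>C" "\<Union>C \<subseteq> carrier A"
    using \<open>C \<noteq> {}\<close> mv_idealD(1,2)[OF ideal] by blast+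
  moreover have "y \<in> \<Union>C" if "x \<in> \<Union>C" "y \<in> carrier A" "y \<preceq> x" for x y
    using that mv_idealD(3)[OF ideal] by blast
  ultimately show ?thesis
    unfolding mv_ideal_def by blast
qed

lemma mv_ideal_residual:
  assumes I: "mv_ideal I" and q [simp]: "q \<in> carrier A"
  shows "mv_ideal {x \<in> carrier A. x \<curlywedge> q \<in> I}"
  unfolding mv_ideal_def
proof (intro conjI ballI impI)
  show "\<^bold>0 \<in> {x \<in> carrier A. x \<curlywedge> q \<in> I}"
    using mv_idealD(2)[OF I] by (simp add: meet_eq_left)
next
  fix x y assume x: "x \<in> {x \<in> carrier A. x \<curlywedge> q \<in> I}" and y [simp]: "y \<in> carrier A" and "y \<preceq> x"
  have "y \<curlywedge> q \<preceq> x \<curlywedge> q"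
    using x \<open>y \<preceq> x\<close> by (intro meet_greatest meet_le2 le_trans[OF meet_le1]) simp_all
  then show "y \<in> {x \<in> carrier A. x \<curlywedge> q \<in> I}"
    using x mv_idealD(3)[OF I] by simp
next
  fix x y assume x: "x \<in> {x \<in> carrier A. x \<curlywedge> q \<in> I}" and y: "y \<in> {x \<in> carrier A. x \<curlywedge> q \<in> I}"
  then have "(x \<oplus> y) \<curlywedge> q \<preceq> x \<curlywedge> q \<oplus> y \<curlywedge> q"
    by (simp add: meet_add_le)
  then show "x \<oplus> y \<in> {x \<in> carrier A. x \<curlywedge> q \<in> I}"
    using x y mv_idealD(3,4)[OF I] by simp
qed auto

lemma mv_prime_ideal_if_maximal:
  assumes I: "mv_ideal I" "d \<notin> I" and d [simp]: "d \<in> carrier A"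
    and max: "\<And>J. mv_ideal J \<Longrightarrow> d \<notin> J \<Longrightarrow> I \<subseteq> J \<Longrightarrow> J = I"
  shows "mv_prime_ideal I"
proof -
  have residual: "d \<curlywedge> q \<in> I" if "p \<curlywedge> q \<in> I" "p \<notin> I" and [simp]: "p \<in> carrier A" "q \<in> carrier A"
    for p q
  proof (rule ccontr)
    let ?J = "{x \<in> carrier A. x \<curlywedge> q \<in> I}"
    assume "d \<curlywedge> q \<notin> I"
    then have "d \<notin> ?J"
      by simp
    moreover have "I \<subseteq> ?J"
      using mv_idealD(3)[OF I(1) meet_le1] mv_idealD(1)[OF I(1)] by auto
    ultimately have "?J = I"
      by (intro max mv_ideal_residual I) simp_all
    moreover have "p \<in> ?J"
      using that by simp
    ultimately show False
      using \<open>p \<notin> I\<close> by blast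
  qed
  have "p \<in> I \<or> q \<in> I" if "p \<curlywedge> q \<in> I" "p \<in> carrier A" "q \<in> carrier A" for p q
  proof (rule ccontr)
    assume "\<not> (p \<in> I \<or> q \<in> I)"
    then have "d \<curlywedge> q \<in> I"
      using residual that by blast
    then have "d \<curlywedge> d \<in> I"
      using residual[of q d] \<open>\<not> (p \<in> I \<or> q \<in> I)\<close> that by (simp add: meet_comm[of q])
    then show False
      using I(2) by (simp add: meet_eq_left)
  qed
  then show ?thesis
    unfolding mv_prime_ideal_def using I d by blast
qed

lemma exists_mv_prime_ideal:
  assumes "d \<in> carrier A" "d \<noteq> \<^bold>0"
  obtains I where "mv_prime_ideal I" "d \<notin> I"
proof -
  define F where "F = {I. mv_ideal I \<and> d \<notin> I}"
  have "F \<noteq> {}"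
    using mv_ideal_zero assms by (auto simp: F_def)
  moreover have "\<Union>C \<in> F" if "C \<noteq> {}" "subset.chain F C" for C
    using mv_ideal_Union_chain[of C] that by (auto simp: F_def subset_chain_def)
  ultimately obtain I where I: "I \<in> F" and max: "\<And>J. J \<in> F \<Longrightarrow> I \<subseteq> J \<Longrightarrow> J = I"
    using subset_Zorn_nonempty[of F] by blast
  have "mv_prime_ideal I"
    using I assms(1) by (intro mv_prime_ideal_if_maximal[of I d] max) (simp_all add: F_def)
  then show ?thesis
    using that I by (simp add: F_def)
qed

end

section \<open>Quotients and MV-chains\<close>

lemma mv_homD:
  assumes "h \<in> mv_hom A C"
  shows "x \<in> carrier A \<Longrightarrow> h x \<in> carrier C"
    "x \<in> carrier A \<Longrightarrow> y \<in> carrier A \<Longrightarrow> h (mv_add A x y) = mv_add C (h x) (h y)"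
    "x \<in> carrier A \<Longrightarrow> h (mv_neg A x) = mv_neg C (h x)"
    "h (mv_zero A) = mv_zero C"
  using assms by (auto simp: mv_hom_def)

definition mv_quotient :: "('a, 'm) mv_scheme \<Rightarrow> ('a \<times> 'a) set \<Rightarrow> 'a set mv" where
  "mv_quotient A R = \<lparr>carrier = carrier A // R,
     mv_add = (\<lambda>X Y. \<Union>x\<in>X. \<Union>y\<in>Y. R `` {mv_add A x y}),
     mv_neg = (\<lambda>X. \<Union>x\<in>X. R `` {mv_neg A x}),
     mv_zero = R `` {mv_zero A}\<rparr>"

locale mv_congruence = mv_algebra A for A :: "('a, 'm) mv_scheme" +
  fixes R :: "('a \<times> 'a) set"
  assumes equiv: "equiv (carrier A) R"
    and neg_cong: "(x, y) \<in> R \<Longrightarrow> (\<sim> x, \<sim> y) \<in> R"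
    and add_cong: "(x, y) \<in> R \<Longrightarrow> z \<in> carrier A \<Longrightarrow> (x \<oplus> z, y \<oplus> z) \<in> R"
begin

abbreviation cls :: "'a \<Rightarrow> 'a set" where "cls x \<equiv> R `` {x}"

lemma cong_closed: "(x, y) \<in> R \<Longrightarrow> x \<in> carrier A \<and> y \<in> carrier A"
  using equiv_type[OF equiv] by blast

lemma cls_eq_iff: "x \<in> carrier A \<Longrightarrow> y \<in> carrier A \<Longrightarrow> cls x = cls y \<longleftrightarrow> (x, y) \<in> R"
  using eq_equiv_class_iff[OF equiv] .

lemma cls_closed: "x \<in> carrier A \<Longrightarrow> cls x \<in> carrier (mv_quotient A R)"
  by (simp add: mv_quotient_def quotientI)

lemma quotient_carrierE:
  assumes "X \<in> carrier (mv_quotient A R)"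
  obtains x where "x \<in> carrier A" "X = cls x"
  using assms by (auto simp: mv_quotient_def elim: quotientE)

lemma neg_cls:
  assumes "x \<in> carrier A"
  shows "mv_neg (mv_quotient A R) (cls x) = cls (\<sim> x)"
proof -
  have "(\<lambda>x. cls (\<sim> x)) respects R"
    by (intro congruentI equiv_class_eq[OF equiv] neg_cong)
  then show ?thesis
    using UN_equiv_class[OF equiv _ assms] by (simp add: mv_quotient_def)
qed

lemma add_cls:
  assumes "x \<in> carrier A" "y \<in> carrier A"
  shows "mv_add (mv_quotient A R) (cls x) (cls y) = cls (x \<oplus> y)"
proof -
  have "(\<lambda>x y. cls (x \<oplus> y)) respects2 R"
  proof (rule congruent2_commuteI[OF equiv])
    show "cls (x \<oplus> y) = cls (x \<oplus> z)" if "x \<in> carrier A" "(y, z) \<in> R" for x y z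
      using that cong_closed[of y z] equiv_class_eq[OF equiv add_cong] by (simp add: add_comm[of x])
  qed (simp add: add_comm)
  then show ?thesis
    using UN_equiv_class2[OF equiv equiv _ assms] by (simp add: mv_quotient_def)
qed

lemma zero_cls: "mv_zero (mv_quotient A R) = cls \<^bold>0"
  by (simp add: mv_quotient_def)

lemma one_cls: "mv_one (mv_quotient A R) = cls \<^bold>1"
  by (simp add: mv_one_def[of "mv_quotient A R"] zero_cls neg_cls)

lemmas cls_ops = neg_cls add_cls zero_cls one_cls cls_closed

lemma mv_algebra_quotient: "mv_algebra (mv_quotient A R)"
proof
  fix X Y Z
  assume "X \<in> carrier (mv_quotient A R)" "Y \<in> carrier (mv_quotient A R)" "Z \<in> carrier (mv_quotient A R)"
  then show "mv_add (mv_quotient A R) (mv_add (mv_quotient A R) X Y) Z =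
      mv_add (mv_quotient A R) X (mv_add (mv_quotient A R) Y Z)"
    by (auto elim!: quotient_carrierE simp: cls_ops add_assoc)
next
  fix X Y assume "X \<in> carrier (mv_quotient A R)" "Y \<in> carrier (mv_quotient A R)"
  then obtain x y where xy: "x \<in> carrier A" "y \<in> carrier A" "X = cls x" "Y = cls y"
    by (auto elim!: quotient_carrierE)
  show "mv_add (mv_quotient A R) X Y \<in> carrier (mv_quotient A R)"
    "mv_add (mv_quotient A R) X Y = mv_add (mv_quotient A R) Y X"
    "mv_add (mv_quotient A R) (mv_neg (mv_quotient A R) (mv_add (mv_quotient A R) (mv_neg (mv_quotient A R) X) Y)) Y =
      mv_add (mv_quotient A R) (mv_neg (mv_quotient A R) (mv_add (mv_quotient A R) (mv_neg (mv_quotient A R) Y) X)) X"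
    using lukasiewicz[OF xy(1,2)] add_comm[OF xy(1,2)] by (simp_all add: xy cls_ops)
qed (auto elim!: quotient_carrierE simp: cls_ops)

lemma cls_mv_hom: "(\<lambda>x\<in>carrier A. cls x) \<in> mv_hom A (mv_quotient A R)"
  by (auto simp: mv_hom_def cls_ops)

end

locale mv_chain = mv_algebra +
  assumes total: "x \<in> carrier A \<Longrightarrow> y \<in> carrier A \<Longrightarrow> x \<preceq> y \<or> y \<preceq> x"
    and nontrivial: "mv_zero A \<noteq> mv_one A"

context mv_algebra
begin

definition ideal_cong :: "'a set \<Rightarrow> ('a \<times> 'a) set" where
  "ideal_cong I = {(x, y). x \<in> carrier A \<and> y \<in> carrier A \<and> x \<ominus> y \<in> I \<and> y \<ominus> x \<in> I}"

lemma ideal_cong_iff: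
  "(x, y) \<in> ideal_cong I \<longleftrightarrow> x \<in> carrier A \<and> y \<in> carrier A \<and> x \<ominus> y \<in> I \<and> y \<ominus> x \<in> I"
  by (simp add: ideal_cong_def)

lemma mv_congruence_ideal_cong:
  assumes "mv_ideal I"
  shows "mv_congruence A (ideal_cong I)"
proof
  note ideal = mv_idealD[OF assms]
  have "x \<ominus> z \<in> I" if "x \<ominus> y \<in> I" "y \<ominus> z \<in> I" "x \<in> carrier A" "y \<in> carrier A" "z \<in> carrier A"
    for x y z
    using that by (intro ideal(3)[OF diff_triangle[of x y z]] ideal(4)) simp_all
  then have "trans (ideal_cong I)"
    unfolding trans_def ideal_cong_iff by blast
  then show "equiv (carrier A) (ideal_cong I)"
    by (intro equivI) (auto simp: ideal_cong_iff refl_on_def sym_def ideal(2))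
  show "(\<sim> x, \<sim> y) \<in> ideal_cong I" if "(x, y) \<in> ideal_cong I" for x y
    using that by (auto simp: ideal_cong_iff add_comm)
  show "(x \<oplus> z, y \<oplus> z) \<in> ideal_cong I" if "(x, y) \<in> ideal_cong I" "z \<in> carrier A" for x y z
    using that ideal(3)[OF diff_add_le[of x y z]] ideal(3)[OF diff_add_le[of y x z]]
    by (simp add: ideal_cong_iff)
qed

lemma mv_chain_quotient:
  assumes "mv_prime_ideal I"
  shows "mv_chain (mv_quotient A (ideal_cong I))"
proof -
  let ?Q = "mv_quotient A (ideal_cong I)"
  have ideal: "mv_ideal I"
    and prime: "\<And>x y. x \<in> carrier A \<Longrightarrow> y \<in> carrier A \<Longrightarrow> x \<curlywedge> y \<in> I \<Longrightarrow> x \<in> I \<or> y \<in> I"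
    and "I \<noteq> carrier A"
    using assms by (auto simp: mv_prime_ideal_def)
  interpret R: mv_congruence A "ideal_cong I"
    by (rule mv_congruence_ideal_cong[OF ideal])
  interpret Q: mv_algebra ?Q
    by (rule R.mv_algebra_quotient)
  have cls_le: "Q.mle (R.cls x) (R.cls y)" if "x \<ominus> y \<in> I" "x \<in> carrier A" "y \<in> carrier A" for x y
    using that mv_idealD(2)[OF ideal] by (simp add: Q.mle_def R.cls_ops R.cls_eq_iff ideal_cong_iff)
  show ?thesis
  proof
    fix X Y assume "X \<in> carrier ?Q" "Y \<in> carrier ?Q"
    then obtain x y where xy: "x \<in> carrier A" "y \<in> carrier A" "X = R.cls x" "Y = R.cls y"
      by (auto elim!: R.quotient_carrierE)
    then have "x \<ominus> y \<in> I \<or> y \<ominus> x \<in> I"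
      using mv_idealD(2)[OF ideal] by (intro prime) (simp_all add: diff_meet_diff_swap)
    then show "Q.mle X Y \<or> Q.mle Y X"
      using cls_le xy by blast
  next
    have "\<^bold>1 \<notin> I"
    proof
      assume "\<^bold>1 \<in> I"
      then have "carrier A \<subseteq> I"
        using mv_idealD(3)[OF ideal le_one] by blast
      then show False
        using \<open>I \<noteq> carrier A\<close> mv_idealD(1)[OF ideal] by blast
    qed
    then show "mv_zero ?Q \<noteq> mv_one ?Q"
      by (simp add: R.cls_ops R.cls_eq_iff ideal_cong_iff)
  qed
qed

lemma mv_chain_hom_separates:
  assumes ab: "a \<in> carrier A" "b \<in> carrier A" "a \<noteq> b"
  obtains C :: "'a set mv" and h where "mv_chain C" "h \<in> mv_hom A C" "h a \<noteq> h b"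
proof -
  have "a \<ominus> b \<noteq> \<^bold>0 \<or> b \<ominus> a \<noteq> \<^bold>0"
    using ab le_antisym by (auto simp: diff_eq_zero_iff)
  then obtain I where I: "mv_prime_ideal I" "a \<ominus> b \<notin> I \<or> b \<ominus> a \<notin> I"
    using exists_mv_prime_ideal[of "a \<ominus> b"] exists_mv_prime_ideal[of "b \<ominus> a"] ab by auto
  interpret R: mv_congruence A "ideal_cong I"
    using I(1) by (simp add: mv_congruence_ideal_cong mv_prime_ideal_def)
  have "R.cls a \<noteq> R.cls b"
    using I(2) ab by (auto simp: R.cls_eq_iff ideal_cong_iff)
  then show ?thesis
    using that[OF mv_chain_quotient[OF I(1)] R.cls_mv_hom] ab by simp
qed

end

section \<open>Sign patterns of integer linear forms\<close>

lemma exists_between_finite_sets: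
  fixes S T :: "'a :: unbounded_dense_linorder set"
  assumes "finite S" "finite T" "\<And>s t. s \<in> S \<Longrightarrow> t \<in> T \<Longrightarrow> s < t"
  shows "\<exists>y. (\<forall>s\<in>S. s < y) \<and> (\<forall>t\<in>T. y < t)"
proof -
  consider "S = {}" "T = {}" | "S = {}" "T \<noteq> {}" | "S \<noteq> {}" "T = {}" | "S \<noteq> {}" "T \<noteq> {}"
    by blast
  then show ?thesis
  proof cases
    case 2
    then show ?thesis using assms lt_ex[of "Min T"] by auto
  next
    case 3
    then show ?thesis using assms gt_ex[of "Max S"] by auto
  next
    case 4
    then have "Max S < Min T" using assms by simp
    then show ?thesis using 4 assms dense[of "Max S" "Min T"] by auto
  qed simp
qed

lemma exists_cut:
  fixes b :: "'i \<Rightarrow> 'a :: unbounded_dense_linorder"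
  assumes "finite I" and cover: "\<And>i. i \<in> I \<Longrightarrow> L i \<or> R i"
    and L_le_R: "\<And>i j. i \<in> I \<Longrightarrow> j \<in> I \<Longrightarrow> L i \<Longrightarrow> R j \<Longrightarrow> b i \<le> b j"
    and less_L: "\<And>i j. i \<in> I \<Longrightarrow> j \<in> I \<Longrightarrow> L i \<Longrightarrow> \<not> L j \<Longrightarrow> b i < b j"
    and less_R: "\<And>i j. i \<in> I \<Longrightarrow> j \<in> I \<Longrightarrow> \<not> R i \<Longrightarrow> R j \<Longrightarrow> b i < b j"
  obtains y where "\<And>i. i \<in> I \<Longrightarrow> L i \<longleftrightarrow> b i \<le> y" "\<And>i. i \<in> I \<Longrightarrow> R i \<longleftrightarrow> y \<le> b i"
proof (cases "\<exists>i\<in>I. L i \<and> R i")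
  case True
  then obtain i where i: "i \<in> I" "L i" "R i" by blast
  show ?thesis
  proof (rule that[of "b i"])
    fix j assume j: "j \<in> I"
    show "L j \<longleftrightarrow> b j \<le> b i" using L_le_R[OF j i(1)] less_L[OF i(1) j] i by (metis not_le)
    show "R j \<longleftrightarrow> b i \<le> b j" using L_le_R[OF i(1) j] less_R[OF j i(1)] i by (metis not_le)
  qed
next
  case False
  have "\<exists>y. (\<forall>s\<in>b ` {i \<in> I. L i}. s < y) \<and> (\<forall>t\<in>b ` {i \<in> I. R i}. y < t)"
    using \<open>finite I\<close> less_L False by (intro exists_between_finite_sets) auto
  then obtain y where "\<And>i. i \<in> I \<Longrightarrow> L i \<Longrightarrow> b i < y" "\<And>i. i \<in> I \<Longrightarrow> R i \<Longrightarrow> y < b i"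
    by auto
  then show ?thesis
    using cover False by (intro that[of y]) (meson less_imp_le not_le)+
qed

definition form_value :: "'v set \<Rightarrow> ('v \<Rightarrow> real) \<Rightarrow> ('v \<Rightarrow> int) \<Rightarrow> real" where
  "form_value V r p = (\<Sum>v\<in>V. real_of_int (p v) * r v)"

lemma form_value_linear:
  "form_value V r (\<lambda>v. a * p v - b * q v) = a * form_value V r p - b * form_value V r q"
  by (simp add: form_value_def sum_distrib_left left_diff_distrib sum_subtractf mult.assoc)

lemma form_value_add: "form_value V r (p + q) = form_value V r p + form_value V r q"
  by (simp add: form_value_def distrib_right sum.distrib)

lemma form_value_uminus: "form_value V r (- p) = - form_value V r p"
  by (simp add: form_value_def sum_negf)

lemma form_value_diff: "form_value V r (p - q) = form_value V r p - form_value V r q"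
  by (simp add: form_value_def left_diff_distrib sum_subtractf)

lemma form_value_insert:
  assumes "finite V" "x \<notin> V"
  shows "form_value (insert x V) (r(x := y)) p = p x * y + form_value V r p"
  using assms by (simp add: form_value_def) (rule sum.cong, auto)

definition eliminate :: "'v \<Rightarrow> ('v \<Rightarrow> int) \<Rightarrow> ('v \<Rightarrow> int) \<Rightarrow> 'v \<Rightarrow> int" where
  "eliminate x p q = (\<lambda>v. p x * q v - q x * p v)"

locale total_form_cone =
  fixes K :: "('v \<Rightarrow> int) set"
  assumes add: "p \<in> K \<Longrightarrow> q \<in> K \<Longrightarrow> p + q \<in> K"
    and total: "p \<in> K \<or> - p \<in> K"
begin

lemma zero: "0 \<in> K"
  using total[of 0] by simp

lemma nat_mult: "p \<in> K \<Longrightarrow> (\<lambda>v. int n * p v) \<in> K"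
proof (induction n)
  case 0
  then show ?case using zero by (simp add: zero_fun_def)
next
  case (Suc n)
  then show ?case
    using add[of p "\<lambda>v. int n * p v"] by (simp add: plus_fun_def algebra_simps)
qed

lemma mult: "p \<in> K \<Longrightarrow> 0 \<le> a \<Longrightarrow> (\<lambda>v. a * p v) \<in> K"
  using nat_mult[of p "nat a"] by simp

lemma mult_iff:
  assumes "0 < a"
  shows "(\<lambda>v. a * p v) \<in> K \<longleftrightarrow> p \<in> K"
proof
  assume mult_mem: "(\<lambda>v. a * p v) \<in> K"
  show "p \<in> K"
  proof (rule ccontr)
    assume "p \<notin> K"
    then have "(\<lambda>v. (a - 1) * (- p) v) \<in> K"
      using total[of p] assms mult[of "- p" "a - 1"] by simp
    then show False
      using add[OF mult_mem] \<open>p \<notin> K\<close> by (fastforce simp: plus_fun_def algebra_simps)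
  qed
qed (use assms mult in auto)

lemma eliminate_mem:
  assumes "p \<in> K" "- q \<in> K" "0 < p x" "0 < q x"
  shows "eliminate x q p \<in> K"
proof -
  have "(\<lambda>v. q x * p v) + (\<lambda>v. p x * (- q) v) \<in> K"
    using assms by (intro add mult[of p] mult[of "- q"]) simp_all
  then show ?thesis
    by (simp add: eliminate_def plus_fun_def)
qed

lemma mem_if_eliminate_mem:
  assumes "eliminate x q p \<in> K" "q \<in> K" "0 < p x" "0 < q x"
  shows "p \<in> K"
proof -
  have "eliminate x q p + (\<lambda>v. p x * q v) \<in> K"
    using assms by (intro add mult) simp_all
  then show ?thesis
    using assms(4) by (simp add: eliminate_def plus_fun_def mult_iff)
qed

lemma uminus_mem_if_eliminate_mem:
  assumes "eliminate x p q \<in> K" "- q \<in> K" "0 < p x" "0 < q x"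
  shows "- p \<in> K"
proof -
  have "eliminate x p q + (\<lambda>v. p x * (- q) v) \<in> K"
    using assms by (intro add mult[of "- q"]) simp_all
  then have "(\<lambda>v. q x * (- p) v) \<in> K"
    by (simp add: eliminate_def plus_fun_def)
  then show ?thesis
    using assms(4) mult_iff[of "q x" "- p"] by simp
qed

text \<open>Fourier--Motzkin elimination: a new variable \<open>x\<close> only has to be placed correctly relative to
  the zeros of the forms in which it occurs, and comparing two such zeros eliminates \<open>x\<close>.\<close>

lemma exists_eliminated_value:
  assumes "finite U" and pos: "\<And>p. p \<in> U \<Longrightarrow> 0 < p x"
    and r: "\<And>p q. p \<in> U \<Longrightarrow> q \<in> U \<Longrightarrow> eliminate x p q \<in> K \<longleftrightarrow> 0 \<le> form_value V r (eliminate x p q)"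
  shows "\<exists>y::real. \<forall>p\<in>U. (p \<in> K \<longleftrightarrow> 0 \<le> p x * y + form_value V r p) \<and>
      (- p \<in> K \<longleftrightarrow> 0 \<le> - (p x * y + form_value V r p))"
proof -
  define root where "root p = - form_value V r p / p x" for p
  have root_le: "eliminate x p q \<in> K \<longleftrightarrow> root q \<le> root p" if "p \<in> U" "q \<in> U" for p q
    using pos[OF that(1)] pos[OF that(2)]
    unfolding r[OF that] unfolding eliminate_def form_value_linear root_def by (simp add: field_simps)
  obtain y where y: "\<And>p. p \<in> U \<Longrightarrow> p \<in> K \<longleftrightarrow> root p \<le> y" "\<And>p. p \<in> U \<Longrightarrow> - p \<in> K \<longleftrightarrow> y \<le> root p"
  proof (rule exists_cut[OF \<open>finite U\<close>, of "\<lambda>p. p \<in> K" "\<lambda>p. - p \<in> K" root])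
    show "root p \<le> root q" if "p \<in> U" "q \<in> U" "p \<in> K" "- q \<in> K" for p q
      using that eliminate_mem[of p q x] pos[of p] pos[of q] by (simp add: root_le)
    show "root p < root q" if "p \<in> U" "q \<in> U" "p \<in> K" "q \<notin> K" for p q
      using that mem_if_eliminate_mem[of x p q] pos[of p] pos[of q] root_le[of p q] by auto
    show "root p < root q" if "p \<in> U" "q \<in> U" "- p \<notin> K" "- q \<in> K" for p q
      using that uminus_mem_if_eliminate_mem[of x p q] pos[of p] pos[of q] root_le[of p q] by auto
  qed (use total in auto)
  have "root p \<le> y \<longleftrightarrow> 0 \<le> p x * y + form_value V r p"
    "y \<le> root p \<longleftrightarrow> 0 \<le> - (p x * y + form_value V r p)" if "p \<in> U" for p
    using pos[OF that] by (auto simp: root_def field_simps)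
  then show ?thesis
    using y by auto
qed

lemma exists_realization_insert:
  assumes "finite V" "x \<notin> V" "finite F"
  defines "U \<equiv> {p \<in> F \<union> uminus ` F. 0 < p x}"
  assumes r_free: "\<And>p. p \<in> F \<Longrightarrow> p x = 0 \<Longrightarrow> p \<in> K \<longleftrightarrow> 0 \<le> form_value V r p"
    and r_elim: "\<And>p q. p \<in> U \<Longrightarrow> q \<in> U \<Longrightarrow> eliminate x p q \<in> K \<longleftrightarrow> 0 \<le> form_value V r (eliminate x p q)"
  shows "\<exists>y::real. \<forall>p\<in>F. p \<in> K \<longleftrightarrow> 0 \<le> form_value (insert x V) (r(x := y)) p"
proof -
  have U: "finite U" "\<And>p. p \<in> U \<Longrightarrow> 0 < p x"
    using \<open>finite F\<close> by (simp_all add: U_def)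
  obtain y :: real where y: "\<forall>p\<in>U. (p \<in> K \<longleftrightarrow> 0 \<le> p x * y + form_value V r p) \<and>
      (- p \<in> K \<longleftrightarrow> 0 \<le> - (p x * y + form_value V r p))"
    using exists_eliminated_value[where U = U and x = x and V = V and r = r] U r_elim by presburger
  have "p \<in> K \<longleftrightarrow> 0 \<le> p x * y + form_value V r p" if "p \<in> F" for p
  proof -
    consider "p x = 0" | "p \<in> U" | "- p \<in> U"
      using \<open>p \<in> F\<close> linorder_less_linear[of "p x" 0] by (auto simp: U_def)
    then show ?thesis
    proof cases
      case 1
      then show ?thesis using r_free[of p] that by simp
    next
      case 2
      then show ?thesis using y by blast
    next
      case 3
      then show ?thesis using bspec[OF y 3] by (simp add: form_value_uminus add.commute)
    qed
  qed
  then show ?thesis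
    unfolding form_value_insert[OF assms(1,2), symmetric] by blast
qed

theorem exists_real_realization:
  assumes "finite V" "finite F" "\<And>p v. p \<in> F \<Longrightarrow> v \<notin> V \<Longrightarrow> p v = 0"
  shows "\<exists>r. \<forall>p\<in>F. p \<in> K \<longleftrightarrow> 0 \<le> form_value V r p"
  using assms
proof (induction V arbitrary: F rule: finite_induct)
  case empty
  have "p = 0" if "p \<in> F" for p
    using empty.prems(2)[OF that] by auto
  then show ?case
    using zero by (auto simp: form_value_def)
next
  case (insert x V)
  define U where "U = {p \<in> F \<union> uminus ` F. 0 < p x}"
  define F' where "F' = {p \<in> F. p x = 0} \<union> (\<lambda>(p, q). eliminate x p q) ` (U \<times> U)"
  have "finite F'"
    using insert.prems(1) by (simp add: F'_def U_def)
  moreover have "p v = 0" if "p \<in> F'" "v \<notin> V" for p v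
  proof (cases "v = x")
    case False
    then have zero: "q v = 0" if "q \<in> F \<union> U" for q
      using that \<open>v \<notin> V\<close> insert.prems(2) by (auto simp: U_def)
    have "eliminate x q s v = 0" if "q \<in> U" "s \<in> U" for q s
      using zero[of q] zero[of s] that by (simp add: eliminate_def)
    then show ?thesis
      using \<open>p \<in> F'\<close> zero[of p] by (auto simp: F'_def)
  qed (use \<open>p \<in> F'\<close> in \<open>auto simp: F'_def eliminate_def\<close>)
  ultimately obtain r where r: "\<And>p. p \<in> F' \<Longrightarrow> p \<in> K \<longleftrightarrow> 0 \<le> form_value V r p"
    using insert.IH[of F'] by blast
  have "\<exists>y. \<forall>p\<in>F. p \<in> K \<longleftrightarrow> 0 \<le> form_value (insert x V) (r(x := y)) p"
  proof (rule exists_realization_insert[OF insert.hyps(1,2) insert.prems(1)])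
    show "eliminate x p q \<in> K \<longleftrightarrow> 0 \<le> form_value V r (eliminate x p q)"
      if "p \<in> {p \<in> F \<union> uminus ` F. 0 < p x}" "q \<in> {p \<in> F \<union> uminus ` F. 0 < p x}" for p q
      using that by (intro r) (force simp: F'_def U_def)
  qed (simp add: r F'_def)
  then show ?case by blast
qed

end

section \<open>Chang's group of an MV-chain\<close>

locale total_group_cone = comm_group G for G (structure) +
  fixes C :: "'a set"
  assumes subset: "C \<subseteq> carrier G"
    and mult: "x \<in> C \<Longrightarrow> y \<in> C \<Longrightarrow> x \<otimes> y \<in> C"
    and total: "x \<in> carrier G \<Longrightarrow> x \<in> C \<or> inv x \<in> C"
begin

definition form_prod :: "'a set \<Rightarrow> ('a \<Rightarrow> int) \<Rightarrow> 'a" where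
  "form_prod V p = (\<Otimes>v\<in>V. v [^] p v)"

definition unit_form :: "'a \<Rightarrow> 'a \<Rightarrow> int" where
  "unit_form v = (\<lambda>u. if u = v then 1 else 0)"

context
  fixes V
  assumes V: "finite V" "V \<subseteq> carrier G"
begin

lemma pow_closed: "(\<lambda>v. v [^] (p v :: int)) \<in> V \<rightarrow> carrier G"
  using V(2) by auto

lemma form_prod_closed: "form_prod V p \<in> carrier G"
  unfolding form_prod_def by (intro finprod_closed pow_closed)

lemma form_prod_add: "form_prod V (p + q) = form_prod V p \<otimes> form_prod V q"
proof -
  have "form_prod V (p + q) = (\<Otimes>v\<in>V. v [^] p v \<otimes> v [^] q v)"
    unfolding form_prod_def using V(2) by (intro finprod_cong') (auto simp: int_pow_mult subset_iff)
  then show ?thesis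
    unfolding form_prod_def by (simp only: finprod_multf pow_closed)
qed

lemma form_prod_uminus: "form_prod V (- p) = inv form_prod V p"
proof -
  have "form_prod V (- p) \<otimes> form_prod V p = form_prod V 0"
    by (simp flip: form_prod_add)
  also have "\<dots> = \<one>"
    by (simp add: form_prod_def)
  finally show ?thesis
    by (rule inv_equality[symmetric]) (simp_all add: form_prod_closed)
qed

lemma form_prod_diff: "form_prod V (p - q) = form_prod V p \<otimes> inv form_prod V q"
  using form_prod_add[of p "- q"] by (simp add: form_prod_uminus)

lemma form_prod_unit_form:
  assumes "v \<in> V"
  shows "form_prod V (unit_form v) = v"
proof -
  have "form_prod V (unit_form v) = (\<Otimes>u\<in>V. if u = v then u else \<one>)"
    unfolding form_prod_def unit_form_def using V(2) by (intro finprod_cong') (auto simp: subset_iff)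
  then show ?thesis
    using finprod_singleton_swap[of v V "\<lambda>u. u"] assms V by (simp add: Pi_def subset_iff)
qed

lemma form_value_unit_form:
  assumes "v \<in> V"
  shows "form_value V r (unit_form v) = r v"
proof -
  have "form_value V r (unit_form v) = (\<Sum>u\<in>V. if u = v then r u else 0)"
    unfolding form_value_def unit_form_def by (intro sum.cong) auto
  then show ?thesis using assms V(1) by simp
qed

text \<open>The restriction of the group order to finitely many elements can be realised in the reals,
  even though the group need not be archimedean.\<close>

theorem exists_real_local_embedding:
  "\<exists>r :: 'a \<Rightarrow> real. \<forall>x\<in>V. \<forall>y\<in>V. \<forall>z\<in>V.
     (x \<otimes> y \<otimes> inv z \<in> C \<longleftrightarrow> r z \<le> r x + r y) \<and>
     (inv (x \<otimes> y \<otimes> inv z) \<in> C \<longleftrightarrow> r x + r y \<le> r z)"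
proof -
  define K where "K = {p. form_prod V p \<in> C}"
  interpret total_form_cone K
    by unfold_locales (auto simp: K_def form_prod_add form_prod_uminus form_prod_closed mult total)
  define sum_form where "sum_form = (\<lambda>(x, y, z). unit_form x + unit_form y - unit_form z)"
  define F where "F = sum_form ` (V \<times> V \<times> V)"
  have "finite (F \<union> uminus ` F)"
    using V(1) by (simp add: F_def)
  moreover have "p v = 0" if "p \<in> F \<union> uminus ` F" "v \<notin> V" for p v
    using that by (auto simp: F_def sum_form_def unit_form_def)
  ultimately obtain r where r: "\<forall>p\<in>F \<union> uminus ` F. p \<in> K \<longleftrightarrow> 0 \<le> form_value V r p"
    using exists_real_realization[OF V(1)] by metis
  have value_sum: "form_value V r (sum_form (x, y, z)) = r x + r y - r z"
    and prod_sum: "form_prod V (sum_form (x, y, z)) = x \<otimes> y \<otimes> inv z"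
    if "x \<in> V" "y \<in> V" "z \<in> V" for x y z
    using that
    by (simp_all add: sum_form_def form_prod_add form_prod_diff form_prod_unit_form
        form_value_add form_value_diff form_value_unit_form)
  have sum_form_mem: "sum_form (x, y, z) \<in> F" if "x \<in> V" "y \<in> V" "z \<in> V" for x y z
    using that by (simp add: F_def)
  show ?thesis
  proof (intro exI[of _ r] ballI conjI)
    fix x y z assume xyz: "x \<in> V" "y \<in> V" "z \<in> V"
    show "x \<otimes> y \<otimes> inv z \<in> C \<longleftrightarrow> r z \<le> r x + r y"
      using bspec[OF r, of "sum_form (x, y, z)"] sum_form_mem[OF xyz]
      by (simp add: K_def value_sum[OF xyz] prod_sum[OF xyz])
    show "inv (x \<otimes> y \<otimes> inv z) \<in> C \<longleftrightarrow> r x + r y \<le> r z"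
      using bspec[OF r, of "- sum_form (x, y, z)"] sum_form_mem[OF xyz]
      by (simp add: K_def form_value_uminus form_prod_uminus value_sum[OF xyz] prod_sum[OF xyz])
  qed
qed

end

end

context mv_algebra
begin

lemma prod_eq_one_iff: "x \<in> carrier A \<Longrightarrow> y \<in> carrier A \<Longrightarrow> x \<odot> y = \<^bold>1 \<longleftrightarrow> x = \<^bold>1 \<and> y = \<^bold>1"
  using diff_le[of x "\<sim> y"] diff_le[of y "\<sim> x"] by (auto simp: one_le_iff add_comm)

lemma prod_mono1:
  "x \<preceq> y \<Longrightarrow> x \<in> carrier A \<Longrightarrow> y \<in> carrier A \<Longrightarrow> z \<in> carrier A \<Longrightarrow> x \<odot> z \<preceq> y \<odot> z"
  using diff_mono[of x y "\<sim> z"] by simp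

text \<open>The three ways in which the carries can fall when \<open>b\<close> and \<open>c\<close> are added to \<open>a\<close> in either
  order: none of the two sums overflows, both do, or only one does.\<close>

lemma add_prod_commute:
  assumes "a \<preceq> \<sim> b" "a \<preceq> \<sim> c" and [simp]: "a \<in> carrier A" "b \<in> carrier A" "c \<in> carrier A"
  shows "(a \<oplus> b) \<odot> c = (a \<oplus> c) \<odot> b"
proof -
  have "\<sim> b = a \<oplus> \<sim> (a \<oplus> b)" "\<sim> c = a \<oplus> \<sim> (a \<oplus> c)"
    using add_diff_of_le[of a "\<sim> b"] add_diff_of_le[of a "\<sim> c"] assms by (simp_all add: add_comm)
  then have "\<sim> (a \<oplus> b) \<oplus> \<sim> c = \<sim> (a \<oplus> c) \<oplus> \<sim> b"
    using add_left_comm[of "\<sim> (a \<oplus> b)" a "\<sim> (a \<oplus> c)"] add_comm[of "\<sim> (a \<oplus> c)"]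
      add_left_comm[of "\<sim> (a \<oplus> c)" a "\<sim> (a \<oplus> b)"] by simp
  then show ?thesis
    by simp
qed

lemma prod_add_commute:
  assumes "a \<oplus> b = \<^bold>1" "a \<oplus> c = \<^bold>1" and [simp]: "a \<in> carrier A" "b \<in> carrier A" "c \<in> carrier A"
  shows "a \<odot> b \<oplus> c = a \<odot> c \<oplus> b"
proof -
  have "(\<sim> a \<oplus> \<sim> b) \<odot> \<sim> c = (\<sim> a \<oplus> \<sim> c) \<odot> \<sim> b"
    by (intro add_prod_commute) (simp_all add: mle_def assms(1,2))
  then show ?thesis
    by (simp add: neg_eq_iff)
qed

lemma add_prod_assoc:
  assumes "a \<preceq> \<sim> b" "a \<oplus> c = \<^bold>1" and [simp]: "a \<in> carrier A" "b \<in> carrier A" "c \<in> carrier A"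
  shows "(a \<oplus> b) \<odot> c = a \<odot> c \<oplus> b"
proof -
  have a: "\<sim> c \<oplus> a \<odot> c = a"
    using add_diff_of_le[of "\<sim> c" a] assms(2) by (simp add: mle_def add_comm)
  have "\<sim> ((a \<oplus> b) \<odot> c) \<oplus> a \<odot> c = \<sim> (a \<oplus> b) \<oplus> (\<sim> c \<oplus> a \<odot> c)"
    by (simp add: add_assoc)
  also have "\<dots> = \<sim> b"
    unfolding a using add_diff_of_le[of a "\<sim> b"] assms(1) by (simp add: add_comm)
  finally have b: "((a \<oplus> b) \<odot> c) \<ominus> a \<odot> c = b"
    by simp
  have "a \<odot> c \<preceq> (a \<oplus> b) \<odot> c"
    by (simp add: prod_mono1)
  then show ?thesis
    using add_diff_of_le[of "a \<odot> c" "(a \<oplus> b) \<odot> c"] b by simp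
qed

text \<open>The pair \<open>(m, x)\<close> stands for the element \<open>m u + x\<close> of the ordered group with strong unit \<open>u\<close>
  whose unit interval is \<open>A\<close>.\<close>

definition chang_group :: "(int \<times> 'a) monoid" where
  "chang_group = \<lparr>carrier = {(m, x). x \<in> carrier A \<and> x \<noteq> \<^bold>1},
     mult = (\<lambda>(m, x) (n, y). if x \<oplus> y = \<^bold>1 then (m + n + 1, x \<odot> y) else (m + n, x \<oplus> y)),
     one = (0, \<^bold>0)\<rparr>"

definition chang_cone :: "(int \<times> 'a) set" where
  "chang_cone = {(m, x). 0 \<le> m \<and> x \<in> carrier A \<and> x \<noteq> \<^bold>1}"

definition chang_embed :: "'a \<Rightarrow> int \<times> 'a" where
  "chang_embed x = (if x = \<^bold>1 then (1, \<^bold>0) else (0, x))"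

lemma carrier_chang_group [simp]: "(m, x) \<in> carrier chang_group \<longleftrightarrow> x \<in> carrier A \<and> x \<noteq> \<^bold>1"
  by (simp add: chang_group_def)

lemma mult_chang_group [simp]: "(m, x) \<otimes>\<^bsub>chang_group\<^esub> (n, y) =
    (if x \<oplus> y = \<^bold>1 then (m + n + 1, x \<odot> y) else (m + n, x \<oplus> y))"
  by (simp add: chang_group_def)

lemma one_chang_group: "\<one>\<^bsub>chang_group\<^esub> = (0, \<^bold>0)"
  by (simp add: chang_group_def)

lemma chang_cone_iff [simp]: "(m, x) \<in> chang_cone \<longleftrightarrow> 0 \<le> m \<and> x \<in> carrier A \<and> x \<noteq> \<^bold>1"
  by (simp add: chang_cone_def)

end

context mv_chain
begin

lemma le_neg_if_add_neq_one: "x \<in> carrier A \<Longrightarrow> y \<in> carrier A \<Longrightarrow> x \<oplus> y \<noteq> \<^bold>1 \<Longrightarrow> x \<preceq> \<sim> y"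
  using total[of x "\<sim> y"] by (auto simp: mle_def add_comm)

lemma chang_mult_overflow_commute:
  assumes carrier [simp]: "a \<in> carrier A" "b \<in> carrier A" "c \<in> carrier A"
    and neq: "a \<noteq> \<^bold>1" "b \<noteq> \<^bold>1" "c \<noteq> \<^bold>1" and "a \<oplus> b \<noteq> \<^bold>1" "a \<oplus> c = \<^bold>1"
  shows "(m, a) \<otimes>\<^bsub>chang_group\<^esub> (n, b) \<otimes>\<^bsub>chang_group\<^esub> (k, c) =
    (m, a) \<otimes>\<^bsub>chang_group\<^esub> (k, c) \<otimes>\<^bsub>chang_group\<^esub> (n, b)"
proof -
  have "(a \<oplus> b) \<odot> c = a \<odot> c \<oplus> b"
    using assms by (intro add_prod_assoc le_neg_if_add_neq_one) simp_all
  moreover from this have "a \<odot> c \<oplus> b \<noteq> \<^bold>1"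
    using neq by (simp flip: \<open>(a \<oplus> b) \<odot> c = a \<odot> c \<oplus> b\<close> add: prod_eq_one_iff)
  moreover have "a \<oplus> b \<oplus> c = \<^bold>1"
    using add_assoc[of b a c] assms by (simp add: add_comm[of a b])
  ultimately show ?thesis
    using assms by simp
qed

lemma chang_mult_right_commute:
  assumes "s \<in> carrier chang_group" "t \<in> carrier chang_group" "u \<in> carrier chang_group"
  shows "s \<otimes>\<^bsub>chang_group\<^esub> t \<otimes>\<^bsub>chang_group\<^esub> u = s \<otimes>\<^bsub>chang_group\<^esub> u \<otimes>\<^bsub>chang_group\<^esub> t"
proof -
  obtain m a n b k c where eq: "s = (m, a)" "t = (n, b)" "u = (k, c)"
    by (cases s, cases t, cases u)
  then have [simp]: "a \<in> carrier A" "b \<in> carrier A" "c \<in> carrier A"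
    and neq: "a \<noteq> \<^bold>1" "b \<noteq> \<^bold>1" "c \<noteq> \<^bold>1"
    using assms by auto
  consider "a \<oplus> b = \<^bold>1" "a \<oplus> c = \<^bold>1" | "a \<oplus> b \<noteq> \<^bold>1" "a \<oplus> c = \<^bold>1" |
    "a \<oplus> b = \<^bold>1" "a \<oplus> c \<noteq> \<^bold>1" | "a \<oplus> b \<noteq> \<^bold>1" "a \<oplus> c \<noteq> \<^bold>1"
    by blast
  then show ?thesis
  proof cases
    case 1
    then have "a \<odot> b \<oplus> c = a \<odot> c \<oplus> b" "a \<odot> b \<odot> c = a \<odot> c \<odot> b"
      by (simp_all add: prod_add_commute add_assoc add_comm[of "\<sim> b"])
    then show ?thesis using 1 by (simp add: eq)
  next
    case 2
    then show ?thesis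
      unfolding eq by (intro chang_mult_overflow_commute neq) simp_all
  next
    case 3
    then show ?thesis
      unfolding eq by (intro chang_mult_overflow_commute[symmetric] neq) simp_all
  next
    case 4
    then have "(a \<oplus> b) \<odot> c = (a \<oplus> c) \<odot> b" "a \<oplus> b \<oplus> c = a \<oplus> c \<oplus> b"
      by (simp_all add: add_prod_commute le_neg_if_add_neq_one add_assoc add_comm[of b])
    then show ?thesis using 4 by (simp add: eq)
  qed
qed

lemma comm_group_chang_group: "comm_group chang_group"
proof (rule comm_groupI)
  let ?G = chang_group
  show closed: "s \<otimes>\<^bsub>?G\<^esub> t \<in> carrier ?G" if "s \<in> carrier ?G" "t \<in> carrier ?G" for s t
    using that by (cases s; cases t) (auto simp: prod_eq_one_iff)
  show comm: "s \<otimes>\<^bsub>?G\<^esub> t = t \<otimes>\<^bsub>?G\<^esub> s" if "s \<in> carrier ?G" "t \<in> carrier ?G" for s t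
    using that by (cases s; cases t) (auto simp: add_comm)
  show "s \<otimes>\<^bsub>?G\<^esub> t \<otimes>\<^bsub>?G\<^esub> u = s \<otimes>\<^bsub>?G\<^esub> (t \<otimes>\<^bsub>?G\<^esub> u)"
    if "s \<in> carrier ?G" "t \<in> carrier ?G" "u \<in> carrier ?G" for s t u
    using that chang_mult_right_commute[of t s u] comm[of s t] comm[of "t \<otimes>\<^bsub>?G\<^esub> u" s] closed[of t u] by simp
  show "\<exists>t\<in>carrier ?G. t \<otimes>\<^bsub>?G\<^esub> s = \<one>\<^bsub>?G\<^esub>" if s: "s \<in> carrier ?G" for s
  proof -
    obtain m x where x: "s = (m, x)" "x \<in> carrier A" "x \<noteq> \<^bold>1"
      using s by (cases s) auto
    show ?thesis
    proof (cases "x = \<^bold>0")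
      case True
      then show ?thesis
        using x by (intro bexI[of _ "(- m, \<^bold>0)"]) (auto simp: one_chang_group)
    next
      case False
      then have "\<sim> x \<noteq> \<^bold>1"
        using x neg_eq_iff[of x "\<^bold>0"] by auto
      then show ?thesis
        using x by (intro bexI[of _ "(- m - 1, \<sim> x)"]) (auto simp: one_chang_group)
    qed
  qed
qed (use nontrivial in \<open>auto simp: chang_group_def\<close>)

sublocale chang: total_group_cone chang_group chang_cone
proof -
  interpret comm_group chang_group
    by (rule comm_group_chang_group)
  show "total_group_cone chang_group chang_cone"
  proof
    show "chang_cone \<subseteq> carrier chang_group"
      by auto
    show "s \<otimes>\<^bsub>chang_group\<^esub> t \<in> chang_cone" if "s \<in> chang_cone" "t \<in> chang_cone" for s t
      using that by (cases s; cases t) (auto simp: prod_eq_one_iff)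
    show "s \<in> chang_cone \<or> inv\<^bsub>chang_group\<^esub> s \<in> chang_cone" if s: "s \<in> carrier chang_group" for s
    proof -
      obtain m x n y where eq: "s = (m, x)" "inv\<^bsub>chang_group\<^esub> s = (n, y)"
        by (cases s, cases "inv\<^bsub>chang_group\<^esub> s")
      have "(m, x) \<otimes>\<^bsub>chang_group\<^esub> (n, y) = (0, \<^bold>0)"
        using r_inv[OF s, unfolded eq(2), unfolded eq(1)] by (simp only: one_chang_group)
      then have "0 \<le> m \<or> 0 \<le> n"
        by (auto split: if_splits)
      then show ?thesis
        using s inv_closed[OF s] unfolding eq(2) unfolding eq(1) by auto
    qed
  qed
qed

lemma chang_embed_closed: "x \<in> carrier A \<Longrightarrow> chang_embed x \<in> carrier chang_group"
  using nontrivial by (simp add: chang_embed_def)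

lemma chang_embed_in_cone: "x \<in> carrier A \<Longrightarrow> chang_embed x \<in> chang_cone"
  using nontrivial by (simp add: chang_embed_def)

lemma chang_embed_eq_one_iff: "chang_embed x = \<one>\<^bsub>chang_group\<^esub> \<longleftrightarrow> x = \<^bold>0"
  using nontrivial by (auto simp: chang_embed_def one_chang_group)

lemma chang_embed_add:
  assumes "x \<preceq> \<sim> y" "x \<in> carrier A" "y \<in> carrier A"
  shows "chang_embed x \<otimes>\<^bsub>chang_group\<^esub> chang_embed y = chang_embed (x \<oplus> y)"
proof -
  have "x = \<^bold>1 \<Longrightarrow> y = \<^bold>0" "y = \<^bold>1 \<Longrightarrow> x = \<^bold>0"
    using assms by (metis neg_closed neg_neg neg_one one_le_iff, simp add: le_zero_iff)
  moreover have "x \<odot> y = \<^bold>0"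
    using assms by (simp add: mle_def)
  ultimately show ?thesis
    using assms nontrivial by (auto simp: chang_embed_def)
qed

lemma chang_embed_diff:
  assumes "x \<preceq> y" "x \<in> carrier A" "y \<in> carrier A"
  shows "chang_embed y \<otimes>\<^bsub>chang_group\<^esub> inv\<^bsub>chang_group\<^esub> chang_embed x = chang_embed (y \<ominus> x)"
proof -
  have "chang_embed (y \<ominus> x) \<otimes>\<^bsub>chang_group\<^esub> chang_embed x = chang_embed y"
    using assms chang_embed_add[of "y \<ominus> x" x] diff_antimono[of x y "\<^bold>1"]
    by (simp add: add_diff_of_le add_comm[of "y \<ominus> x"] neg_le_neg_iff)
  then show ?thesis
    using assms by (simp add: chang.inv_solve_right' chang_embed_closed)
qed

lemma chang_cone_antisym:
  assumes "s \<in> chang_cone" "inv\<^bsub>chang_group\<^esub> s \<in> chang_cone"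
  shows "s = \<one>\<^bsub>chang_group\<^esub>"
proof -
  obtain m x n y where eq: "s = (m, x)" "inv\<^bsub>chang_group\<^esub> s = (n, y)"
    by (cases s, cases "inv\<^bsub>chang_group\<^esub> s")
  have "(m, x) \<otimes>\<^bsub>chang_group\<^esub> (n, y) = (0, \<^bold>0)"
    using chang.r_inv[of s, unfolded eq(2), unfolded eq(1)] assms chang.subset
    by (auto simp: eq(1) one_chang_group)
  moreover have "0 \<le> m" "0 \<le> n" "x \<in> carrier A" "y \<in> carrier A"
    using assms unfolding eq(2) unfolding eq(1) by auto
  ultimately have "m = 0" "x \<oplus> y = \<^bold>0"
    by (auto split: if_splits)
  then show ?thesis
    using le_add[of x y] \<open>x \<in> carrier A\<close> \<open>y \<in> carrier A\<close> by (simp add: eq(1) le_zero_iff one_chang_group)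
qed

lemma chang_embed_le_iff:
  assumes xy: "x \<in> carrier A" "y \<in> carrier A"
  shows "chang_embed y \<otimes>\<^bsub>chang_group\<^esub> inv\<^bsub>chang_group\<^esub> chang_embed x \<in> chang_cone \<longleftrightarrow> x \<preceq> y"
proof
  let ?d = "chang_embed y \<otimes>\<^bsub>chang_group\<^esub> inv\<^bsub>chang_group\<^esub> chang_embed x"
  assume d_mem: "?d \<in> chang_cone"
  show "x \<preceq> y"
  proof (rule ccontr)
    assume "\<not> x \<preceq> y"
    then have "inv\<^bsub>chang_group\<^esub> ?d = chang_embed (x \<ominus> y)"
      using total[OF xy] xy
      by (simp add: chang_embed_closed chang.inv_mult_group flip: chang_embed_diff)
    then have "chang_embed (x \<ominus> y) = \<one>\<^bsub>chang_group\<^esub>"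
      using chang_cone_antisym[OF d_mem] chang_embed_in_cone[of "x \<ominus> y"] xy by simp
    then have "x \<ominus> y = \<^bold>0"
      by (simp only: chang_embed_eq_one_iff)
    then show False
      using \<open>\<not> x \<preceq> y\<close> xy by (simp add: diff_eq_zero_iff)
  qed
qed (use xy in \<open>simp add: chang_embed_diff chang_embed_in_cone\<close>)

lemma chang_embed_overflow:
  assumes "x \<oplus> y = \<^bold>1" and xy: "x \<in> carrier A" "y \<in> carrier A"
  shows "chang_embed x \<otimes>\<^bsub>chang_group\<^esub> chang_embed y \<otimes>\<^bsub>chang_group\<^esub>
    inv\<^bsub>chang_group\<^esub> chang_embed \<^bold>1 \<in> chang_cone"
proof -
  let ?G = chang_group
  have "x \<odot> y \<oplus> \<sim> x = y"
    using add_diff_of_le[of "\<sim> x" y] assms by (simp add: mle_def add_comm)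
  then have y: "chang_embed y = chang_embed (x \<odot> y) \<otimes>\<^bsub>?G\<^esub> chang_embed (\<sim> x)"
    using chang_embed_add[of "x \<odot> y" "\<sim> x"] diff_le[of x "\<sim> y"] xy by simp
  have "chang_embed x \<otimes>\<^bsub>?G\<^esub> chang_embed y =
      chang_embed (x \<odot> y) \<otimes>\<^bsub>?G\<^esub> (chang_embed x \<otimes>\<^bsub>?G\<^esub> chang_embed (\<sim> x))"
    unfolding y using xy by (simp add: chang_embed_closed chang.m_lcomm)
  also have "chang_embed x \<otimes>\<^bsub>?G\<^esub> chang_embed (\<sim> x) = chang_embed \<^bold>1"
    using chang_embed_add[of x "\<sim> x"] xy by simp
  finally have "chang_embed x \<otimes>\<^bsub>?G\<^esub> chang_embed y \<otimes>\<^bsub>?G\<^esub> inv\<^bsub>?G\<^esub> chang_embed \<^bold>1 =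
      chang_embed (x \<odot> y)"
    using xy by (simp add: chang.inv_solve_right' chang_embed_closed)
  then show ?thesis
    using xy by (simp add: chang_embed_in_cone)
qed

lemma exists_unital_real_embedding:
  assumes Y: "finite Y" "Y \<subseteq> carrier A" "\<^bold>0 \<in> Y" "\<^bold>1 \<in> Y"
  obtains s :: "'a \<Rightarrow> real" where "s \<^bold>0 = 0"
    "\<And>x y. x \<in> Y \<Longrightarrow> y \<in> Y \<Longrightarrow> s x \<le> s y \<longleftrightarrow> x \<preceq> y"
    "\<And>x y. x \<in> Y \<Longrightarrow> y \<in> Y \<Longrightarrow> x \<oplus> y \<in> Y \<Longrightarrow> x \<preceq> \<sim> y \<Longrightarrow> s (x \<oplus> y) = s x + s y"
    "\<And>x y. x \<in> Y \<Longrightarrow> y \<in> Y \<Longrightarrow> x \<oplus> y = \<^bold>1 \<Longrightarrow> s \<^bold>1 \<le> s x + s y"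
proof -
  let ?G = chang_group
  have Y_carrier: "x \<in> carrier A" if "x \<in> Y" for x
    using that Y(2) by blast
  have "finite (chang_embed ` Y)" "chang_embed ` Y \<subseteq> carrier ?G"
    using Y(1) Y_carrier chang_embed_closed by auto
  from chang.exists_real_local_embedding[OF this] obtain r :: "int \<times> 'a \<Rightarrow> real" where r:
    "\<forall>x\<in>chang_embed ` Y. \<forall>y\<in>chang_embed ` Y. \<forall>z\<in>chang_embed ` Y.
       (x \<otimes>\<^bsub>?G\<^esub> y \<otimes>\<^bsub>?G\<^esub> inv\<^bsub>?G\<^esub> z \<in> chang_cone \<longleftrightarrow> r z \<le> r x + r y) \<and>
       (inv\<^bsub>?G\<^esub> (x \<otimes>\<^bsub>?G\<^esub> y \<otimes>\<^bsub>?G\<^esub> inv\<^bsub>?G\<^esub> z) \<in> chang_cone \<longleftrightarrow> r x + r y \<le> r z)" ..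
  define s where "s x = r (chang_embed x)" for x
  define excess where "excess x y z = chang_embed x \<otimes>\<^bsub>?G\<^esub> chang_embed y \<otimes>\<^bsub>?G\<^esub> inv\<^bsub>?G\<^esub> chang_embed z" for x y z
  have excess: "excess x y z \<in> chang_cone \<longleftrightarrow> s z \<le> s x + s y"
    "inv\<^bsub>?G\<^esub> excess x y z \<in> chang_cone \<longleftrightarrow> s x + s y \<le> s z"
    if "x \<in> Y" "y \<in> Y" "z \<in> Y" for x y z
    using r that by (simp_all add: s_def excess_def)
  have add: "s (x \<oplus> y) = s x + s y" if "x \<in> Y" "y \<in> Y" "x \<oplus> y \<in> Y" "x \<preceq> \<sim> y" for x y
  proof -
    have "excess x y (x \<oplus> y) = \<one>\<^bsub>?G\<^esub>"
      using that Y_carrier by (simp add: excess_def chang_embed_add chang_embed_closed)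
    moreover have "\<one>\<^bsub>?G\<^esub> \<in> chang_cone"
      using chang.total[of "\<one>\<^bsub>?G\<^esub>"] by simp
    ultimately show ?thesis
      using excess[OF that(1-3)] by simp
  qed
  have zero: "s \<^bold>0 = 0"
    using add[of "\<^bold>0" "\<^bold>0"] Y(3) by simp
  show ?thesis
  proof (rule that[of s])
    show "s x \<le> s y \<longleftrightarrow> x \<preceq> y" if "x \<in> Y" "y \<in> Y" for x y
      using excess(1)[OF that(2) Y(3) that(1)] that Y_carrier zero
      by (simp add: excess_def chang_embed_eq_one_iff[THEN iffD2] chang_embed_closed chang_embed_le_iff)
    show "s \<^bold>1 \<le> s x + s y" if "x \<in> Y" "y \<in> Y" "x \<oplus> y = \<^bold>1" for x y
      using excess(1)[OF that(1,2) Y(4)] that Y_carrier by (simp add: excess_def chang_embed_overflow)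
  qed (fact zero add)+
qed

end

section \<open>Completeness of the unit interval\<close>

definition unit_interval :: "real mv" where
  "unit_interval = \<lparr>carrier = {0..1}, mv_add = \<lambda>x y. min (x + y) 1, mv_neg = \<lambda>x. 1 - x, mv_zero = 0\<rparr>"

lemma unit_interval_ops [simp]:
  "carrier unit_interval = {0..1}" "mv_add unit_interval x y = min (x + y) 1"
  "mv_neg unit_interval x = 1 - x" "mv_zero unit_interval = 0" "mv_one unit_interval = 1"
  by (simp_all add: unit_interval_def mv_one_def)

definition mv_partial_embedding ::
    "('a, 'm) mv_scheme \<Rightarrow> ('b, 'n) mv_scheme \<Rightarrow> 'a set \<Rightarrow> ('a \<Rightarrow> 'b) \<Rightarrow> bool" where
  "mv_partial_embedding A C X \<rho> \<longleftrightarrow> \<rho> ` X \<subseteq> carrier C \<and> inj_on \<rho> X \<and>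
     (mv_zero A \<in> X \<longrightarrow> \<rho> (mv_zero A) = mv_zero C) \<and>
     (\<forall>x\<in>X. mv_neg A x \<in> X \<longrightarrow> \<rho> (mv_neg A x) = mv_neg C (\<rho> x)) \<and>
     (\<forall>x\<in>X. \<forall>y\<in>X. mv_add A x y \<in> X \<longrightarrow> \<rho> (mv_add A x y) = mv_add C (\<rho> x) (\<rho> y))"

lemma mv_partial_embeddingD:
  assumes "mv_partial_embedding A C X \<rho>"
  shows "x \<in> X \<Longrightarrow> \<rho> x \<in> carrier C" "inj_on \<rho> X"
    "mv_zero A \<in> X \<Longrightarrow> \<rho> (mv_zero A) = mv_zero C"
    "x \<in> X \<Longrightarrow> mv_neg A x \<in> X \<Longrightarrow> \<rho> (mv_neg A x) = mv_neg C (\<rho> x)"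
    "x \<in> X \<Longrightarrow> y \<in> X \<Longrightarrow> mv_add A x y \<in> X \<Longrightarrow> \<rho> (mv_add A x y) = mv_add C (\<rho> x) (\<rho> y)"
  using assms by (auto simp: mv_partial_embedding_def)

lemma mv_partial_embedding_unit_interval_scaled:
  fixes s :: "'a \<Rightarrow> real"
  assumes "0 < u" and bounds: "\<And>x. x \<in> X \<Longrightarrow> 0 \<le> s x \<and> s x \<le> u" and "inj_on s X"
    and zero: "s (mv_zero A) = 0"
    and neg: "\<And>x. x \<in> X \<Longrightarrow> mv_neg A x \<in> X \<Longrightarrow> s (mv_neg A x) = u - s x"
    and add: "\<And>x y. x \<in> X \<Longrightarrow> y \<in> X \<Longrightarrow> mv_add A x y \<in> X \<Longrightarrow> s (mv_add A x y) = min (s x + s y) u"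
  shows "mv_partial_embedding A unit_interval X (\<lambda>x. s x / u)"
  unfolding mv_partial_embedding_def
proof (intro conjI ballI impI)
  show "(\<lambda>x. s x / u) ` X \<subseteq> carrier unit_interval"
    using bounds \<open>0 < u\<close> by auto
  show "inj_on (\<lambda>x. s x / u) X"
    using \<open>inj_on s X\<close> \<open>0 < u\<close> by (auto simp: inj_on_def)
  show "s (mv_neg A x) / u = mv_neg unit_interval (s x / u)" if "x \<in> X" "mv_neg A x \<in> X" for x
    using \<open>0 < u\<close> neg[OF that] by (simp add: diff_divide_distrib)
  show "s (mv_add A x y) / u = mv_add unit_interval (s x / u) (s y / u)"
    if "x \<in> X" "y \<in> X" "mv_add A x y \<in> X" for x y
    using \<open>0 < u\<close> add[OF that] by (simp add: min_def field_simps)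
qed (simp add: zero)

theorem (in mv_chain) exists_partial_embedding_unit_interval:
  assumes "finite X" "X \<subseteq> carrier A"
  obtains \<rho> where "mv_partial_embedding A unit_interval X \<rho>"
proof -
  define Y where "Y = X \<union> mv_neg A ` X \<union> {\<^bold>0, \<^bold>1}"
  have Y: "finite Y" "Y \<subseteq> carrier A" "\<^bold>0 \<in> Y" "\<^bold>1 \<in> Y"
    using assms by (auto simp: Y_def)
  obtain s :: "'a \<Rightarrow> real" where s_zero: "s \<^bold>0 = 0"
    and s_le_iff: "\<And>x y. x \<in> Y \<Longrightarrow> y \<in> Y \<Longrightarrow> s x \<le> s y \<longleftrightarrow> x \<preceq> y"
    and s_add: "\<And>x y. x \<in> Y \<Longrightarrow> y \<in> Y \<Longrightarrow> x \<oplus> y \<in> Y \<Longrightarrow> x \<preceq> \<sim> y \<Longrightarrow> s (x \<oplus> y) = s x + s y"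
    and s_overflow: "\<And>x y. x \<in> Y \<Longrightarrow> y \<in> Y \<Longrightarrow> x \<oplus> y = \<^bold>1 \<Longrightarrow> s \<^bold>1 \<le> s x + s y"
    using exists_unital_real_embedding[OF Y] by blast
  have X_in_Y: "x \<in> Y" "\<sim> x \<in> Y" "x \<in> carrier A" if "x \<in> X" for x
    using that assms(2) by (auto simp: Y_def)
  have s_one: "0 < s \<^bold>1"
    using s_le_iff[OF Y(4,3)] nontrivial by (simp add: s_zero le_zero_iff)
  have s_bounds: "0 \<le> s x \<and> s x \<le> s \<^bold>1" if "x \<in> X" for x
    using s_le_iff[OF Y(3) X_in_Y(1)[OF that]] s_le_iff[OF X_in_Y(1)[OF that] Y(4)] X_in_Y(3)[OF that]
    by (simp add: s_zero)
  have "x = y" if "x \<in> X" "y \<in> X" "s x = s y" for x y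
    using that s_le_iff[of x y] s_le_iff[of y x] X_in_Y by (intro le_antisym) simp_all
  then have "inj_on s X"
    by (rule inj_onI)
  moreover have "s (\<sim> x) = s \<^bold>1 - s x" if "x \<in> X" "\<sim> x \<in> X" for x
    using s_add[of x "\<sim> x"] X_in_Y[OF that(1)] Y(4) by simp
  moreover have "s (x \<oplus> y) = min (s x + s y) (s \<^bold>1)" if "x \<in> X" "y \<in> X" "x \<oplus> y \<in> X" for x y
  proof (cases "x \<oplus> y = \<^bold>1")
    case True
    then show ?thesis
      using s_overflow[of x y] X_in_Y[OF that(1)] X_in_Y[OF that(2)] by simp
  next
    case False
    then have "s (x \<oplus> y) = s x + s y"
      using s_add[of x y] X_in_Y[OF that(1)] X_in_Y[OF that(2)] X_in_Y[OF that(3)] by (simp add: le_neg_if_add_neq_one)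
    then show ?thesis
      using s_bounds[OF that(3)] by simp
  qed
  ultimately have "mv_partial_embedding A unit_interval X (\<lambda>x. s x / s \<^bold>1)"
    using s_one s_bounds s_zero
    by (intro mv_partial_embedding_unit_interval_scaled[where s = s]) simp_all
  then show ?thesis by (rule that)
qed

lemma kleene_terms_sel [simp]:
  "mv_add (kleene_terms B) = MV_Add" "mv_neg (kleene_terms B) = MV_Neg" "mv_zero (kleene_terms B) = MV_Zero"
  by (simp_all add: mv_term_algebra_def)

lemma mem_kleene_terms_iff [simp]:
  "MV_Gen b \<in> carrier (kleene_terms B) \<longleftrightarrow> b \<in> carrier B" "MV_Zero \<in> carrier (kleene_terms B)"
  "MV_Neg s \<in> carrier (kleene_terms B) \<longleftrightarrow> s \<in> carrier (kleene_terms B)"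
  "MV_Add s t \<in> carrier (kleene_terms B) \<longleftrightarrow> s \<in> carrier (kleene_terms B) \<and> t \<in> carrier (kleene_terms B)"
  by (auto simp: mv_term_algebra_def)

lemma mv_eval_cong:
  assumes "s \<in> carrier (kleene_terms B)" "\<And>b. b \<in> carrier B \<Longrightarrow> f b = g b"
  shows "mv_eval A f s = mv_eval A g s"
  using assms(1) by (induction s) (simp_all add: assms(2))

lemma (in mv_algebra) mv_eval_closed:
  assumes "s \<in> carrier (kleene_terms B)" "\<And>b. b \<in> carrier B \<Longrightarrow> g b \<in> carrier A"
  shows "mv_eval A g s \<in> carrier A"
  using assms(1) by (induction s) (simp_all add: assms(2))

lemma mv_eval_ops:
  "mv_eval A g (mv_join (kleene_terms B) s t) = mv_join A (mv_eval A g s) (mv_eval A g t)"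
  "mv_eval A g (mv_meet (kleene_terms B) s t) = mv_meet A (mv_eval A g s) (mv_eval A g t)"
  "mv_eval A g (mv_one (kleene_terms B)) = mv_one A"
  by (simp_all add: mv_join_def mv_meet_def mv_one_def)

lemma mv_hom_free_mv_class:
  assumes B: "kleene_algebra B" and h: "h \<in> mv_hom (free_mv B) A"
    and "s \<in> carrier (kleene_terms B)"
  shows "h (free_mv_cong B `` {s}) = mv_eval A (\<lambda>b\<in>carrier B. h (free_mv_unit B b)) s"
  using assms(3)
  by (induction s)
    (simp_all add: free_mv_unit_def mv_homD(2-4)[OF h] free_mv_class_closed[OF B]
      flip: free_mv_zero_class[OF B] free_mv_neg_class[OF B] free_mv_add_class[OF B])

definition kleene_relations :: "('a, 'm) kleene_scheme \<Rightarrow> ('a mv_term \<times> 'a mv_term) set" where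
  "kleene_relations B =
     (\<lambda>(a, b). (MV_Gen (k_join B a b), mv_join (kleene_terms B) (MV_Gen a) (MV_Gen b))) ` (carrier B \<times> carrier B) \<union>
     (\<lambda>(a, b). (MV_Gen (k_meet B a b), mv_meet (kleene_terms B) (MV_Gen a) (MV_Gen b))) ` (carrier B \<times> carrier B) \<union>
     (\<lambda>a. (MV_Gen (k_neg B a), MV_Neg (MV_Gen a))) ` carrier B \<union>
     {(MV_Gen (k_zero B), MV_Zero), (MV_Gen (k_one B), mv_one (kleene_terms B))}"

lemma kleene_relations_subset_free_mv_cong: "kleene_relations B \<subseteq> free_mv_cong B"
  using free_mv_cong.gen_join[of _ B] free_mv_cong.gen_meet[of _ B] free_mv_cong.gen_neg[of _ B]
    free_mv_cong.gen_zero[of B] free_mv_cong.gen_one[of B]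
  by (auto simp: kleene_relations_def)

definition kleene_relation_terms :: "('a, 'm) kleene_scheme \<Rightarrow> 'a mv_term set" where
  "kleene_relation_terms B =
     MV_Gen ` carrier B \<union> fst ` kleene_relations B \<union> snd ` kleene_relations B"

lemma kleene_relation_terms_subset:
  assumes "kleene_algebra B"
  shows "kleene_relation_terms B \<subseteq> carrier (kleene_terms B)"
  using free_mv_cong_carrier[OF assms] kleene_relations_subset_free_mv_cong[of B]
  by (fastforce simp: kleene_relation_terms_def)

lemma finite_kleene_relation_terms: "finite (carrier B) \<Longrightarrow> finite (kleene_relation_terms B)"
  by (simp add: kleene_relation_terms_def kleene_relations_def)

lemma kleene_hom_underlying_iff:
  "g \<in> kleene_hom B (underlying_kleene A) \<longleftrightarrow> g \<in> carrier B \<rightarrow>\<^sub>E carrier A \<and>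
     (\<forall>(s, t)\<in>kleene_relations B. mv_eval A g s = mv_eval A g t)"
  by (auto simp: kleene_hom_def underlying_kleene_def kleene_relations_def ball_Un mv_eval_ops)

primrec subterms :: "'a mv_term \<Rightarrow> 'a mv_term set" where
  "subterms (MV_Gen a) = {MV_Gen a}"
| "subterms MV_Zero = {MV_Zero}"
| "subterms (MV_Neg t) = insert (MV_Neg t) (subterms t)"
| "subterms (MV_Add s t) = insert (MV_Add s t) (subterms s \<union> subterms t)"

lemma finite_subterms: "finite (subterms t)"
  by (induction t) auto

lemma self_in_subterms: "t \<in> subterms t"
  by (cases t) auto

lemma subterms_closed: "s \<in> carrier (kleene_terms B) \<Longrightarrow> subterms s \<subseteq> carrier (kleene_terms B)"
  by (induction s) auto

lemma mv_eval_partial_embedding: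
  assumes \<rho>: "mv_partial_embedding A C X \<rho>"
    and "s \<in> carrier (kleene_terms B)" "mv_eval A g ` subterms s \<subseteq> X"
  shows "mv_eval C (\<lambda>b\<in>carrier B. \<rho> (g b)) s = \<rho> (mv_eval A g s)"
  using assms(2,3)
proof (induction s)
  case (MV_Neg s)
  then have "mv_eval A g s \<in> X" "mv_neg A (mv_eval A g s) \<in> X"
    using self_in_subterms[of s] by auto
  then show ?case
    using MV_Neg mv_partial_embeddingD(4)[OF \<rho>] by simp
next
  case (MV_Add s t)
  then have "mv_eval A g s \<in> X" "mv_eval A g t \<in> X" "mv_add A (mv_eval A g s) (mv_eval A g t) \<in> X"
    using self_in_subterms[of s] self_in_subterms[of t] by auto
  then show ?case
    using MV_Add mv_partial_embeddingD(5)[OF \<rho>] by (simp add: image_Un)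
qed (use mv_partial_embeddingD(3)[OF \<rho>] in auto)

lemma kleene_hom_comp_free_mv_unit:
  assumes B: "kleene_algebra B" and h: "h \<in> mv_hom (free_mv B) A"
  shows "(\<lambda>b\<in>carrier B. h (free_mv_unit B b)) \<in> kleene_hom B (underlying_kleene A)" (is "?g \<in> _")
proof -
  have "free_mv_unit B b \<in> carrier (free_mv B)" if "b \<in> carrier B" for b
    using that by (simp add: free_mv_unit_def free_mv_class_closed[OF B])
  then have "?g \<in> carrier B \<rightarrow>\<^sub>E carrier A"
    using mv_homD(1)[OF h] by auto
  moreover have "mv_eval A ?g s = mv_eval A ?g t" if "(s, t) \<in> kleene_relations B" for s t
  proof -
    have "(s, t) \<in> free_mv_cong B"
      using that kleene_relations_subset_free_mv_cong by blast
    moreover from this have "s \<in> carrier (kleene_terms B)" "t \<in> carrier (kleene_terms B)"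
      using free_mv_cong_carrier[OF B] by blast+
    ultimately show ?thesis
      using mv_hom_free_mv_class[OF B h] free_mv_cong_class_eq[OF B] by metis
  qed
  ultimately show ?thesis
    by (auto simp: kleene_hom_underlying_iff)
qed

lemma kleene_hom_partial_embedding:
  assumes B: "kleene_algebra B" and g: "g \<in> kleene_hom B (underlying_kleene A)"
    and \<rho>: "mv_partial_embedding A C X \<rho>"
    and X: "\<And>u. u \<in> kleene_relation_terms B \<Longrightarrow> mv_eval A g ` subterms u \<subseteq> X"
  shows "(\<lambda>b\<in>carrier B. \<rho> (g b)) \<in> kleene_hom B (underlying_kleene C)"
proof -
  let ?\<phi> = "\<lambda>b\<in>carrier B. \<rho> (g b)"
  have eval: "mv_eval C ?\<phi> u = \<rho> (mv_eval A g u)" if "u \<in> kleene_relation_terms B" for u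
    using that kleene_relation_terms_subset[OF B] by (intro mv_eval_partial_embedding[OF \<rho>] X) auto
  have "g b \<in> X" if "b \<in> carrier B" for b
    using X[of "MV_Gen b"] that by (simp add: kleene_relation_terms_def)
  then have "?\<phi> \<in> carrier B \<rightarrow>\<^sub>E carrier C"
    using mv_partial_embeddingD(1)[OF \<rho>] by auto
  moreover have "mv_eval C ?\<phi> u = mv_eval C ?\<phi> v" if "(u, v) \<in> kleene_relations B" for u v
  proof -
    have "u \<in> kleene_relation_terms B" "v \<in> kleene_relation_terms B"
      using that by (force simp: kleene_relation_terms_def)+
    moreover have "mv_eval A g u = mv_eval A g v"
      using g that by (auto simp: kleene_hom_underlying_iff)
    ultimately show ?thesis
      by (simp add: eval)
  qed
  ultimately show ?thesis
    by (auto simp: kleene_hom_underlying_iff)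
qed

text \<open>The relations of a finite \<open>B\<close> are finite in number and hence survive the local embedding of
  an MV-chain into the unit interval.\<close>

lemma (in mv_chain) exists_separating_kleene_hom_unit_interval:
  assumes B: "kleene_algebra B" and fin: "finite (carrier B)"
    and g: "g \<in> kleene_hom B (underlying_kleene A)"
    and st: "s \<in> carrier (kleene_terms B)" "t \<in> carrier (kleene_terms B)"
    and neq: "mv_eval A g s \<noteq> mv_eval A g t"
  obtains \<phi> where "\<phi> \<in> kleene_hom B (underlying_kleene unit_interval)"
    "mv_eval unit_interval \<phi> s \<noteq> mv_eval unit_interval \<phi> t"
proof -
  define T where "T = {s, t} \<union> kleene_relation_terms B"
  define X where "X = mv_eval A g ` (\<Union>u\<in>T. subterms u)"
  have "T \<subseteq> carrier (kleene_terms B)"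
    using st kleene_relation_terms_subset[OF B] by (simp add: T_def)
  then have "(\<Union>u\<in>T. subterms u) \<subseteq> carrier (kleene_terms B)"
    using subterms_closed by blast
  moreover have "g b \<in> carrier A" if "b \<in> carrier B" for b
    using g that by (auto simp: kleene_hom_underlying_iff)
  ultimately have "X \<subseteq> carrier A"
    by (auto simp: X_def intro!: mv_eval_closed)
  moreover have "finite X"
    using fin by (simp add: X_def T_def finite_kleene_relation_terms finite_subterms)
  ultimately obtain \<rho> where \<rho>: "mv_partial_embedding A unit_interval X \<rho>"
    using exists_partial_embedding_unit_interval by blast
  have subterms_X: "mv_eval A g ` subterms u \<subseteq> X" if "u \<in> T" for u
    using that by (auto simp: X_def)
  show ?thesis
  proof (rule that)
    show "(\<lambda>b\<in>carrier B. \<rho> (g b)) \<in> kleene_hom B (underlying_kleene unit_interval)"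
      by (rule kleene_hom_partial_embedding[OF B g \<rho> subterms_X]) (simp add: T_def)
    have "mv_eval A g s \<in> X" "mv_eval A g t \<in> X"
      using subterms_X[of s] subterms_X[of t] self_in_subterms[of s] self_in_subterms[of t]
      by (auto simp: T_def)
    then have "\<rho> (mv_eval A g s) \<noteq> \<rho> (mv_eval A g t)"
      using neq mv_partial_embeddingD(2)[OF \<rho>] by (simp add: inj_on_eq_iff)
    then show "mv_eval unit_interval (\<lambda>b\<in>carrier B. \<rho> (g b)) s \<noteq>
        mv_eval unit_interval (\<lambda>b\<in>carrier B. \<rho> (g b)) t"
      using st by (simp add: mv_eval_partial_embedding[OF \<rho> _ subterms_X] T_def)
  qed
qed

theorem free_mv_separated:
  assumes B: "kleene_algebra B" "finite (carrier B)"
    and st: "s \<in> carrier (kleene_terms B)" "t \<in> carrier (kleene_terms B)"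
    and neq: "free_mv_cong B `` {s} \<noteq> free_mv_cong B `` {t}"
  obtains \<phi> where "\<phi> \<in> kleene_hom B (underlying_kleene unit_interval)"
    "mv_eval unit_interval \<phi> s \<noteq> mv_eval unit_interval \<phi> t"
proof -
  interpret F: mv_algebra "free_mv B"
    by (rule mv_algebra_free_mv[OF B(1)])
  obtain C :: "'a mv_term set set mv" and h
    where C: "mv_chain C" and h: "h \<in> mv_hom (free_mv B) C"
      and "h (free_mv_cong B `` {s}) \<noteq> h (free_mv_cong B `` {t})"
    using F.mv_chain_hom_separates[OF free_mv_class_closed[OF B(1) st(1)] free_mv_class_closed[OF B(1) st(2)] neq] .
  then have "mv_eval C (\<lambda>b\<in>carrier B. h (free_mv_unit B b)) s \<noteq> mv_eval C (\<lambda>b\<in>carrier B. h (free_mv_unit B b)) t"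
    using mv_hom_free_mv_class[OF B(1) h] st by simp
  then show ?thesis
    using mv_chain.exists_separating_kleene_hom_unit_interval[OF C B kleene_hom_comp_free_mv_unit[OF B(1) h] st] that
    by blast
qed

section \<open>Max-min representation of piecewise linear functions\<close>

lemma piece_through_closure_point:
  fixes f :: "'a :: topological_space \<Rightarrow> 'b :: real_normed_vector"
  assumes S: "S \<subseteq> D" "x \<in> closure S" and "closed D"
    and f: "continuous_on D f" and L: "finite L" "\<And>l. l \<in> L \<Longrightarrow> continuous_on D l"
    and pieces: "\<And>y. y \<in> S \<Longrightarrow> \<exists>l\<in>L. f y = l y"
  obtains l y where "l \<in> L" "f x = l x" "y \<in> S" "f y = l y"
proof -
  define C where "C l = {y \<in> D. f y = l y}" for l
  have closed: "closed (C l)" if "l \<in> L" for l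
    using continuous_closed_preimage_constant[of D "\<lambda>y. f y - l y" 0] \<open>closed D\<close> f L(2)[OF that]
    by (simp add: C_def continuous_on_diff)
  have "S \<subseteq> (\<Union>l\<in>L. S \<inter> C l)"
    using S(1) pieces by (fastforce simp: C_def)
  also have "\<dots> \<subseteq> (\<Union>l\<in>L. closure (S \<inter> C l))"
    by (intro UN_mono closure_subset order_refl)
  finally have "closure S \<subseteq> (\<Union>l\<in>L. closure (S \<inter> C l))"
    using L(1) by (intro closure_minimal closed_UN) auto
  then obtain l where l: "l \<in> L" "x \<in> closure (S \<inter> C l)"
    using S(2) by blast
  then have "x \<in> C l"
    using closure_minimal[of "S \<inter> C l" "C l"] closed by blast
  moreover obtain y where "y \<in> S \<inter> C l"
    using l(2) by (cases "S \<inter> C l = {}") auto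
  ultimately show ?thesis
    using l(1) by (intro that[of l y]) (auto simp: C_def)
qed

lemma affine_less_after_crossing:
  fixes a b a' b' s t :: real
  assumes "a' < a" "a + b * s \<le> a' + b' * s" "0 \<le> s" "s < t"
  shows "a + b * t < a' + b' * t"
proof -
  have "(b - b') * s < 0"
    using assms(1,2) by (simp add: algebra_simps)
  then have "b < b'"
    using assms(3) by (simp add: mult_less_0_iff)
  then have "(b - b') * (t - s) < 0"
    using assms(4) by (simp add: mult_neg_pos)
  then show ?thesis
    using assms(2) by (simp add: algebra_simps)
qed

text \<open>Otherwise the pieces that start below \<open>f 0\<close> all end below \<open>f 1\<close>.  After the last time at which
  \<open>f\<close> is bounded by one of them, \<open>f\<close> follows a piece that starts higher, hence is less steep and can
  only stay below.\<close>

lemma exists_piece_crossing_segment: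
  fixes f :: "real \<Rightarrow> real"
  assumes f: "continuous_on {0..1} f"
    and L: "finite L" "\<And>l. l \<in> L \<Longrightarrow> \<exists>a b. l = (\<lambda>t. a + b * t)"
    and pieces: "\<And>t. t \<in> {0..1} \<Longrightarrow> \<exists>l\<in>L. f t = l t"
  shows "\<exists>l\<in>L. l 0 \<le> f 0 \<and> f 1 \<le> l 1"
proof (rule ccontr)
  assume "\<not> ?thesis"
  then have below: "l 1 < f 1" if "l \<in> L" "l 0 \<le> f 0" for l
    using that by force
  have cont: "continuous_on {0..1} l" if "l \<in> L" for l
    using L(2)[OF that] by (auto intro!: continuous_intros)
  define T where "T = (\<Union>l\<in>{l \<in> L. l 0 \<le> f 0}. {t \<in> {0..1}. f t \<le> l t})"
  have "closed T"
    unfolding T_def using L(1) f cont by (intro closed_UN ballI continuous_on_closed_Collect_le) auto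
  moreover have "0 \<in> T"
    using pieces[of 0] by (force simp: T_def)
  moreover have bdd: "bdd_above T"
    by (rule bdd_aboveI[of _ 1]) (auto simp: T_def)
  ultimately have "Sup T \<in> T"
    by (intro closed_contains_Sup) auto
  then obtain k where k: "k \<in> L" "k 0 \<le> f 0" "f (Sup T) \<le> k (Sup T)" "Sup T \<in> {0..1}"
    by (auto simp: T_def)
  have "Sup T < 1"
    using below[OF k(1,2)] k(3,4) by (cases "Sup T = 1") auto
  have above: "l t < f t" if "t \<in> {Sup T<..1}" "l \<in> L" "l 0 \<le> f 0" for l t
    using that cSup_upper[OF _ bdd, of t] k(4) by (force simp: T_def not_le[symmetric])
  obtain l t where l: "l \<in> L" "f (Sup T) = l (Sup T)" and t: "t \<in> {Sup T<..1}" "f t = l t"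
    by (rule piece_through_closure_point[of "{Sup T<..1}" "{0..1}" "Sup T" f L])
      (use \<open>Sup T < 1\<close> k(4) f L(1) cont pieces in auto)
  have "f 0 < l 0"
    using above[OF t(1) l(1)] t(2) by force
  obtain a b a' b' where ab: "l = (\<lambda>t. a + b * t)" "k = (\<lambda>t. a' + b' * t)"
    using L(2) l(1) k(1) by metis
  have "l t < k t"
    using affine_less_after_crossing[of a' a b "Sup T" b' t] \<open>f 0 < l 0\<close> k(2-4) l(2) t(1)
    by (simp add: ab)
  then show False
    using above[OF t(1) k(1,2)] t(2) by simp
qed

lemma int_affine_on_segment:
  assumes "l \<in> int_affine d"
  shows "\<exists>a b. (\<lambda>t. l (\<lambda>i. x i + t * (y i - x i))) = (\<lambda>t. a + b * t)"
proof -
  obtain c a where "l = (\<lambda>x. real_of_int c + (\<Sum>i<d. real_of_int (a i) * x i))"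
    using assms by (auto simp: int_affine_def)
  then have "(\<lambda>t. l (\<lambda>i. x i + t * (y i - x i))) =
      (\<lambda>t. (c + (\<Sum>i<d. a i * x i)) + (\<Sum>i<d. a i * (y i - x i)) * t)"
    by (auto simp: algebra_simps sum.distrib sum_distrib_left sum_subtractf)
  then show ?thesis by blast
qed

lemma continuous_map_segment_Euclidean_space:
  assumes "x \<in> topspace (Euclidean_space d)" "y \<in> topspace (Euclidean_space d)"
  shows "continuous_map euclideanreal (Euclidean_space d) (\<lambda>t i. x i + t * (y i - x i))"
proof -
  have "continuous_map euclideanreal (powertop_real UNIV) (\<lambda>t i. x i + t * (y i - x i))"
    unfolding continuous_map_componentwise_UNIV by (auto intro!: continuous_intros)
  then show ?thesis
    using assms by (auto simp: Euclidean_space_def continuous_map_in_subtopology topspace_Euclidean_space)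
qed

lemma exists_separating_piece:
  assumes f: "continuous_map (Euclidean_space d) euclideanreal f"
    and L: "finite L" "L \<subseteq> int_affine d"
    and pieces: "\<And>x. x \<in> topspace (Euclidean_space d) \<Longrightarrow> \<exists>l\<in>L. f x = l x"
    and x: "x \<in> topspace (Euclidean_space d)" and y: "y \<in> topspace (Euclidean_space d)"
  shows "\<exists>l\<in>L. l x \<le> f x \<and> f y \<le> l y"
proof -
  define p where "p = (\<lambda>t i. x i + t * (y i - x i))"
  have p: "continuous_map euclideanreal (Euclidean_space d) p"
    unfolding p_def by (rule continuous_map_segment_Euclidean_space[OF x y])
  have "\<exists>l\<in>(\<lambda>l t. l (p t)) ` L. l 0 \<le> f (p 0) \<and> f (p 1) \<le> l 1"
  proof (rule exists_piece_crossing_segment)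
    show "continuous_on {0..1} (\<lambda>t. f (p t))"
      using continuous_map_compose[OF p f] by (auto simp: comp_def intro: continuous_on_subset)
    show "\<exists>a b. l = (\<lambda>t. a + b * t)" if "l \<in> (\<lambda>l t. l (p t)) ` L" for l
      using that L(2) int_affine_on_segment[of _ d x y] by (auto simp: p_def)
    show "\<exists>l\<in>(\<lambda>l t. l (p t)) ` L. f (p t) = l t" for t
      using pieces[of "p t"] continuous_map_image_subset_topspace[OF p] by auto
  qed (use L(1) in simp)
  moreover have "p 0 = x" "p 1 = y"
    by (auto simp: p_def)
  ultimately show ?thesis by auto
qed

theorem int_piecewise_linear_max_min:
  assumes "int_piecewise_linear d f"
  obtains F where "finite F" "F \<noteq> {}" "\<And>G. G \<in> F \<Longrightarrow> finite G \<and> G \<noteq> {} \<and> G \<subseteq> int_affine d"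
    "\<And>x. x \<in> topspace (Euclidean_space d) \<Longrightarrow> f x = (MAX G\<in>F. MIN l\<in>G. l x)"
proof -
  let ?E = "topspace (Euclidean_space d)"
  obtain L where f: "continuous_map (Euclidean_space d) euclideanreal f"
    and L: "finite L" "L \<subseteq> int_affine d" "\<And>x. x \<in> ?E \<Longrightarrow> \<exists>l\<in>L. f x = l x"
    using assms by (auto simp: int_piecewise_linear_def)
  define G where "G y = {l \<in> L. f y \<le> l y}" for y
  define F where "F = G ` ?E"
  have finF: "finite F"
    using L(1) by (intro finite_subset[of F "Pow L"]) (auto simp: F_def G_def)
  have G: "finite (G y)" "G y \<subseteq> int_affine d" for y
    using L(1,2) by (auto simp: G_def)
  have G_ne: "G y \<noteq> {}" if "y \<in> ?E" for y
    using L(3)[OF that] by (force simp: G_def)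
  have "(\<lambda>_. 0) \<in> ?E"
    by (simp add: topspace_Euclidean_space)
  then have F_ne: "F \<noteq> {}"
    by (auto simp: F_def)
  have "(MAX G\<in>F. MIN l\<in>G. l x) = f x" if x: "x \<in> ?E" for x
  proof (rule antisym)
    have "(MIN l\<in>G y. l x) \<le> f x" if y: "y \<in> ?E" for y
    proof -
      obtain l where "l \<in> L" "l x \<le> f x" "f y \<le> l y"
        using exists_separating_piece[OF f L x y] by blast
      then show ?thesis
        using G(1)[of y] by (intro order_trans[OF Min_le[of _ "l x"]]) (auto simp: G_def)
    qed
    then show "(MAX G\<in>F. MIN l\<in>G. l x) \<le> f x"
      using finF F_ne by (subst Max_le_iff) (auto simp: F_def)
    have "f x \<le> (MIN l\<in>G x. l x)"
      using G(1) G_ne[OF x] by (subst Min_ge_iff) (auto simp: G_def)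
    also have "\<dots> \<le> (MAX G\<in>F. MIN l\<in>G. l x)"
      using finF x by (intro Max_ge) (auto simp: F_def)
    finally show "f x \<le> (MAX G\<in>F. MIN l\<in>G. l x)" .
  qed
  moreover have "finite G' \<and> G' \<noteq> {} \<and> G' \<subseteq> int_affine d" if "G' \<in> F" for G'
    using that G G_ne by (auto simp: F_def)
  ultimately show ?thesis
    using that[OF finF F_ne] by simp
qed

section \<open>Truncated integral affine functions\<close>

definition trunc :: "real \<Rightarrow> real" where
  "trunc r = max 0 (min 1 r)"

lemma mono_trunc: "mono trunc"
  by (auto simp: mono_def trunc_def)

lemma trunc_of_int: "trunc (real_of_int c) = (if 1 \<le> c then 1 else 0)"
  by (auto simp: trunc_def)

lemma trunc_id: "0 \<le> r \<Longrightarrow> r \<le> 1 \<Longrightarrow> trunc r = r"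
  by (simp add: trunc_def)

lemma trunc_add:
  assumes "0 \<le> s" "s \<le> 1"
  shows "max 0 (min (trunc r + s) 1 - (1 - trunc (r + 1))) = trunc (r + s)"
proof -
  consider "r \<le> -1" | "-1 \<le> r" "r \<le> 0" | "0 \<le> r" "r \<le> 1" | "1 \<le> r"
    by linarith
  then show ?thesis
    using assms by cases (auto simp: trunc_def min_def max_def)
qed

locale mv_function_algebra =
  fixes X :: "'x set" and H :: "('x \<Rightarrow> real) set"
  assumes range: "f \<in> H \<Longrightarrow> x \<in> X \<Longrightarrow> 0 \<le> f x \<and> f x \<le> 1"
    and zero: "(\<lambda>x\<in>X. 0) \<in> H"
    and neg: "f \<in> H \<Longrightarrow> (\<lambda>x\<in>X. 1 - f x) \<in> H"
    and add: "f \<in> H \<Longrightarrow> g \<in> H \<Longrightarrow> (\<lambda>x\<in>X. min (f x + g x) 1) \<in> H"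
begin

definition represented :: "('x \<Rightarrow> real) \<Rightarrow> bool" where
  "represented f \<longleftrightarrow> restrict f X \<in> H"

lemma represented_cong: "(\<And>x. x \<in> X \<Longrightarrow> f x = g x) \<Longrightarrow> represented f \<longleftrightarrow> represented g"
  by (simp add: represented_def cong: restrict_cong)

lemma represented_range: "represented f \<Longrightarrow> x \<in> X \<Longrightarrow> 0 \<le> f x \<and> f x \<le> 1"
  using range[of "restrict f X" x] by (simp add: represented_def)

lemma represented_zero: "represented (\<lambda>_. 0)"
  using zero by (simp add: represented_def)

lemma represented_neg: "represented f \<Longrightarrow> represented (\<lambda>x. 1 - f x)"
  using neg[of "restrict f X"] by (simp add: represented_def cong: restrict_cong)

lemma represented_add: "represented f \<Longrightarrow> represented g \<Longrightarrow> represented (\<lambda>x. min (f x + g x) 1)"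
  using add[of "restrict f X" "restrict g X"] by (simp add: represented_def cong: restrict_cong)

lemma represented_one: "represented (\<lambda>_. 1)"
  using represented_neg[OF represented_zero] by simp

lemma represented_diff:
  assumes "represented f" "represented g"
  shows "represented (\<lambda>x. max 0 (f x - g x))"
  using represented_neg[OF represented_add[OF represented_neg[OF assms(1)] assms(2)]]
  by (rule represented_cong[THEN iffD1, rotated]) (auto simp: min_def max_def)

lemma represented_max:
  assumes "represented f" "represented g"
  shows "represented (\<lambda>x. max (f x) (g x))"
  using represented_add[OF represented_diff[OF assms] assms(2)]
  by (rule represented_cong[THEN iffD1, rotated])
     (use assms[THEN represented_range] in \<open>force simp: min_def max_def\<close>)

lemma represented_min:
  assumes "represented f" "represented g"
  shows "represented (\<lambda>x. min (f x) (g x))"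
  using represented_neg[OF represented_max[OF assms[THEN represented_neg]]]
  by (rule represented_cong[THEN iffD1, rotated]) (auto simp: min_def max_def)

lemma represented_Max:
  assumes "finite I" "I \<noteq> {}" "\<And>i. i \<in> I \<Longrightarrow> represented (f i)"
  shows "represented (\<lambda>x. MAX i\<in>I. f i x)"
  using assms by (induction I rule: finite_ne_induct) (simp_all add: represented_max)

lemma represented_Min:
  assumes "finite I" "I \<noteq> {}" "\<And>i. i \<in> I \<Longrightarrow> represented (f i)"
  shows "represented (\<lambda>x. MIN i\<in>I. f i x)"
  using assms by (induction I rule: finite_ne_induct) (simp_all add: represented_min)

definition truncs_represented :: "('x \<Rightarrow> real) \<Rightarrow> bool" where
  "truncs_represented f \<longleftrightarrow> (\<forall>c::int. represented (\<lambda>x. trunc (f x + c)))"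

lemma truncs_represented_const: "truncs_represented (\<lambda>_. real_of_int k)"
  unfolding truncs_represented_def
proof
  show "represented (\<lambda>x. trunc (real_of_int k + real_of_int c))" for c
    using trunc_of_int[of "k + c"] by (simp add: represented_zero represented_one)
qed

lemma truncs_represented_shift:
  assumes "truncs_represented f"
  shows "truncs_represented (\<lambda>x. f x + real_of_int k)"
  unfolding truncs_represented_def
proof
  show "represented (\<lambda>x. trunc (f x + real_of_int k + real_of_int c))" for c
    using assms[unfolded truncs_represented_def, THEN spec, of "k + c"] by (simp add: add.assoc)
qed

lemma truncs_represented_add:
  assumes f: "truncs_represented f" and g: "represented g"
  shows "truncs_represented (\<lambda>x. f x + g x)"
  unfolding truncs_represented_def
proof
  fix c :: int
  have "represented (\<lambda>x. trunc (f x + c))" "represented (\<lambda>x. trunc (f x + c + 1))"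
    using f[unfolded truncs_represented_def, THEN spec, of c]
      f[unfolded truncs_represented_def, THEN spec, of "c + 1"] by (simp_all add: add.assoc)
  then have "represented (\<lambda>x. max 0 (min (trunc (f x + c) + g x) 1 - (1 - trunc (f x + c + 1))))"
    by (intro represented_diff represented_add represented_neg g)
  then have "represented (\<lambda>x. trunc (f x + c + g x))"
    by (rule represented_cong[THEN iffD1, rotated]) (use represented_range[OF g] in \<open>simp add: trunc_add\<close>)
  then show "represented (\<lambda>x. trunc (f x + g x + c))"
    by (simp add: add_ac)
qed

lemma truncs_represented_diff:
  assumes "truncs_represented f" "represented g"
  shows "truncs_represented (\<lambda>x. f x - g x)"
  using truncs_represented_add[OF truncs_represented_shift[OF assms(1), of "-1"] represented_neg[OF assms(2)]]
  by simp

lemma truncs_represented_add_mult: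
  assumes "truncs_represented f" "represented g"
  shows "truncs_represented (\<lambda>x. f x + real_of_int k * g x)"
proof (induction k rule: int_induct[of _ 0])
  case base
  then show ?case using assms(1) by simp
next
  case (step1 i)
  show ?case using truncs_represented_add[OF step1(2) assms(2)] by (simp add: algebra_simps)
next
  case (step2 i)
  show ?case using truncs_represented_diff[OF step2(2) assms(2)] by (simp add: algebra_simps)
qed

lemma truncs_represented_affine:
  assumes "finite I" "\<And>i. i \<in> I \<Longrightarrow> represented (g i)"
  shows "truncs_represented (\<lambda>x. real_of_int c + (\<Sum>i\<in>I. real_of_int (a i) * g i x))"
  using assms
proof (induction I rule: finite_induct)
  case (insert i I)
  then show ?case
    using truncs_represented_add_mult[OF insert.IH, of "g i" "a i"] by (simp add: algebra_simps)
qed (simp add: truncs_represented_const)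

end

theorem represented_int_piecewise_linear:
  assumes "mv_function_algebra X H"
    and coord: "\<And>i. i < d \<Longrightarrow> mv_function_algebra.represented X H (\<lambda>x. x i)"
    and X: "X \<subseteq> topspace (Euclidean_space d)"
    and f: "int_piecewise_linear d f" and f01: "f ` X \<subseteq> {0..1}"
  shows "mv_function_algebra.represented X H f"
proof -
  interpret mv_function_algebra X H by fact
  obtain F where F: "finite F" "F \<noteq> {}" "\<And>G. G \<in> F \<Longrightarrow> finite G \<and> G \<noteq> {} \<and> G \<subseteq> int_affine d"
    "\<And>x. x \<in> topspace (Euclidean_space d) \<Longrightarrow> f x = (MAX G\<in>F. MIN l\<in>G. l x)"
    using int_piecewise_linear_max_min[OF f] by blast
  have "represented (\<lambda>x. trunc (l x))" if affine: "l \<in> int_affine d" for l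
  proof -
    obtain c a where l: "l = (\<lambda>x. real_of_int c + (\<Sum>i<d. real_of_int (a i) * x i))"
      using affine by (auto simp: int_affine_def)
    have "truncs_represented l"
      unfolding l using coord by (intro truncs_represented_affine) simp_all
    then have "represented (\<lambda>x. trunc (l x + real_of_int 0))"
      unfolding truncs_represented_def by blast
    then show ?thesis by simp
  qed
  then have "represented (\<lambda>x. MAX G\<in>F. MIN l\<in>G. trunc (l x))"
    by (intro represented_Max represented_Min) (use F in auto)
  moreover have "(MAX G\<in>F. MIN l\<in>G. trunc (l x)) = f x" if "x \<in> X" for x
  proof -
    have "(MIN l\<in>G. trunc (l x)) = trunc (MIN l\<in>G. l x)" if "G \<in> F" for G
      using F(3)[OF that] mono_Min_commute[OF mono_trunc, of "(\<lambda>l. l x) ` G"] by (simp add: image_image)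
    then have "(MAX G\<in>F. MIN l\<in>G. trunc (l x)) = (MAX G\<in>F. trunc (MIN l\<in>G. l x))"
      by (simp cong: image_cong)
    also have "\<dots> = trunc (MAX G\<in>F. MIN l\<in>G. l x)"
      using F mono_Max_commute[OF mono_trunc, of "(\<lambda>G. MIN l\<in>G. l x) ` F"] by (simp add: image_image)
    also have "\<dots> = trunc (f x)"
      using F(4) X that by auto
    also have "\<dots> = f x"
      using f01 that by (intro trunc_id) auto
    finally show ?thesis .
  qed
  ultimately show ?thesis
    by (rule represented_cong[THEN iffD1, rotated])
qed

section \<open>Points of the companion polyhedron\<close>

lemma mem_conv_finite_image_iff:
  assumes "inj_on v I"
  shows "x \<in> conv_finite (v ` I) \<longleftrightarrow>
    (\<exists>u. (\<forall>i\<in>I. 0 \<le> u i) \<and> sum u I = 1 \<and> x = (\<lambda>j. \<Sum>i\<in>I. u i * v i j))"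
proof
  assume "x \<in> conv_finite (v ` I)"
  then obtain u where "\<forall>p\<in>v ` I. 0 \<le> u p" "sum u (v ` I) = 1" "x = (\<lambda>j. \<Sum>p\<in>v ` I. u p * p j)"
    by (auto simp: conv_finite_def)
  then show "\<exists>u. (\<forall>i\<in>I. 0 \<le> u i) \<and> sum u I = 1 \<and> x = (\<lambda>j. \<Sum>i\<in>I. u i * v i j)"
    using assms by (intro exI[of _ "\<lambda>i. u (v i)"]) (simp add: sum.reindex)
next
  assume "\<exists>u. (\<forall>i\<in>I. 0 \<le> u i) \<and> sum u I = 1 \<and> x = (\<lambda>j. \<Sum>i\<in>I. u i * v i j)"
  then obtain u where "\<forall>i\<in>I. 0 \<le> u i" "sum u I = 1" "x = (\<lambda>j. \<Sum>i\<in>I. u i * v i j)"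
    by blast
  then show "x \<in> conv_finite (v ` I)"
    unfolding conv_finite_def using assms
    by (intro CollectI exI[of _ "\<lambda>p. u (the_inv_into I v p)"]) (simp add: sum.reindex the_inv_into_f_f)
qed

lemma mem_conv_finite_scaled_basis_iff:
  assumes "finite I" and pos: "\<And>i. i \<in> I \<Longrightarrow> 0 < c i"
  shows "x \<in> conv_finite ((\<lambda>i j. std_basis i j / c i) ` I) \<longleftrightarrow>
    (\<forall>j. j \<notin> I \<longrightarrow> x j = 0) \<and> (\<forall>i\<in>I. 0 \<le> x i) \<and> (\<Sum>i\<in>I. c i * x i) = 1"
proof -
  have "inj_on (\<lambda>i j. std_basis i j / c i) I"
  proof (rule inj_onI)
    fix i k assume "i \<in> I" and eq: "(\<lambda>j. std_basis i j / c i) = (\<lambda>j. std_basis k j / c k)"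
    then show "i = k"
      using fun_cong[OF eq, of i] pos[of i] by (auto simp: std_basis_def split: if_splits)
  qed
  moreover have "(\<Sum>i\<in>I. u i * (std_basis i j / c i)) = (if j \<in> I then u j / c j else 0)" for u j
  proof -
    have "(\<Sum>i\<in>I. u i * (std_basis i j / c i)) = (\<Sum>i\<in>I. if i = j then u j / c j else 0)"
      by (rule sum.cong) (auto simp: std_basis_def)
    then show ?thesis using \<open>finite I\<close> by simp
  qed
  ultimately have "x \<in> conv_finite ((\<lambda>i j. std_basis i j / c i) ` I) \<longleftrightarrow>
      (\<exists>u. (\<forall>i\<in>I. 0 \<le> u i) \<and> sum u I = 1 \<and> x = (\<lambda>j. if j \<in> I then u j / c j else 0))"
    by (simp add: mem_conv_finite_image_iff)
  also have "\<dots> \<longleftrightarrow> (\<forall>j. j \<notin> I \<longrightarrow> x j = 0) \<and> (\<forall>i\<in>I. 0 \<le> x i) \<and> (\<Sum>i\<in>I. c i * x i) = 1"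
    (is "?L \<longleftrightarrow> ?R")
  proof
    assume ?L
    then obtain u where u: "\<forall>i\<in>I. 0 \<le> u i" "sum u I = 1" "x = (\<lambda>j. if j \<in> I then u j / c j else 0)"
      by blast
    moreover have "(\<Sum>i\<in>I. c i * x i) = sum u I"
      using pos by (intro sum.cong) (force simp: u(3))+
    ultimately show ?R
      using pos by (auto intro: divide_nonneg_pos)
  next
    assume ?R
    then show ?L
      using pos by (intro exI[of _ "\<lambda>i. c i * x i"]) (force simp: fun_eq_iff intro: mult_nonneg_nonneg less_imp_le)
  qed
  finally show ?thesis .
qed

theorem mem_companion_polyhedron_iff:
  assumes w: "inj_on w {..<d}" and pos: "\<And>i. i < d \<Longrightarrow> 0 < \<omega> (w i)"
    and down: "\<And>S T. S \<in> N \<Longrightarrow> T \<subseteq> S \<Longrightarrow> T \<in> N"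
  shows "x \<in> companion_polyhedron d w N \<omega> \<longleftrightarrow> (\<forall>j\<ge>d. x j = 0) \<and> (\<forall>i<d. 0 \<le> x i) \<and>
    (\<Sum>i<d. real (\<omega> (w i)) * x i) = 1 \<and> w ` {i. i < d \<and> x i \<noteq> 0} \<in> N"
proof -
  define I where "I S = {i. i < d \<and> w i \<in> S}" for S
  have "{(\<lambda>j. std_basis i j / real (\<omega> (w i))) | i. i < d \<and> w i \<in> S} =
      (\<lambda>i j. std_basis i j / real (\<omega> (w i))) ` I S" for S
    unfolding I_def by blast
  moreover have "x \<in> conv_finite ((\<lambda>i j. std_basis i j / real (\<omega> (w i))) ` I S) \<longleftrightarrow>
      (\<forall>j. j \<notin> I S \<longrightarrow> x j = 0) \<and> (\<forall>i\<in>I S. 0 \<le> x i) \<and> (\<Sum>i\<in>I S. real (\<omega> (w i)) * x i) = 1" for S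
    by (rule mem_conv_finite_scaled_basis_iff) (simp_all add: I_def pos)
  ultimately have "x \<in> companion_polyhedron d w N \<omega> \<longleftrightarrow> (\<exists>S\<in>N. (\<forall>j. j \<notin> I S \<longrightarrow> x j = 0) \<and>
      (\<forall>i\<in>I S. 0 \<le> x i) \<and> (\<Sum>i\<in>I S. real (\<omega> (w i)) * x i) = 1)"
    by (simp add: companion_polyhedron_def)
  also have "\<dots> \<longleftrightarrow> (\<exists>S\<in>N. (\<forall>j. j \<notin> I S \<longrightarrow> x j = 0) \<and> (\<forall>i<d. 0 \<le> x i) \<and>
      (\<Sum>i<d. real (\<omega> (w i)) * x i) = 1)"
  proof (intro bex_cong HOL.refl conj_cong)
    fix S assume zero: "\<forall>j. j \<notin> I S \<longrightarrow> x j = 0"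
    have "0 \<le> x i" if "i \<notin> I S" for i
      using zero that by simp
    then show "(\<forall>i\<in>I S. 0 \<le> x i) \<longleftrightarrow> (\<forall>i<d. 0 \<le> x i)"
      unfolding I_def by blast
    have "(\<Sum>i\<in>I S. real (\<omega> (w i)) * x i) = (\<Sum>i<d. real (\<omega> (w i)) * x i)"
      using zero by (intro sum.mono_neutral_left) (auto simp: I_def)
    then show "(\<Sum>i\<in>I S. real (\<omega> (w i)) * x i) = 1 \<longleftrightarrow> (\<Sum>i<d. real (\<omega> (w i)) * x i) = 1"
      by simp
  qed
  also have "(\<exists>S\<in>N. (\<forall>j. j \<notin> I S \<longrightarrow> x j = 0) \<and> Q) \<longleftrightarrow>
      (\<forall>j\<ge>d. x j = 0) \<and> Q \<and> w ` {i. i < d \<and> x i \<noteq> 0} \<in> N" for Q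
  proof -
    have "(\<forall>j. j \<notin> I S \<longrightarrow> x j = 0) \<longleftrightarrow> (\<forall>j\<ge>d. x j = 0) \<and> w ` {i. i < d \<and> x i \<noteq> 0} \<subseteq> S" for S
      by (force simp: I_def not_le)
    then show ?thesis
      using down by blast
  qed
  finally show ?thesis by simp
qed

section \<open>Finite Kleene algebras and their dual spaces\<close>

lemma nerve_subset: "S \<in> nerve W R \<Longrightarrow> T \<subseteq> S \<Longrightarrow> T \<in> nerve W R"
  unfolding nerve_def by blast

lemma dual_pointD:
  assumes "h \<in> dual_points B"
  shows "b \<in> carrier B \<Longrightarrow> h b \<in> {0, 1/2, 1}"
    "a \<in> carrier B \<Longrightarrow> b \<in> carrier B \<Longrightarrow> h (k_join B a b) = max (h a) (h b)"
    "a \<in> carrier B \<Longrightarrow> b \<in> carrier B \<Longrightarrow> h (k_meet B a b) = min (h a) (h b)"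
    "b \<in> carrier B \<Longrightarrow> h (k_neg B b) = 1 - h b"
    "h (k_zero B) = 0"
  using assms by (auto simp: dual_points_def kleene_hom_def K3_def)

lemma dual_point_eqI:
  assumes "h \<in> dual_points B" "h' \<in> dual_points B" "\<And>b. b \<in> carrier B \<Longrightarrow> h b = h' b"
  shows "h = h'"
  using assms by (intro extensionalityI[of h "carrier B"]) (auto simp: dual_points_def kleene_hom_def PiE_def)

lemma dual_le_refl: "h \<in> dual_points B \<Longrightarrow> dual_le B h h"
  using dual_pointD(1)[of h B] by (auto simp: dual_le_def K3_le_def)

lemma dual_le_trans: "dual_le B f g \<Longrightarrow> dual_le B g h \<Longrightarrow> dual_le B f h"
  by (fastforce simp: dual_le_def K3_le_def)

lemma dual_le_antisym:
  "h \<in> dual_points B \<Longrightarrow> h' \<in> dual_points B \<Longrightarrow> dual_le B h h' \<Longrightarrow> dual_le B h' h \<Longrightarrow> h = h'"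
  by (rule dual_point_eqI) (fastforce simp: dual_le_def K3_le_def)+

lemma dual_weight_pos: "0 < dual_weight B h"
  by (simp add: dual_weight_def)

lemma dual_weight_mult_in_Ints:
  assumes "h \<in> dual_points B" "b \<in> carrier B"
  shows "real (dual_weight B h) * h b \<in> \<int>"
proof (cases "h \<in> dual_M B")
  case True
  then show ?thesis
    using assms(2) by (auto simp: dual_weight_def dual_M_def image_subset_iff)
next
  case False
  have "2 * h b \<in> {0, 1, 2}"
    using dual_pointD(1)[OF assms] by auto
  then show ?thesis
    using False by (auto simp: dual_weight_def)
qed

context kleene_algebra
begin

lemma exists_finite_meet:
  assumes "finite F" "F \<noteq> {}" "F \<subseteq> carrier B"
  shows "\<exists>m\<in>carrier B. \<forall>h\<in>dual_points B. h m = Min (h ` F)"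
  using assms
proof (induction F rule: finite_ne_induct)
  case (insert b F)
  then obtain m where "m \<in> carrier B" "\<forall>h\<in>dual_points B. h m = Min (h ` F)"
    by auto
  then show ?case
    using insert by (intro bexI[of _ "k_meet B b m"]) (auto simp: meet_closed dual_pointD(3))
qed auto

definition principal_factor :: "('a \<Rightarrow> real) \<Rightarrow> 'a \<Rightarrow> 'a" where
  "principal_factor g b =
     (if g b = 1 then b else if g b = 0 then k_neg B b else k_meet B b (k_neg B b))"

lemma principal_factor_closed: "b \<in> carrier B \<Longrightarrow> principal_factor g b \<in> carrier B"
  by (simp add: principal_factor_def neg_closed meet_closed)

lemma dual_point_principal_factor:
  assumes "g \<in> dual_points B" "h \<in> dual_points B" "b \<in> carrier B"
  shows "h (principal_factor g b) =
    (if K3_le (h b) (g b) then if h b = 1/2 then 1/2 else 1 else 0)"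
  using dual_pointD(1)[OF assms(1,3)] dual_pointD(1)[OF assms(2,3)] assms(3)
  by (auto simp: principal_factor_def K3_le_def dual_pointD(3,4)[OF assms(2)] neg_closed)

lemma Min_principal_factor:
  assumes "finite (carrier B)" and g: "g \<in> dual_points B" and h: "h \<in> dual_points B"
  shows "Min (h ` principal_factor g ` carrier B) = (if dual_le B h g then 1 / dual_weight B h else 0)"
    (is "_ = ?r")
proof (rule Min_eqI)
  note factor = dual_point_principal_factor[OF g h]
  fix y assume "y \<in> h ` principal_factor g ` carrier B"
  then show "?r \<le> y"
    using factor dual_pointD(1)[OF h] h by (fastforce simp: dual_le_def dual_weight_def dual_M_def)
next
  note factor = dual_point_principal_factor[OF g h]
  consider b where "b \<in> carrier B" "\<not> K3_le (h b) (g b)" |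
    b where "b \<in> carrier B" "dual_le B h g" "h b = 1/2" | "dual_le B h g" "h \<in> dual_M B"
    using h dual_pointD(1)[OF h] by (fastforce simp: dual_le_def dual_M_def)
  then have "\<exists>b\<in>carrier B. h (principal_factor g b) = ?r"
  proof cases
    case (1 b)
    then show ?thesis using factor by (auto simp: dual_le_def)
  next
    case (2 b)
    then have "h \<notin> dual_M B" "K3_le (h b) (g b)"
      by (force simp: dual_M_def image_subset_iff, simp add: dual_le_def)
    then have "?r = 1/2" "h (principal_factor g b) = 1/2"
      using 2(2) by (simp add: dual_weight_def, simp only: factor[OF 2(1)] 2(3) if_True HOL.refl)
    then show ?thesis using 2(1) by metis
  next
    case 3
    then have "h (principal_factor g (k_zero B)) = 1"
      using factor[OF zero_closed] zero_closed by (auto simp: dual_le_def dual_pointD(5)[OF h])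
    then show ?thesis using 3 zero_closed by (auto simp: dual_weight_def)
  qed
  then show "?r \<in> h ` principal_factor g ` carrier B"
    by (metis imageI)
qed (use assms(1) in simp)

text \<open>The witness is the meet of the factors, each of which vanishes at \<open>h\<close> precisely when
  \<open>h b \<preceq> g b\<close> fails.\<close>

lemma exists_principal_element:
  assumes fin: "finite (carrier B)" and g: "g \<in> dual_points B"
  obtains c where "c \<in> carrier B"
    "\<And>h. h \<in> dual_points B \<Longrightarrow> h c = (if dual_le B h g then 1 / dual_weight B h else 0)"
proof -
  have "principal_factor g ` carrier B \<noteq> {}" "principal_factor g ` carrier B \<subseteq> carrier B"
    using zero_closed principal_factor_closed by auto
  then obtain c where "c \<in> carrier B" "\<forall>h\<in>dual_points B. h c = Min (h ` principal_factor g ` carrier B)"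
    using exists_finite_meet[of "principal_factor g ` carrier B"] fin by blast
  then show ?thesis
    using Min_principal_factor[OF fin g] by (intro that[of c]) simp_all
qed

end

section \<open>Homomorphisms into the unit interval as points\<close>

definition threshold :: "real \<Rightarrow> real \<Rightarrow> real" where
  "threshold t y = (if y \<le> t then 0 else if 1 - t \<le> y then 1 else 1/2)"

lemma mono_threshold: "t < 1/2 \<Longrightarrow> mono (threshold t)"
  by (auto simp: mono_def threshold_def)

lemma threshold_in_K3: "threshold t y \<in> {0, 1/2, 1}"
  by (simp add: threshold_def)

lemma threshold_one_minus: "t < 1/2 \<Longrightarrow> threshold t (1 - y) = 1 - threshold t y"
  by (auto simp: threshold_def)

lemma threshold_zero: "0 \<le> t \<Longrightarrow> threshold t 0 = 0"
  by (simp add: threshold_def)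

lemma K3_le_threshold: "s \<le> t \<Longrightarrow> t < 1/2 \<Longrightarrow> K3_le (threshold s y) (threshold t y)"
  by (auto simp: K3_le_def threshold_def)

lemma threshold_mean_low:
  assumes t: "strict_mono_on {..n} t" "t 0 = 0" "t n = 1/2" and j: "j \<le> n"
  shows "(\<Sum>k<n. 2 * (t (Suc k) - t k) * threshold (t k) (t j)) = t j"
proof -
  have less: "t i < t k \<longleftrightarrow> i < k" if "i \<le> n" "k \<le> n" for i k
    using strict_mono_on_less[OF t(1)] that by simp
  have "threshold (t k) (t j) = (if k < j then 1/2 else 0)" if "k < n" for k
  proof (cases "k < j")
    case True
    then have "t k < t j" "t j \<le> 1/2" "t k < 1/2"
      using less[of k j] less[of n j] less[of k n] j that t(3) by (auto simp: not_less)
    then show ?thesis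
      using True by (simp add: threshold_def)
  next
    case False
    then have "t j \<le> t k"
      using less[of k j] j that by simp
    then show ?thesis
      using False by (simp add: threshold_def)
  qed
  then have "(\<Sum>k<n. 2 * (t (Suc k) - t k) * threshold (t k) (t j)) =
      (\<Sum>k<n. if k < j then t (Suc k) - t k else 0)"
    by (intro sum.cong) auto
  also have "\<dots> = (\<Sum>k<j. t (Suc k) - t k)"
    using j by (intro sum.mono_neutral_cong_right) auto
  also have "\<dots> = t j"
    by (simp add: sum_lessThan_telescope t(2))
  finally show ?thesis .
qed

lemma threshold_weights_sum:
  assumes "t 0 = 0" "t n = 1/2"
  shows "(\<Sum>k<n. 2 * (t (Suc k) - t k :: real)) = 1"
  by (simp only: sum_distrib_left[symmetric] sum_lessThan_telescope) (simp add: assms)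

text \<open>This is the layer-cake formula \<open>y = 2 \<integral>\<^sub>0\<^sup>1\<^sup>/\<^sup>2 threshold t y dt\<close> for a step function.\<close>

lemma threshold_mean:
  assumes t: "strict_mono_on {..n} t" "t 0 = 0" "t n = 1/2" and y: "y \<in> t ` {..n} \<or> 1 - y \<in> t ` {..n}"
  shows "(\<Sum>k<n. 2 * (t (Suc k) - t k) * threshold (t k) y) = y"
  using y
proof
  assume "y \<in> t ` {..n}"
  then show ?thesis
    using threshold_mean_low[OF t] by auto
next
  assume "1 - y \<in> t ` {..n}"
  then have low: "(\<Sum>k<n. 2 * (t (Suc k) - t k) * threshold (t k) (1 - y)) = 1 - y"
    using threshold_mean_low[OF t] by auto
  have "threshold (t k) (1 - y) = 1 - threshold (t k) y" if "k < n" for k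
    using strict_mono_onD[OF t(1), of k n] that t(3) by (intro threshold_one_minus) simp
  then have "(\<Sum>k<n. 2 * (t (Suc k) - t k) * threshold (t k) (1 - y)) =
      (\<Sum>k<n. 2 * (t (Suc k) - t k)) - (\<Sum>k<n. 2 * (t (Suc k) - t k) * threshold (t k) y)"
    by (simp add: right_diff_distrib sum_subtractf)
  then show ?thesis
    using low threshold_weights_sum[of t n] t(2,3) by simp
qed

lemma exists_strict_mono_enumeration:
  fixes V :: "'a :: linorder set"
  assumes "finite V" "a \<in> V" "b \<in> V" "\<And>v. v \<in> V \<Longrightarrow> a \<le> v \<and> v \<le> b"
  obtains n t where "strict_mono_on {..n :: nat} t" "t ` {..n} = V" "t 0 = a" "t n = b"
proof -
  define xs where "xs = sorted_list_of_set V"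
  have xs: "set xs = V" "sorted_wrt (<) xs"
    using assms(1) by (simp_all add: xs_def)
  define n where "n = length xs - 1"
  have "xs \<noteq> []"
    using xs(1) assms(2) by auto
  then have less_iff: "k < length xs \<longleftrightarrow> k \<le> n" for k
    by (cases xs) (auto simp: n_def)
  have mono: "strict_mono_on {..n} ((!) xs)"
    using xs(2) by (auto simp: strict_mono_on_def less_iff intro: sorted_wrt_nth_less)
  have image: "(!) xs ` {..n} = V"
    using xs(1) by (auto simp: set_conv_nth less_iff)
  have nth_le: "xs ! i \<le> xs ! j" if "i \<le> j" "j \<le> n" for i j
    using strict_mono_on_leD[OF mono, of i j] that by simp
  obtain i j where "i \<le> n" "xs ! i = a" "j \<le> n" "xs ! j = b"
    using assms(2,3) image by (metis (no_types) atMost_iff imageE)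
  then have "xs ! 0 = a" "xs ! n = b"
    using nth_le[of 0 i] nth_le[of j n] assms(4)[of "xs ! 0"] assms(4)[of "xs ! n"] image by force+
  then show ?thesis
    using that[of n "(!) xs"] mono image by blast
qed

lemma kleene_hom_unit_intervalD:
  assumes "\<phi> \<in> kleene_hom B (underlying_kleene unit_interval)"
  shows "b \<in> carrier B \<Longrightarrow> 0 \<le> \<phi> b \<and> \<phi> b \<le> 1"
    "a \<in> carrier B \<Longrightarrow> b \<in> carrier B \<Longrightarrow> \<phi> (k_join B a b) = max (\<phi> a) (\<phi> b)"
    "a \<in> carrier B \<Longrightarrow> b \<in> carrier B \<Longrightarrow> \<phi> (k_meet B a b) = min (\<phi> a) (\<phi> b)"
    "b \<in> carrier B \<Longrightarrow> \<phi> (k_neg B b) = 1 - \<phi> b"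
    "\<phi> (k_zero B) = 0" "\<phi> (k_one B) = 1"
proof -
  have bounds: "0 \<le> \<phi> b \<and> \<phi> b \<le> 1" if "b \<in> carrier B" for b
    using assms that by (auto simp: kleene_hom_def underlying_kleene_def)
  then show "b \<in> carrier B \<Longrightarrow> 0 \<le> \<phi> b \<and> \<phi> b \<le> 1" .
  show "\<phi> (k_join B a b) = max (\<phi> a) (\<phi> b)" "\<phi> (k_meet B a b) = min (\<phi> a) (\<phi> b)"
    if "a \<in> carrier B" "b \<in> carrier B"
    using assms that bounds[OF that(1)] bounds[OF that(2)]
    by (auto simp: kleene_hom_def underlying_kleene_def mv_join_def mv_meet_def)
qed (use assms in \<open>auto simp: kleene_hom_def underlying_kleene_def\<close>)

lemma (in kleene_algebra) threshold_comp_kleene_hom_dual_point: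
  assumes \<phi>: "\<phi> \<in> kleene_hom B (underlying_kleene unit_interval)" and t: "0 \<le> t" "t < 1/2"
  shows "(\<lambda>b\<in>carrier B. threshold t (\<phi> b)) \<in> dual_points B"
proof -
  have "threshold t (max y z) = max (threshold t y) (threshold t z)"
    "threshold t (min y z) = min (threshold t y) (threshold t z)" for y z
    using mono_threshold[OF t(2)] by (simp_all add: max_of_mono min_of_mono)
  then show ?thesis
    using t threshold_one_minus[OF t(2), of 0] threshold_in_K3
    by (simp add: dual_points_def kleene_hom_def K3_def kleene_hom_unit_intervalD[OF \<phi>]
        threshold_one_minus threshold_zero join_closed meet_closed neg_closed zero_closed one_closed)
qed

lemma sum_fibre_weights:
  fixes u :: "'k \<Rightarrow> 'a :: semiring_0"
  assumes "finite I" "finite D" "\<kappa> ` I \<subseteq> D"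
  shows "(\<Sum>h\<in>D. (\<Sum>k | k \<in> I \<and> \<kappa> k = h. u k) * f h) = (\<Sum>k\<in>I. u k * f (\<kappa> k))"
proof -
  have "(\<Sum>h\<in>D. (\<Sum>k | k \<in> I \<and> \<kappa> k = h. u k) * f h) =
      (\<Sum>h\<in>D. \<Sum>k | k \<in> I \<and> \<kappa> k = h. u k * f (\<kappa> k))"
    unfolding sum_distrib_right by (intro sum.cong) auto
  then show ?thesis
    by (simp only: sum.group[OF assms])
qed

locale dual_kleene_space = kleene_algebra B for B :: "('a, 'm) kleene_scheme" +
  fixes w :: "nat \<Rightarrow> 'a \<Rightarrow> real" and d :: nat
  assumes finite_carrier: "finite (carrier B)"
    and enum: "bij_betw w {..<d} (dual_points B)"
begin

abbreviation w_le (infix "\<preceq>" 50) where "i \<preceq> j \<equiv> dual_le B (w i) (w j)"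
abbreviation weight ("\<omega>") where "\<omega> i \<equiv> real (dual_weight B (w i))"
abbreviation P where "P \<equiv> companion_polyhedron d w (nerve (dual_points B) (dual_le B)) (dual_weight B)"

lemma w_dual: "i < d \<Longrightarrow> w i \<in> dual_points B"
  using enum by (auto simp: bij_betw_def)

lemma mem_P_iff:
  "x \<in> P \<longleftrightarrow> (\<forall>j\<ge>d. x j = 0) \<and> (\<forall>i<d. 0 \<le> x i) \<and> (\<Sum>i<d. \<omega> i * x i) = 1 \<and>
     (\<forall>i<d. \<forall>j<d. x i \<noteq> 0 \<longrightarrow> x j \<noteq> 0 \<longrightarrow> i \<preceq> j \<or> j \<preceq> i)"
proof -
  have "x \<in> P \<longleftrightarrow> (\<forall>j\<ge>d. x j = 0) \<and> (\<forall>i<d. 0 \<le> x i) \<and> (\<Sum>i<d. \<omega> i * x i) = 1 \<and>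
      w ` {i. i < d \<and> x i \<noteq> 0} \<in> nerve (dual_points B) (dual_le B)"
    using bij_betw_imp_inj_on[OF enum] dual_weight_pos nerve_subset by (rule mem_companion_polyhedron_iff)
  moreover have "w ` {i. i < d \<and> x i \<noteq> 0} \<in> nerve (dual_points B) (dual_le B) \<longleftrightarrow>
      (\<forall>i<d. \<forall>j<d. x i \<noteq> 0 \<longrightarrow> x j \<noteq> 0 \<longrightarrow> i \<preceq> j \<or> j \<preceq> i)"
    unfolding nerve_def using w_dual by blast
  ultimately show ?thesis
    by (simp only:)
qed

lemma P_nonneg: "x \<in> P \<Longrightarrow> i < d \<Longrightarrow> 0 \<le> x i"
  by (simp only: mem_P_iff)

lemma P_weighted_sum: "x \<in> P \<Longrightarrow> (\<Sum>i<d. \<omega> i * x i) = 1"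
  by (simp only: mem_P_iff)

lemma P_support_chain:
  "x \<in> P \<Longrightarrow> i < d \<Longrightarrow> j < d \<Longrightarrow> x i \<noteq> 0 \<Longrightarrow> x j \<noteq> 0 \<Longrightarrow> i \<preceq> j \<or> j \<preceq> i"
  unfolding mem_P_iff by blast

lemma P_subset_Euclidean_space: "P \<subseteq> topspace (Euclidean_space d)"
  by (auto simp: mem_P_iff topspace_Euclidean_space)

definition lin :: "'a \<Rightarrow> (nat \<Rightarrow> real) \<Rightarrow> real" where
  "lin b x = (\<Sum>i<d. \<omega> i * w i b * x i)"

lemma exists_point_with_lin_eq_mean:
  assumes I: "finite I" "\<And>k. k \<in> I \<Longrightarrow> \<kappa> k \<in> dual_points B"
    and chain: "\<And>k l. k \<in> I \<Longrightarrow> l \<in> I \<Longrightarrow> dual_le B (\<kappa> k) (\<kappa> l) \<or> dual_le B (\<kappa> l) (\<kappa> k)"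
    and u: "\<And>k. k \<in> I \<Longrightarrow> 0 \<le> u k" "sum u I = 1"
  shows "\<exists>x\<in>P. \<forall>b. lin b x = (\<Sum>k\<in>I. u k * \<kappa> k b)"
proof -
  define \<mu> where "\<mu> h = (\<Sum>k | k \<in> I \<and> \<kappa> k = h. u k)" for h
  define x where "x i = (if i < d then \<mu> (w i) / \<omega> i else 0)" for i
  have "\<omega> i * x i = \<mu> (w i)" if "i < d" for i
    using that dual_weight_pos[of B "w i"] by (simp add: x_def)
  then have integral: "(\<Sum>i<d. \<omega> i * x i * f (w i)) = (\<Sum>k\<in>I. u k * f (\<kappa> k))" for f
    using sum_fibre_weights[OF I(1) bij_betw_finite[THEN iffD1, OF enum], of \<kappa> u f] I(2)
    by (simp add: \<mu>_def image_subset_iff flip: sum.reindex_bij_betw[OF enum])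
  have support: "\<exists>k\<in>I. \<kappa> k = w i" if "x i \<noteq> 0" for i
  proof (rule ccontr)
    assume "\<not> ?thesis"
    then have "{k. k \<in> I \<and> \<kappa> k = w i} = {}"
      by blast
    with that show False
      by (simp only: x_def \<mu>_def sum.empty) (simp split: if_splits)
  qed
  have "x \<in> P"
    unfolding mem_P_iff
  proof (intro conjI allI impI)
    show "0 \<le> x i" for i
      using u(1) by (auto simp: x_def \<mu>_def intro!: divide_nonneg_nonneg sum_nonneg)
    show "(\<Sum>i<d. \<omega> i * x i) = 1"
      using integral[of "\<lambda>_. 1"] u(2) by simp
    fix i j assume "x i \<noteq> 0" "x j \<noteq> 0"
    then obtain k l where "k \<in> I" "\<kappa> k = w i" "l \<in> I" "\<kappa> l = w j"
      using support[of i] support[of j] by blast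
    then show "i \<preceq> j \<or> j \<preceq> i"
      using chain[of k l] by simp
  qed (simp add: x_def)
  moreover have "lin b x = (\<Sum>k\<in>I. u k * \<kappa> k b)" for b
    using integral[of "\<lambda>h. h b"] by (simp add: lin_def mult_ac)
  ultimately show ?thesis
    by blast
qed

theorem kleene_hom_unit_interval_is_point:
  assumes \<phi>: "\<phi> \<in> kleene_hom B (underlying_kleene unit_interval)"
  shows "\<exists>x\<in>P. \<forall>b\<in>carrier B. lin b x = \<phi> b"
proof -
  note \<phi>D = kleene_hom_unit_intervalD[OF \<phi>]
  let ?V = "{0, 1/2} \<union> {y \<in> \<phi> ` carrier B. y \<le> 1/2}"
  have V: "0 \<le> y \<and> y \<le> 1/2" if "y \<in> ?V" for y
    using that \<phi>D(1) by auto
  obtain n and t :: "nat \<Rightarrow> real" where t: "strict_mono_on {..n} t" "t ` {..n} = ?V" "t 0 = 0" "t n = 1/2"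
    by (rule exists_strict_mono_enumeration[of ?V 0 "1/2"]) (use finite_carrier V in auto)
  have t_bounds: "0 \<le> t k" "t k < 1/2" if "k < n" for k
    using strict_mono_onD[OF t(1), of k n] strict_mono_on_leD[OF t(1), of 0 k] that t(3,4) by auto
  define \<kappa> where "\<kappa> k = (\<lambda>b\<in>carrier B. threshold (t k) (\<phi> b))" for k
  have chain: "dual_le B (\<kappa> k) (\<kappa> l)" if "k \<le> l" "l < n" for k l
    using strict_mono_on_leD[OF t(1), of k l] that t_bounds(2)
    by (auto simp: dual_le_def \<kappa>_def intro!: K3_le_threshold)
  have "\<exists>x\<in>P. \<forall>b. lin b x = (\<Sum>k\<in>{..<n}. 2 * (t (Suc k) - t k) * \<kappa> k b)"
  proof (rule exists_point_with_lin_eq_mean)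
    show "\<kappa> k \<in> dual_points B" if "k \<in> {..<n}" for k
      unfolding \<kappa>_def using that t_bounds by (intro threshold_comp_kleene_hom_dual_point[OF \<phi>]) auto
    show "dual_le B (\<kappa> k) (\<kappa> l) \<or> dual_le B (\<kappa> l) (\<kappa> k)" if "k \<in> {..<n}" "l \<in> {..<n}" for k l
      using chain[of k l] chain[of l k] that by (cases "k \<le> l") auto
    show "0 \<le> 2 * (t (Suc k) - t k)" if "k \<in> {..<n}" for k
      using strict_mono_onD[OF t(1), of k "Suc k"] that by simp
    show "(\<Sum>k\<in>{..<n}. 2 * (t (Suc k) - t k)) = 1"
      using t(3,4) by (rule threshold_weights_sum)
  qed simp
  then obtain x where x: "x \<in> P" "\<And>b. lin b x = (\<Sum>k<n. 2 * (t (Suc k) - t k) * \<kappa> k b)"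
    by blast
  have "lin b x = \<phi> b" if b: "b \<in> carrier B" for b
  proof -
    have "\<phi> b \<in> ?V \<or> 1 - \<phi> b \<in> ?V"
      using b \<phi>D(4)[OF b] neg_closed[OF b] by (cases "\<phi> b \<le> 1/2") (auto intro!: image_eqI[of _ \<phi> "k_neg B b"])
    then show ?thesis
      using threshold_mean[OF t(1,3,4), of "\<phi> b"] t(2) b by (simp add: x(2) \<kappa>_def)
  qed
  then show ?thesis
    using x(1) by blast
qed

end

section \<open>The linear functions of a finite Kleene algebra\<close>

lemma int_affine_imp_int_piecewise_linear:
  assumes "l \<in> int_affine d"
  shows "int_piecewise_linear d l"
proof -
  obtain c a where l: "l = (\<lambda>x. real_of_int c + (\<Sum>i<d. real_of_int (a i) * x i))"
    using assms by (auto simp: int_affine_def)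
  have "continuous_map (Euclidean_space d) euclideanreal (\<lambda>x. x i)" for i
    unfolding Euclidean_space_def
    by (intro continuous_map_from_subtopology continuous_map_product_projection) simp
  then have "continuous_map (Euclidean_space d) euclideanreal l"
    unfolding l by (intro continuous_map_add continuous_map_sum continuous_map_real_mult) simp_all
  then show ?thesis
    using assms unfolding int_piecewise_linear_def by (intro conjI exI[of _ "{l}"]) auto
qed

lemma K3_le_less_imp_le:
  assumes "K3_le x x'" "K3_le y y'" "x < y"
  shows "x' \<le> y'"
proof -
  have "x' \<in> {0, 1/2, 1}" "y' \<in> {0, 1/2, 1}" "x = x' \<or> x = 1/2" "y = y' \<or> y = 1/2" "x \<in> {0, 1/2, 1}"
    using assms(1,2) by (simp_all add: K3_le_def)
  then show ?thesis
    using assms(3) by auto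
qed

context dual_kleene_space
begin

lemma lin_int_piecewise_linear:
  assumes "b \<in> carrier B"
  shows "int_piecewise_linear d (lin b)"
proof (rule int_affine_imp_int_piecewise_linear)
  define a where "a i = \<lfloor>\<omega> i * w i b\<rfloor>" for i
  have "real_of_int (a i) = \<omega> i * w i b" if "i < d" for i
    using dual_weight_mult_in_Ints[OF w_dual[OF that] assms] by (simp add: a_def)
  then have "lin b = (\<lambda>x. real_of_int 0 + (\<Sum>i<d. real_of_int (a i) * x i))"
    by (simp add: lin_def[abs_def])
  then show "lin b \<in> int_affine d"
    unfolding int_affine_def by blast
qed

lemma lin_mono:
  assumes "x \<in> P" "\<And>i. i < d \<Longrightarrow> x i \<noteq> 0 \<Longrightarrow> w i a \<le> w i b"
  shows "lin a x \<le> lin b x"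
  unfolding lin_def
proof (rule sum_mono)
  fix i assume "i \<in> {..<d}"
  then show "\<omega> i * w i a * x i \<le> \<omega> i * w i b * x i"
    using assms(2) P_nonneg[OF assms(1)] by (cases "x i = 0") (auto intro!: mult_right_mono mult_left_mono)
qed

lemma lin_cong:
  assumes "\<And>i. i < d \<Longrightarrow> x i \<noteq> 0 \<Longrightarrow> w i a = w i b"
  shows "lin a x = lin b x"
  unfolding lin_def by (rule sum.cong) (use assms in auto)

lemma comparable_on_support:
  assumes x: "x \<in> P" and ab: "a \<in> carrier B" "b \<in> carrier B"
  shows "(\<forall>i<d. x i \<noteq> 0 \<longrightarrow> w i a \<le> w i b) \<or> (\<forall>i<d. x i \<noteq> 0 \<longrightarrow> w i b \<le> w i a)"
proof (rule ccontr)
  assume "\<not> ?thesis"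
  then obtain i j where ij: "i < d" "j < d" "x i \<noteq> 0" "x j \<noteq> 0" "w i b < w i a" "w j a < w j b"
    unfolding not_le[symmetric] by blast
  then consider "i \<preceq> j" | "j \<preceq> i"
    using P_support_chain[OF x ij(1,2)] ij(3,4) by blast
  then show False
  proof cases
    case 1
    then have "w j b \<le> w j a"
      using K3_le_less_imp_le[OF _ _ ij(5)] ab unfolding dual_le_def by blast
    then show ?thesis using ij(6) by simp
  next
    case 2
    then have "w i a \<le> w i b"
      using K3_le_less_imp_le[OF _ _ ij(6)] ab unfolding dual_le_def by blast
    then show ?thesis using ij(5) by simp
  qed
qed

lemma lin_join:
  assumes x: "x \<in> P" and ab: "a \<in> carrier B" "b \<in> carrier B"
  shows "lin (k_join B a b) x = max (lin a x) (lin b x)"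
proof -
  have join: "w i (k_join B a b) = max (w i a) (w i b)" if "i < d" for i
    using dual_pointD(2)[OF w_dual[OF that] ab] .
  show ?thesis
    using comparable_on_support[OF assms]
  proof
    assume w_le: "\<forall>i<d. x i \<noteq> 0 \<longrightarrow> w i a \<le> w i b"
    then have "lin (k_join B a b) x = lin b x"
      by (intro lin_cong) (simp add: join)
    then show ?thesis using lin_mono[OF x, of a b] w_le by simp
  next
    assume w_le: "\<forall>i<d. x i \<noteq> 0 \<longrightarrow> w i b \<le> w i a"
    then have "lin (k_join B a b) x = lin a x"
      by (intro lin_cong) (simp add: join)
    then show ?thesis using lin_mono[OF x, of b a] w_le by simp
  qed
qed

lemma lin_neg:
  assumes "x \<in> P" "b \<in> carrier B"
  shows "lin (k_neg B b) x = 1 - lin b x"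
proof -
  have neg: "w i (k_neg B b) = 1 - w i b" if "i < d" for i
    using dual_pointD(4)[OF w_dual[OF that] assms(2)] .
  have "lin (k_neg B b) x = (\<Sum>i<d. \<omega> i * x i - \<omega> i * w i b * x i)"
    unfolding lin_def by (intro sum.cong) (auto simp: neg algebra_simps)
  then show ?thesis
    using P_weighted_sum[OF assms(1)] by (simp add: sum_subtractf lin_def)
qed

lemma lin_zero: "lin (k_zero B) x = 0"
  using dual_pointD(5)[OF w_dual] by (simp add: lin_def)

lemma lin_nonneg:
  assumes "x \<in> P" "b \<in> carrier B"
  shows "0 \<le> lin b x"
  unfolding lin_def
proof (rule sum_nonneg)
  fix i assume "i \<in> {..<d}"
  then have "0 \<le> w i b" "0 \<le> x i"
    using dual_pointD(1)[OF w_dual assms(2), of i] P_nonneg[OF assms(1)] by auto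
  then show "0 \<le> \<omega> i * w i b * x i" by simp
qed

lemma lin_le_one: "x \<in> P \<Longrightarrow> b \<in> carrier B \<Longrightarrow> lin b x \<le> 1"
  using lin_nonneg[of x "k_neg B b"] by (simp add: lin_neg neg_closed)

definition downset_sum :: "nat \<Rightarrow> (nat \<Rightarrow> real) \<Rightarrow> real" where
  "downset_sum i x = (\<Sum>j | j < d \<and> j \<preceq> i. x j)"

lemma exists_lin_eq_downset_sum:
  assumes "i < d"
  obtains c where "c \<in> carrier B" "lin c = downset_sum i"
proof -
  obtain c where c: "c \<in> carrier B"
    "\<And>h. h \<in> dual_points B \<Longrightarrow> h c = (if dual_le B h (w i) then 1 / dual_weight B h else 0)"
    using exists_principal_element[OF finite_carrier w_dual[OF assms]] by blast
  have "lin c x = (\<Sum>j<d. if j \<preceq> i then x j else 0)" for x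
    unfolding lin_def
    by (intro sum.cong) (auto simp: c(2)[OF w_dual] gr_implies_not0[OF dual_weight_pos])
  then have "lin c = downset_sum i"
    by (auto simp: downset_sum_def simp flip: sum.inter_filter)
  then show ?thesis
    using that c(1) by blast
qed

definition strictly_below :: "nat \<Rightarrow> nat set" where
  "strictly_below i = {k. k < d \<and> k \<preceq> i \<and> k \<noteq> i}"

lemma strictly_below_subset: "finite (strictly_below i)" "strictly_below i \<subseteq> {..<d}"
  by (auto simp: strictly_below_def)

lemma downset_subset_strictly_below:
  assumes "i < d" "k \<in> strictly_below i"
  shows "{j. j < d \<and> j \<preceq> k} \<subseteq> strictly_below i"
proof
  fix j assume j: "j \<in> {j. j < d \<and> j \<preceq> k}"
  moreover have "j \<noteq> i"
    using dual_le_antisym[OF w_dual w_dual, of i k] j assms bij_betw_imp_inj_on[OF enum]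
    by (auto simp: strictly_below_def inj_on_def)
  ultimately show "j \<in> strictly_below i"
    using assms(2) dual_le_trans by (auto simp: strictly_below_def)
qed

lemma downset_sum_le_sum_strictly_below:
  assumes "x \<in> P" "i < d" "k \<in> strictly_below i"
  shows "downset_sum k x \<le> sum x (strictly_below i)"
  unfolding downset_sum_def
  using downset_subset_strictly_below[OF assms(2,3)] strictly_below_subset[of i] P_nonneg[OF assms(1)]
  by (intro sum_mono2) auto

lemma exists_downset_sum_eq_sum_strictly_below:
  assumes x: "x \<in> P" and i: "i < d" and nonzero: "sum x (strictly_below i) \<noteq> 0"
  shows "\<exists>k\<in>strictly_below i. downset_sum k x = sum x (strictly_below i)"
proof -
  define T where "T = {j \<in> strictly_below i. x j \<noteq> 0}"
  have T: "finite T" "T \<subseteq> strictly_below i" "\<And>j. j \<in> T \<Longrightarrow> j < d \<and> x j \<noteq> 0"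
    using strictly_below_subset[of i] by (auto simp: T_def)
  have sum_T: "sum x (strictly_below i) = sum x T"
    using strictly_below_subset(1) by (intro sum.mono_neutral_right) (auto simp: T_def)
  have "totalp_on T (\<lambda>j k. j \<preceq> k)"
    using P_support_chain[OF x] T(3) unfolding totalp_on_def by blast
  moreover have "transp_on T (\<lambda>j k. j \<preceq> k)"
    using dual_le_trans unfolding transp_on_def by blast
  moreover have "T \<noteq> {}"
    using nonzero sum_T by auto
  ultimately obtain k where k: "k \<in> T" "\<And>j. j \<in> T \<Longrightarrow> j \<noteq> k \<Longrightarrow> j \<preceq> k"
    using Finite_Set.bex_greatest_element[OF T(1)] by blast
  have "downset_sum k x = sum x T"
    unfolding downset_sum_def
  proof (rule sum.mono_neutral_right)
    show "T \<subseteq> {j. j < d \<and> j \<preceq> k}"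
      using k T(3) dual_le_refl[OF w_dual, of k] by auto
    show "\<forall>j\<in>{j. j < d \<and> j \<preceq> k} - T. x j = 0"
      using downset_subset_strictly_below[OF i, of k] k(1) T(2) by (auto simp: T_def)
  qed simp
  then show ?thesis
    using sum_T k(1) T(2) by auto
qed

lemma Max_downset_sum_strictly_below:
  assumes "x \<in> P" "i < d"
  shows "(MAX q\<in>insert (\<lambda>_. 0) (downset_sum ` strictly_below i). q x) = sum x (strictly_below i)"
    (is "Max ?M = ?s")
proof (rule Max_eqI)
  have "0 \<le> ?s"
    using strictly_below_subset(2)[of i] P_nonneg[OF assms(1)] by (intro sum_nonneg) auto
  then show "y \<le> ?s" if "y \<in> ?M" for y
    using that downset_sum_le_sum_strictly_below[OF assms] by auto
  show "?s \<in> ?M"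
  proof (cases "?s = 0")
    case False
    then obtain k where "k \<in> strictly_below i" "downset_sum k x = ?s"
      using exists_downset_sum_eq_sum_strictly_below[OF assms] by blast
    then show ?thesis
      by (intro image_eqI[of _ _ "downset_sum k"]) simp_all
  qed simp
qed (simp add: strictly_below_subset)

lemma coordinate_eq:
  assumes "x \<in> P" and i: "i < d"
  shows "x i = max 0 (downset_sum i x -
    (MAX q\<in>insert (\<lambda>_. 0) (downset_sum ` strictly_below i). q x))"
proof -
  have "{j. j < d \<and> j \<preceq> i} = insert i (strictly_below i)"
    using dual_le_refl[OF w_dual[OF i]] i by (auto simp: strictly_below_def)
  moreover have "i \<notin> strictly_below i"
    by (simp add: strictly_below_def)
  ultimately have "downset_sum i x = x i + sum x (strictly_below i)"
    by (simp add: downset_sum_def strictly_below_subset)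
  then show ?thesis
    using P_nonneg[OF assms] unfolding Max_downset_sum_strictly_below[OF assms] by simp
qed

lemma represented_coordinate:
  assumes "mv_function_algebra P H"
    and lin: "\<And>b. b \<in> carrier B \<Longrightarrow> mv_function_algebra.represented P H (lin b)"
    and i: "i < d"
  shows "mv_function_algebra.represented P H (\<lambda>x. x i)"
proof -
  interpret mv_function_algebra P H by fact
  have downset: "represented (downset_sum k)" if "k < d" for k
    using exists_lin_eq_downset_sum[OF that] lin by metis
  have "represented (\<lambda>x. MAX q\<in>insert (\<lambda>_. 0) (downset_sum ` strictly_below i). q x)"
    using strictly_below_subset[of i]
    by (intro represented_Max) (auto intro: represented_zero downset)
  then have "represented (\<lambda>x. max 0 (downset_sum i x -
      (MAX q\<in>insert (\<lambda>_. 0) (downset_sum ` strictly_below i). q x)))"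
    by (intro represented_diff downset i)
  then show ?thesis
    by (rule represented_cong[THEN iffD1, rotated]) (rule coordinate_eq[OF _ i, symmetric])
qed

end

section \<open>The isomorphism\<close>

lemma zmap_algebra_ops:
  "mv_add (zmap_algebra d X) f g = (\<lambda>x\<in>X. min (f x + g x) 1)"
  "mv_neg (zmap_algebra d X) f = (\<lambda>x\<in>X. 1 - f x)"
  "mv_zero (zmap_algebra d X) = (\<lambda>x\<in>X. 0)"
  by (simp_all add: zmap_algebra_def)

lemma zmap_algebra_join:
  assumes "f \<in> carrier (zmap_algebra d X)" "g \<in> carrier (zmap_algebra d X)"
  shows "mv_join (zmap_algebra d X) f g = (\<lambda>x\<in>X. max (f x) (g x))"
  using assms by (auto simp: mv_join_def zmap_algebra_ops) (auto simp: zmap_algebra_def fun_eq_iff image_subset_iff)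

lemma mv_function_algebra_hom_image:
  assumes "mv_algebra A" and h: "h \<in> mv_hom A (zmap_algebra d X)"
  shows "mv_function_algebra X (h ` carrier A)"
proof
  interpret mv_algebra A by fact
  note hom = mv_homD[OF h]
  show "0 \<le> f x \<and> f x \<le> 1" if "f \<in> h ` carrier A" "x \<in> X" for f x
    using that hom(1) by (force simp: zmap_algebra_def image_subset_iff)
  show "(\<lambda>x\<in>X. 0) \<in> h ` carrier A"
    using imageI[OF zero_closed, of h] by (simp add: hom(4) zmap_algebra_ops)
  show "(\<lambda>x\<in>X. 1 - f x) \<in> h ` carrier A" if f: "f \<in> h ` carrier A" for f
  proof -
    obtain u where u: "u \<in> carrier A" "f = h u"
      using f by blast
    then show ?thesis
      using imageI[OF neg_closed[OF u(1)], of h] by (simp add: hom(3) zmap_algebra_ops)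
  qed
  show "(\<lambda>x\<in>X. min (f x + g x) 1) \<in> h ` carrier A" if fg: "f \<in> h ` carrier A" "g \<in> h ` carrier A" for f g
  proof -
    obtain u v where uv: "u \<in> carrier A" "f = h u" "v \<in> carrier A" "g = h v"
      using fg by blast
    then show ?thesis
      using imageI[OF add_closed[OF uv(1,3)], of h] by (simp add: hom(2) zmap_algebra_ops)
  qed
qed

context dual_kleene_space
begin

abbreviation Z where "Z \<equiv> zmap_algebra d P"

definition lin_map :: "'a \<Rightarrow> (nat \<Rightarrow> real) \<Rightarrow> real" where
  "lin_map = (\<lambda>b\<in>carrier B. restrict (lin b) P)"

lemma lin_map_kleene_hom: "lin_map \<in> kleene_hom B (underlying_kleene Z)"
proof -
  have closed: "lin_map b \<in> carrier Z" if "b \<in> carrier B" for b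
    using that lin_int_piecewise_linear lin_nonneg lin_le_one by (auto simp: lin_map_def zmap_algebra_def)
  have neg: "lin_map (k_neg B b) = mv_neg Z (lin_map b)" if "b \<in> carrier B" for b
    using that by (auto simp: lin_map_def zmap_algebra_ops lin_neg neg_closed)
  have join: "lin_map (k_join B a b) = mv_join Z (lin_map a) (lin_map b)"
    if "a \<in> carrier B" "b \<in> carrier B" for a b
    unfolding zmap_algebra_join[OF closed[OF that(1)] closed[OF that(2)]]
    using that by (auto simp: lin_map_def lin_join join_closed)
  have meet: "lin_map (k_meet B a b) = mv_meet Z (lin_map a) (lin_map b)"
    if "a \<in> carrier B" "b \<in> carrier B" for a b
  proof -
    have "k_meet B a b = k_neg B (k_join B (k_neg B a) (k_neg B b))"
      using that de_morgan[of a b] neg_neg[of "k_meet B a b"] by (simp add: meet_closed)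
    then show ?thesis
      using that by (simp add: mv_meet_def neg join neg_closed join_closed)
  qed
  have zero: "lin_map (k_zero B) = mv_zero Z"
    by (auto simp: lin_map_def zmap_algebra_ops lin_zero zero_closed)
  have one: "lin_map (k_one B) = mv_one Z"
    using neg[OF zero_closed] by (simp add: neg_zero zero mv_one_def)
  show ?thesis
    using closed neg join meet zero one
    by (auto simp: kleene_hom_def underlying_kleene_def lin_map_def)
qed

lemma mv_eval_lin_map:
  assumes "x \<in> P" "s \<in> carrier (kleene_terms B)"
  shows "mv_eval Z lin_map s x = mv_eval unit_interval (\<lambda>b. lin b x) s"
  using assms(2) by (induction s) (simp_all add: assms(1) lin_map_def zmap_algebra_ops)

lemma inj_on_free_mv_if_extends_lin_map:
  assumes h: "h \<in> mv_hom (free_mv B) Z"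
    and unit: "\<And>b. b \<in> carrier B \<Longrightarrow> h (free_mv_unit B b) = lin_map b"
  shows "inj_on h (carrier (free_mv B))"
proof (rule inj_onI, rule ccontr)
  have B: "kleene_algebra B" by unfold_locales
  have lin_map: "(\<lambda>b\<in>carrier B. h (free_mv_unit B b)) = lin_map"
    using unit by (auto simp: lin_map_def fun_eq_iff)
  have h_class: "h (free_mv_cong B `` {u}) x = mv_eval unit_interval (\<lambda>b. lin b x) u"
    if "u \<in> carrier (kleene_terms B)" "x \<in> P" for u x
    unfolding mv_hom_free_mv_class[OF B h that(1)] lin_map by (rule mv_eval_lin_map[OF that(2,1)])
  fix X Y assume X: "X \<in> carrier (free_mv B)" and Y: "Y \<in> carrier (free_mv B)" and "h X = h Y" "X \<noteq> Y"
  obtain s where s: "s \<in> carrier (kleene_terms B)" "X = free_mv_cong B `` {s}"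
    by (rule free_mv_carrierE[OF B X])
  obtain t where t: "t \<in> carrier (kleene_terms B)" "Y = free_mv_cong B `` {t}"
    by (rule free_mv_carrierE[OF B Y])
  have "free_mv_cong B `` {s} \<noteq> free_mv_cong B `` {t}"
    using \<open>X \<noteq> Y\<close> s(2) t(2) by simp
  then obtain \<phi> where \<phi>: "\<phi> \<in> kleene_hom B (underlying_kleene unit_interval)"
    and neq: "mv_eval unit_interval \<phi> s \<noteq> mv_eval unit_interval \<phi> t"
    by (rule free_mv_separated[OF B finite_carrier s(1) t(1)])
  obtain x where x: "x \<in> P" "\<And>b. b \<in> carrier B \<Longrightarrow> lin b x = \<phi> b"
    using kleene_hom_unit_interval_is_point[OF \<phi>] by blast
  have eval: "h (free_mv_cong B `` {u}) x = mv_eval unit_interval \<phi> u" if "u \<in> carrier (kleene_terms B)" for u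
    unfolding h_class[OF that x(1)] by (rule mv_eval_cong[OF that x(2)])
  show False
    using neq \<open>h X = h Y\<close> eval[OF s(1)] eval[OF t(1)] by (simp add: s(2) t(2))
qed

lemma image_free_mv_if_extends_lin_map:
  assumes h: "h \<in> mv_hom (free_mv B) Z"
    and unit: "\<And>b. b \<in> carrier B \<Longrightarrow> h (free_mv_unit B b) = lin_map b"
  shows "h ` carrier (free_mv B) = carrier Z"
proof
  show "h ` carrier (free_mv B) \<subseteq> carrier Z"
    using mv_homD(1)[OF h] by blast
  have B: "kleene_algebra B" by unfold_locales
  interpret mv_function_algebra P "h ` carrier (free_mv B)"
    by (rule mv_function_algebra_hom_image[OF mv_algebra_free_mv[OF B] h])
  have "represented (lin b)" if "b \<in> carrier B" for b
  proof -
    have "restrict (lin b) P = h (free_mv_unit B b)"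
      using unit that by (simp add: lin_map_def)
    moreover have "free_mv_unit B b \<in> carrier (free_mv B)"
      using that by (simp add: free_mv_unit_def free_mv_class_closed[OF B])
    ultimately show ?thesis
      by (simp add: represented_def)
  qed
  then have "represented (\<lambda>x. x i)" if "i < d" for i
    by (rule represented_coordinate[OF mv_function_algebra_axioms _ that])
  then have "represented f" if "int_piecewise_linear d f" "f ` P \<subseteq> {0..1}" for f
    using represented_int_piecewise_linear[OF mv_function_algebra_axioms _ P_subset_Euclidean_space that] by blast
  then show "carrier Z \<subseteq> h ` carrier (free_mv B)"
    by (auto simp: zmap_algebra_def represented_def)
qed

end

theorem theoremI:
  fixes B :: "'a kleene" and w :: "nat \<Rightarrow> ('a \<Rightarrow> real)" and d :: nat
  assumes "kleene_algebra B"
    and "finite (carrier B)"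
    and "bij_betw w {..<d} (dual_points B)"
  shows "mv_isomorphic (free_mv B)
           (zmap_algebra d
              (companion_polyhedron d w (nerve (dual_points B) (dual_le B)) (dual_weight B)))"
proof -
  interpret dual_kleene_space B w d
    using assms by (intro dual_kleene_space.intro dual_kleene_space_axioms.intro)
  obtain h where h: "h \<in> mv_hom (free_mv B) Z"
    and unit: "\<And>b. b \<in> carrier B \<Longrightarrow> h (free_mv_unit B b) = lin_map b"
    using free_mv_universal[OF assms(1) mv_algebra_zmap_algebra lin_map_kleene_hom] by blast
  have "bij_betw h (carrier (free_mv B)) (carrier Z)"
    unfolding bij_betw_def
    using inj_on_free_mv_if_extends_lin_map[OF h unit] image_free_mv_if_extends_lin_map[OF h unit] ..
  then show ?thesis
    unfolding mv_isomorphic_def using h by blast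
qed

end
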